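(* Let $c,d$ be positive integers, $\alpha,\delta\in(0,1]$, and let $C_0\subseteq\mathbb{F}_2^d$ be a linear code with minimum distance $d_0$, all regarded as constants, and assume $\delta d_0>2$. Then there is a deterministic algorithm which, given a $(c,d,\alpha,\delta)$-bipartite expander $G=(L\cup R,E)$ with $L=[n]$ (with fixed orderings of the neighborhoods $N(v)$, $v\in R$) and a word $x\in\mathbb{F}_2^n$ such that $d_H(x,y)\le\alpha n$ for some $y\in T(G,C_0)$, outputs $y$ in time $O(n)$. That is, the algorithm corrects up to $\alpha n$ errors for $T(G,C_0)$ in linear time.
   Context: All codes are binary linear codes; $d_H$ is Hamming distance and the minimum distance of a code is the least Hamming distance between two distinct codewords. A bipartite graph $G=(L\cup R,E)$ is $(c,d)$-regular if every vertex in $L$ has degree $c$ and every vertex in $R$ has degree $d$. For $S$ a set of vertices, $N(S)$ is the set of neighbors of $S$. A $(c,d,\alpha,\delta)$-bipartite expander is a $(c,d)$-regular bipartite graph such that $|N(S)|\ge\delta c|S|$ for every $S\subseteq L$ with $|S|\le\alpha|L|$. Tanner code: let $L=[n]$, $C_0\subseteq\mathbb{F}_2^d$ linear; for each $v\in R$ fix a total ordering $N(v,1),\dots,N(v,d)$ of $N(v)$ and for $x\in\mathbb{F}_2^n$ set $x_{N(v)}=(x_{N(v,1)},\dots,x_{N(v,d)})\in\mathbb{F}_2^d$. Then $T(G,C_0)=\{x\in\mathbb{F}_2^n: x_{N(v)}\in C_0\text{ for all }v\in R\}$. The parameters $c,d,\alpha,\delta,C_0$ are constants independent of $n$; the $O(\cdot)$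 is with respect to $n$ (constants may depend on $c,d,\alpha,\delta,C_0$). Running time is measured in the RAM model with the graph given by adjacency lists. *)

theory Defs
  imports Main "HOL.Real"
begin

definition xor_word :: "bool list \<Rightarrow> bool list \<Rightarrow> bool list" where
  "xor_word a b = map2 (\<noteq>) a b"

definition hamming :: "bool list \<Rightarrow> bool list \<Rightarrow> nat" where
  "hamming a b = card {i. i < length a \<and> a ! i \<noteq> b ! i}"

definition linear_code :: "nat \<Rightarrow> bool list set \<Rightarrow> bool" where
  "linear_code d C \<longleftrightarrow> C \<subseteq> {w. length w = d} \<and> replicate d False \<in> C \<and>
     (\<forall>a\<in>C. \<forall>b\<in>C. xor_word a b \<in> C)"

definition min_dist :: "bool list set \<Rightarrow> nat" where
  "min_dist C = Min {hamming a b | a b. a \<in> C \<and> b \<in> C \<and> a \<noteq> b}"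

definition bip_regular :: "nat \<Rightarrow> nat \<Rightarrow> (nat \<times> nat) set \<Rightarrow> nat \<Rightarrow> nat \<Rightarrow> bool" where
  "bip_regular n m E c d \<longleftrightarrow> E \<subseteq> {..<n} \<times> {..<m} \<and>
     (\<forall>i<n. card (E `` {i}) = c) \<and> (\<forall>v<m. card {i. (i, v) \<in> E} = d)"

definition bip_expander ::
  "nat \<Rightarrow> nat \<Rightarrow> (nat \<times> nat) set \<Rightarrow> nat \<Rightarrow> nat \<Rightarrow> real \<Rightarrow> real \<Rightarrow> bool" where
  "bip_expander n m E c d \<alpha> \<delta> \<longleftrightarrow> bip_regular n m E c d \<and>
     (\<forall>S. S \<subseteq> {..<n} \<and> real (card S) \<le> \<alpha> * real n \<longrightarrow>
          real (card (E `` S)) \<ge> \<delta> * real c * real (card S))"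

text \<open>Adjacency lists: nbL i j (j<c) lists N(i) for left vertices, nbR v k (k<d)
  is the fixed ordering N(v,k+1) of N(v) for right vertices.\<close>
definition adj_lists ::
  "nat \<Rightarrow> nat \<Rightarrow> (nat \<times> nat) set \<Rightarrow> nat \<Rightarrow> nat \<Rightarrow> (nat \<Rightarrow> nat \<Rightarrow> nat) \<Rightarrow> (nat \<Rightarrow> nat \<Rightarrow> nat) \<Rightarrow> bool" where
  "adj_lists n m E c d nbL nbR \<longleftrightarrow>
     (\<forall>i<n. bij_betw (nbL i) {..<c} (E `` {i})) \<and>
     (\<forall>v<m. bij_betw (nbR v) {..<d} {i. (i, v) \<in> E})"

definition tanner :: "nat \<Rightarrow> nat \<Rightarrow> nat \<Rightarrow> (nat \<Rightarrow> nat \<Rightarrow> nat) \<Rightarrow> bool list set \<Rightarrow> bool list set" where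
  "tanner n m d nbR C0 = {x. length x = n \<and> (\<forall>v<m. map (\<lambda>k. x ! nbR v k) [0..<d] \<in> C0)}"

section \<open>Unit-cost RAM model (integer cells, +, -, indirect addressing, branching)\<close>

datatype instr =
    Const nat int
  | Add nat nat nat
  | Sub nat nat nat
  | Load nat nat
  | Store nat nat
  | Jz nat nat
  | Jlt nat nat nat
  | Jmp nat
  | Halt

type_synonym config = "nat \<times> (nat \<Rightarrow> int)"

definition halted :: "instr list \<Rightarrow> config \<Rightarrow> bool" where
  "halted P cf \<longleftrightarrow> fst cf \<ge> length P \<or> P ! fst cf = Halt"

fun exec_instr :: "instr \<Rightarrow> config \<Rightarrow> config" where
  "exec_instr (Const r k) (pc, mem) = (Suc pc, mem(r := k))"
| "exec_instr (Add r a b) (pc, mem) = (Suc pc, mem(r := mem a + mem b))"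
| "exec_instr (Sub r a b) (pc, mem) = (Suc pc, mem(r := mem a - mem b))"
| "exec_instr (Load r a) (pc, mem) = (Suc pc, mem(r := mem (nat (mem a))))"
| "exec_instr (Store a r) (pc, mem) = (Suc pc, mem(nat (mem a) := mem r))"
| "exec_instr (Jz r l) (pc, mem) = (if mem r = 0 then l else Suc pc, mem)"
| "exec_instr (Jlt a b l) (pc, mem) = (if mem a < mem b then l else Suc pc, mem)"
| "exec_instr (Jmp l) (pc, mem) = (l, mem)"
| "exec_instr Halt (pc, mem) = (pc, mem)"

definition step :: "instr list \<Rightarrow> config \<Rightarrow> config" where
  "step P cf = (if halted P cf then cf else exec_instr (P ! fst cf) cf)"

definition bit_int :: "bool \<Rightarrow> int" where
  "bit_int b = (if b then 1 else 0)"

text \<open>Input layout: mem[0] = n, mem[1] = m, mem[2+i] = x_i (i<n),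
  mem[2+n+c*i+j] = nbL i j (i<n, j<c),
  mem[2+n+c*n+d*v+k] = nbR v k (v<m, k<d), all other cells 0.\<close>
definition input_mem ::
  "nat \<Rightarrow> nat \<Rightarrow> nat \<Rightarrow> nat \<Rightarrow> (nat \<Rightarrow> nat \<Rightarrow> nat) \<Rightarrow> (nat \<Rightarrow> nat \<Rightarrow> nat) \<Rightarrow> bool list \<Rightarrow> nat \<Rightarrow> int" where
  "input_mem c d n m nbL nbR x a =
     (if a = 0 then int n
      else if a = 1 then int m
      else if a < 2 + n then bit_int (x ! (a - 2))
      else if a < 2 + n + c * n then int (nbL ((a - 2 - n) div c) ((a - 2 - n) mod c))
      else if a < 2 + n + c * n + d * m then
        int (nbR ((a - 2 - n - c * n) div d) ((a - 2 - n - c * n) mod d))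
      else 0)"

end

theory Submission
  imports Defs Complex_Main
begin

text \<open>Let \<open>F\<close> be the set of wrong positions. Every constraint whose local word has distance
  \<open>t < D/2\<close> from the inner code, where \<open>D\<close> is the minimum distance, votes with weight \<open>D - 2 t\<close>
  for flipping one position in which it differs from the nearest inner codeword. Expansion and
  \<open>\<delta> D > 2\<close> make the votes for wrong positions outweigh the others by a constant times \<open>card F\<close>.
  There are only constantly many kinds of votes, classified by the local word \<open>w\<close>, the voted
  coordinate \<open>k\<close> and the place \<open>j\<close> of the constraint in the list of that position, so obeying all
  votes of a suitable kind shrinks \<open>F\<close> by a constant factor.

  The suitable kind is unknown, but after a constant number of rounds it need not be guessed:
  while \<open>card F\<close> is at most \<open>\<alpha> n\<close>, the number of violated constraints equals \<open>card F\<close> up to constant factors,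
  so once \<open>F\<close> is small enough, one can try all sequences of kinds of a fixed length, undo the
  failures and keep the first one that halves the number of violated constraints. A trial costs time
  proportional to that number, hence the total is linear. All initial sequences are tried as
  well, and the resulting codeword closest to the input is the answer, because it is unique.\<close>

section \<open>Structured programs for the RAM\<close>

text \<open>The error set is invisible to the machine, which sees only the number \<open>u\<close>
  of violated constraints. With at most \<alpha> n errors, a satisfied constraint next to an error
  sees at least \<open>D\<close> of them, and by \<delta> D > 2 such constraints cannot hide more
  than half of the expansion; so \<open>u\<close> is at least \<delta> c / 2 times the number of
  errors, and enough good rounds halve \<open>u\<close>. The obstacle is the converse: a sequence
  that halves \<open>u\<close> may still add errors, and beyond \<alpha> n errors the lower bound is
  lost. The slack factor \<open>growth\<close>, demanded of the word on which the descent starts,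
  rules this out; the initial sequences serve to reach that slack, and no test tells which of them
  did. A wrong one must therefore be harmless: on every word the descent halves \<open>u\<close> or
  stops, so its cost is always a geometric series. Finally, a rival codeword as close to the input
  as \<open>y\<close> may differ from \<open>y\<close> in 2 \<alpha> n positions, where expansion is
  not assumed; it is excluded by expanding only half of the difference.\<close>

type_synonym mem = "nat \<Rightarrow> int"

fun effect :: "instr \<Rightarrow> mem \<Rightarrow> mem" where
  "effect (Const r k) M = M(r := k)"
| "effect (Add r a b) M = M(r := M a + M b)"
| "effect (Sub r a b) M = M(r := M a - M b)"
| "effect (Load r a) M = M(r := M (nat (M a)))"
| "effect (Store a r) M = M(nat (M a) := M r)"
| "effect _ M = M"

fun basic :: "instr \<Rightarrow> bool" where
  "basic (Jz _ _) = False"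
| "basic (Jlt _ _ _) = False"
| "basic (Jmp _) = False"
| "basic Halt = False"
| "basic _ = True"

lemma exec_basic: "basic i \<Longrightarrow> exec_instr i (pc, M) = (Suc pc, effect i M)"
  by (cases i) auto

definition code_at :: "instr list \<Rightarrow> nat \<Rightarrow> instr list \<Rightarrow> bool" where
  "code_at P l is \<longleftrightarrow> (\<forall>i<length is. l + i < length P \<and> P ! (l + i) = is ! i)"

lemma code_at_Nil [simp]: "code_at P l []"
  by (simp add: code_at_def)

lemma code_at_Cons [simp]:
  "code_at P l (i # is) \<longleftrightarrow> l < length P \<and> P ! l = i \<and> code_at P (Suc l) is"
proof -
  have "(\<forall>k<Suc n. Q k) \<longleftrightarrow> Q 0 \<and> (\<forall>k<n. Q (Suc k))" for Q :: "nat \<Rightarrow> bool" and n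
    by (auto simp: less_Suc_eq_0_disj)
  then show ?thesis by (simp add: code_at_def)
qed

lemma code_at_append [simp]:
  "code_at P l (is @ js) \<longleftrightarrow> code_at P l is \<and> code_at P (l + length is) js"
  by (induction "is" arbitrary: l) auto

lemma code_at_self: "code_at P 0 P"
  by (simp add: code_at_def)

lemma step_at: "l < length P \<Longrightarrow> P ! l \<noteq> Halt \<Longrightarrow> step P (l, M) = exec_instr (P ! l) (l, M)"
  by (simp add: step_def halted_def)

lemma steps_halted: "halted P cf \<Longrightarrow> (step P ^^ k) cf = cf"
  by (induction k) (auto simp: step_def)

lemma steps_trans:
  "(step P ^^ k) cf = cf' \<Longrightarrow> (step P ^^ k') cf' = cf'' \<Longrightarrow> (step P ^^ (k + k')) cf = cf''"
  by (simp add: funpow_add add.commute[of k])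

lemma steps_Suc: "step P cf = cf' \<Longrightarrow> (step P ^^ k) cf' = cf'' \<Longrightarrow> (step P ^^ Suc k) cf = cf''"
  by (simp add: funpow_swap1)

lemma steps_block:
  "list_all basic is \<Longrightarrow> code_at P l is \<Longrightarrow>
    (step P ^^ length is) (l, M) = (l + length is, fold effect is M)"
proof (induction "is" arbitrary: l M)
  case (Cons i "is")
  then have "i \<noteq> Halt" by auto
  with Cons have "step P (l, M) = (Suc l, effect i M)"
    by (simp add: step_at exec_basic)
  moreover have "(step P ^^ length is) (Suc l, effect i M) = (Suc l + length is, fold effect is (effect i M))"
    using Cons by auto
  ultimately show ?case using steps_Suc by fastforce
qed simp

datatype lcom =
    Block "instr list"
  | Sq lcom lcom
  | If_lt nat nat lcom lcom
  | While_lt "instr list" nat nat lcom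

fun clen :: "lcom \<Rightarrow> nat" where
  "clen (Block is) = length is"
| "clen (Sq p q) = clen p + clen q"
| "clen (If_lt a b p q) = clen p + clen q + 2"
| "clen (While_lt is a b p) = length is + clen p + 3"

text \<open>Jump targets are absolute, hence the start address \<open>l\<close>. The length of the
  code does not depend on it, so \<open>clen\<close> predicts every target.\<close>

fun compile :: "nat \<Rightarrow> lcom \<Rightarrow> instr list" where
  "compile l (Block is) = is"
| "compile l (Sq p q) = compile l p @ compile (l + clen p) q"
| "compile l (If_lt a b p q) = Jlt a b (l + clen q + 2) # compile (Suc l) q @
     Jmp (l + clen q + 2 + clen p) # compile (l + clen q + 2) p"
| "compile l (While_lt is a b p) = is @ Jlt a b (l + length is + 2) #
     Jmp (l + length is + clen p + 3) # compile (l + length is + 2) p @ [Jmp l]"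

lemma length_compile [simp]: "length (compile l p) = clen p"
  by (induction p arbitrary: l) auto

text \<open>The step count is exact and includes the jumps of the compiled code: one for the first
  branch of a conditional, two for the second, two per loop iteration and two for leaving a
  loop.\<close>

inductive lrun :: "lcom \<Rightarrow> mem \<Rightarrow> nat \<Rightarrow> mem \<Rightarrow> bool" where
  Block: "list_all basic is \<Longrightarrow> lrun (Block is) M (length is) (fold effect is M)"
| Sq: "lrun p M k M' \<Longrightarrow> lrun q M' k' M'' \<Longrightarrow> lrun (Sq p q) M (k + k') M''"
| If_true: "M a < M b \<Longrightarrow> lrun p M k M' \<Longrightarrow> lrun (If_lt a b p q) M (Suc k) M'"
| If_false: "\<not> M a < M b \<Longrightarrow> lrun q M k M' \<Longrightarrow> lrun (If_lt a b p q) M (Suc (k + 1)) M'"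
| While_false: "list_all basic is \<Longrightarrow> M' = fold effect is M \<Longrightarrow> \<not> M' a < M' b \<Longrightarrow>
    lrun (While_lt is a b p) M (length is + 2) M'"
| While_true: "list_all basic is \<Longrightarrow> M' = fold effect is M \<Longrightarrow> M' a < M' b \<Longrightarrow>
    lrun p M' k M1 \<Longrightarrow> lrun (While_lt is a b p) M1 k' M2 \<Longrightarrow>
    lrun (While_lt is a b p) M (length is + Suc (k + Suc k')) M2"

lemma compile_correct:
  "lrun p M k M' \<Longrightarrow> code_at P l (compile l p) \<Longrightarrow> (step P ^^ k) (l, M) = (l + clen p, M')"
proof (induction p M k M' arbitrary: l rule: lrun.induct)
  case (Block "is" M)
  then show ?case by (simp add: steps_block)
next
  case (Sq p M k M' q k' M'')
  then have "(step P ^^ k) (l, M) = (l + clen p, M')"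
    and "(step P ^^ k') (l + clen p, M') = (l + clen p + clen q, M'')" by auto
  from steps_trans[OF this] show ?case by (simp add: add.assoc)
next
  case (If_true M a b p k M' q)
  then have s: "step P (l, M) = (l + clen q + 2, M)" by (simp add: step_at)
  have "(step P ^^ k) (l + clen q + 2, M) = (l + clen q + 2 + clen p, M')"
    using If_true by auto
  from steps_Suc[OF s this] show ?case by (simp add: algebra_simps)
next
  case (If_false M a b q k M' p)
  then have s: "step P (l, M) = (Suc l, M)" by (simp add: step_at)
  have r: "(step P ^^ k) (Suc l, M) = (Suc l + clen q, M')"
    using If_false by auto
  have "(step P ^^ 1) (Suc l + clen q, M') = (l + clen q + 2 + clen p, M')"
    using If_false.prems by (auto simp: step_at)
  from steps_Suc[OF s steps_trans[OF r this]] show ?case by (simp add: algebra_simps)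
next
  case (While_false "is" M' M a b p)
  have r: "(step P ^^ length is) (l, M) = (l + length is, M')"
    using While_false by (simp add: steps_block)
  have "(step P ^^ 2) (l + length is, M') = (l + length is + clen p + 3, M')"
    using While_false by (simp add: numeral_2_eq_2 step_at)
  from steps_trans[OF r this] show ?case by (simp add: algebra_simps)
next
  case (While_true "is" M' M a b p k M1 k' M2)
  have r: "(step P ^^ length is) (l, M) = (l + length is, M')"
    using While_true by (simp add: steps_block)
  have s: "step P (l + length is, M') = (l + length is + 2, M')"
    using While_true by (simp add: step_at)
  have r2: "(step P ^^ k) (l + length is + 2, M') = (l + length is + 2 + clen p, M1)"
    using While_true by auto
  have s2: "step P (l + length is + 2 + clen p, M1) = (l, M1)"
    using While_true.prems by (auto simp: step_at)
  have "(step P ^^ k') (l, M1) = (l + clen (While_lt is a b p), M2)"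
    using While_true by blast
  from steps_trans[OF r steps_Suc[OF s steps_trans[OF r2 steps_Suc[OF s2 this]]]]
  show ?case .
qed

text \<open>A halted configuration is a fixed point of \<open>step\<close>, so an upper bound
  \<open>T\<close> on the running time serves as an iteration count as well as the exact
  time.\<close>

lemma compile_halts:
  assumes "lrun p M k M'" "k \<le> T"
  shows "(step (compile 0 p) ^^ T) (0, M) = (clen p, M')" "halted (compile 0 p) (clen p, M')"
proof -
  show h: "halted (compile 0 p) (clen p, M')" by (simp add: halted_def)
  have "(step (compile 0 p) ^^ k) (0, M) = (clen p, M')"
    using compile_correct[OF assms(1) code_at_self] by simp
  from steps_trans[OF this steps_halted[OF h, of "T - k"]] assms(2)
  show "(step (compile 0 p) ^^ T) (0, M) = (clen p, M')" by simp
qed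

section \<open>A small language with named registers and infinite arrays\<close>

datatype reg = rN | rU | rLG | rU0 | rG | rBD | rH | rQ | rP | rI | rV | rT | rPP | rLL

text \<open>Cells 1 and 2 are scratch space of the translation, and cell 3 holds the base address
  of the arrays. The array cells are interleaved, so no array needs a length.\<close>

fun cell :: "reg \<Rightarrow> nat" where
  "cell rN = 0" | "cell rU = 4" | "cell rLG = 5" | "cell rU0 = 6" | "cell rG = 7"
| "cell rBD = 8" | "cell rH = 9" | "cell rQ = 10" | "cell rP = 11" | "cell rI = 12"
| "cell rV = 13" | "cell rT = 14" | "cell rPP = 15" | "cell rLL = 16"

datatype arr = aIN | aWD | aBEST | aPOS | aARR | aLOG

fun slot :: "arr \<Rightarrow> nat" where
  "slot aIN = 0" | "slot aWD = 1" | "slot aBEST = 2" | "slot aPOS = 3" | "slot aARR = 4"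
| "slot aLOG = 5"

lemma cell_inj [simp]: "cell r = cell r' \<longleftrightarrow> r = r'"
  by (cases r; cases r'; simp)

lemma cell_neq [simp]: "cell r \<noteq> 1" "cell r \<noteq> Suc 0" "cell r \<noteq> 2" "cell r \<noteq> 3" "1 \<noteq> cell r"
   "Suc 0 \<noteq> cell r" "2 \<noteq> cell r" "3 \<noteq> cell r"
  by (cases r; simp)+

lemma cell_le: "cell r \<le> 16"
  by (cases r; simp)

lemma slot_inj [simp]: "slot r = slot r' \<longleftrightarrow> r = r'"
  by (cases r; cases r'; simp)

lemma slot_less: "slot a < 6"
  by (cases a; simp)

lemma address_inj [simp]: "6 * i + slot a = 6 * j + slot b \<longleftrightarrow> i = j \<and> a = b"
  by (metis slot_inj slot_less mod_less mod_mult_self4 add_right_cancel mult_left_cancel zero_neq_numeral)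

text \<open>A constant plus a list of registers. Repeating a register multiplies it by a constant,
  which the machine cannot do in one instruction.\<close>

type_synonym lexp = "nat \<times> reg list"
type_synonym state = "(reg \<Rightarrow> nat) \<times> (arr \<Rightarrow> nat \<Rightarrow> nat)"

definition lin :: "(reg \<Rightarrow> nat) \<Rightarrow> lexp \<Rightarrow> nat" where
  "lin \<rho> e = fst e + sum_list (map \<rho> (snd e))"

datatype com =
    SKIP
  | LET reg lexp
  | GET reg arr lexp
  | PUT arr lexp lexp
  | DEC reg
  | Seq com com  (infixr ";;" 60)
  | IFLT lexp lexp com com
  | WHILE lexp lexp com

definition ld :: "nat \<Rightarrow> lexp \<Rightarrow> instr list" where
  "ld t e = Const t (int (fst e)) # map (\<lambda>r. Add t t (cell r)) (snd e)"

text \<open>Adding each register six times scales the index by the interleaving factor of the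
  arrays; cell 3 contributes the base address.\<close>

definition lda :: "nat \<Rightarrow> arr \<Rightarrow> lexp \<Rightarrow> instr list" where
  "lda t a e = Const t (int (6 * fst e + slot a)) # Add t t 3 #
     concat (map (\<lambda>r. replicate 6 (Add t t (cell r))) (snd e))"

text \<open>\<open>LET\<close> computes in scratch cell 1 and copies at the end, because the
  expression may mention the target. \<open>DEC\<close> tests for zero first: memory cells are
  integers, registers are naturals with truncated subtraction.\<close>

fun tr :: "com \<Rightarrow> lcom" where
  "tr SKIP = Block []"
| "tr (LET r e) = Block (ld 1 e @ [Const 2 0, Add (cell r) 1 2])"
| "tr (GET r a e) = Block (lda 1 a e @ [Load (cell r) 1])"
| "tr (PUT a e e') = Block (lda 1 a e @ ld 2 e' @ [Store 1 2])"
| "tr (DEC r) = Sq (Block [Const 1 0]) (If_lt 1 (cell r)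
     (Block [Const 1 1, Sub (cell r) (cell r) 1]) (Block []))"
| "tr (c1 ;; c2) = Sq (tr c1) (tr c2)"
| "tr (IFLT e e' c1 c2) = Sq (Block (ld 1 e @ ld 2 e')) (If_lt 1 2 (tr c1) (tr c2))"
| "tr (WHILE e e' c) = While_lt (ld 1 e @ ld 2 e') 1 2 (tr c)"

text \<open>Register cells are at most 16, so \<open>16 < B\<close> keeps the arrays off
  them.\<close>

definition rep :: "nat \<Rightarrow> state \<Rightarrow> mem \<Rightarrow> bool" where
  "rep B s M \<longleftrightarrow> 16 < B \<and> M 3 = int B \<and> (\<forall>r. M (cell r) = int (fst s r)) \<and>
     (\<forall>a i. M (B + (6 * i + slot a)) = int (snd s a i))"

lemma rep_scratch:
  assumes "rep B s M" "t = 1 \<or> t = 2"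
  shows "rep B s (M(t := k))"
  using assms by (auto simp: rep_def)

lemma basic_ld [simp]: "list_all basic (ld t e)"
  by (auto simp: ld_def list_all_iff)

lemma basic_lda [simp]: "list_all basic (lda t a e)"
  by (auto simp: lda_def list_all_iff)

lemma fold_effect_ld:
  assumes "rep B s M" "t = 1 \<or> t = 2"
  shows "fold effect (ld t e) M = M(t := int (lin (fst s) e))"
proof -
  have "fold effect (map (\<lambda>r. Add t t (cell r)) rs) (M(t := k)) =
      M(t := k + int (sum_list (map (fst s) rs)))" for rs k
  proof (induction rs arbitrary: k)
    case (Cons r rs)
    have "cell r \<noteq> t" "M (cell r) = int (fst s r)" using assms by (auto simp: rep_def)
    then have "effect (Add t t (cell r)) (M(t := k)) = M(t := k + int (fst s r))" by simp
    then show ?case by (simp only: list.map fold_simps Cons) (simp add: add.assoc)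
  qed simp
  from this[of "snd e" "int (fst e)"] show ?thesis by (simp add: ld_def lin_def)
qed

lemma fold_effect_lda:
  assumes "rep B s M" "t = 1 \<or> t = 2"
  shows "fold effect (lda t a e) M = M(t := int (B + (6 * lin (fst s) e + slot a)))"
proof -
  have *: "fold effect (concat (map (\<lambda>r. replicate 6 (Add t t (cell r))) rs)) (M(t := k)) =
      M(t := k + 6 * int (sum_list (map (fst s) rs)))" for rs k
  proof (induction rs arbitrary: k)
    case (Cons r rs)
    have "cell r \<noteq> t" "M (cell r) = int (fst s r)" using assms by (auto simp: rep_def)
    then have "fold effect (replicate q (Add t t (cell r))) (M(t := k)) =
        M(t := k + int q * int (fst s r))" for q
      by (induction q arbitrary: k) (simp_all add: algebra_simps)
    from this[of 6] show ?case
      by (simp only: list.map concat.simps fold_append o_apply Cons) (simp add: algebra_simps)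
  qed simp
  have "M 3 = int B" "t \<noteq> 3" using assms by (auto simp: rep_def)
  with *[of "snd e" "int (6 * fst e + slot a) + int B"] show ?thesis
    by (simp add: lda_def lin_def algebra_simps)
qed

section \<open>Timed weakest preconditions\<close>

text \<open>Total correctness with a time bound. As \<open>hwp\<close> is again a predicate on
  states, it can serve as a postcondition, which is how sequences and loops are composed; this needs
  the base address \<open>B\<close> to be the same before and after.\<close>

definition hwp :: "com \<Rightarrow> nat \<Rightarrow> (state \<Rightarrow> bool) \<Rightarrow> state \<Rightarrow> bool" where
  "hwp c t Q s \<longleftrightarrow> (\<forall>B M. rep B s M \<longrightarrow>
     (\<exists>k M' s'. lrun (tr c) M k M' \<and> k \<le> t \<and> rep B s' M' \<and> Q s'))"

lemma hwpI:
  assumes "\<And>B M. rep B s M \<Longrightarrow> \<exists>k M' s'. lrun (tr c) M k M' \<and> k \<le> t \<and> rep B s' M' \<and> Q s'"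
  shows "hwp c t Q s"
  using assms by (auto simp: hwp_def)

lemma hwp_mono: "hwp c t Q s \<Longrightarrow> (\<And>s'. Q s' \<Longrightarrow> Q' s') \<Longrightarrow> t \<le> t' \<Longrightarrow> hwp c t' Q' s"
  unfolding hwp_def by (meson le_trans)

lemma hwp_block:
  assumes "tr c = Block is" "list_all basic is" "length is \<le> t"
    and "\<And>B M. rep B s M \<Longrightarrow> rep B s' (fold effect is M)" and "Q s'"
  shows "hwp c t Q s"
  by (rule hwpI) (metis assms lrun.Block)

lemma hwp_SKIP: "Q s \<Longrightarrow> hwp SKIP 0 Q s"
  by (rule hwp_block) auto

fun atomic_update :: "com \<Rightarrow> state \<Rightarrow> state" where
  "atomic_update (LET r e) (\<rho>, \<sigma>) = (\<rho>(r := lin \<rho> e), \<sigma>)"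
| "atomic_update (GET r a e) (\<rho>, \<sigma>) = (\<rho>(r := \<sigma> a (lin \<rho> e)), \<sigma>)"
| "atomic_update (PUT a e e') (\<rho>, \<sigma>) = (\<rho>, \<sigma>(a := (\<sigma> a)(lin \<rho> e := lin \<rho> e')))"
| "atomic_update (DEC r) (\<rho>, \<sigma>) = (\<rho>(r := \<rho> r - 1), \<sigma>)"
| "atomic_update _ s = s"

text \<open>Two steps on top of the evaluation of both sides pay for the jumps of every construct: a
  conditional, a loop iteration or a loop exit needs at most two.\<close>

definition guard_cost :: "lexp \<Rightarrow> lexp \<Rightarrow> nat" where
  "guard_cost e e' = length (ld 1 e @ ld 2 e') + 2"

lemma hwp_LET:
  assumes "Q (atomic_update (LET r e) s)"
  shows "hwp (LET r e) (clen (tr (LET r e))) Q s"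
proof (rule hwp_block[where Q = Q, rotated 4, OF assms])
  obtain \<rho> \<sigma> where s: "s = (\<rho>, \<sigma>)" by fastforce
  fix B M assume r: "rep B s M"
  have "rep B (atomic_update (LET r e) s) (M(1 := int (lin \<rho> e), 2 := 0, cell r := int (lin \<rho> e)))"
    using r cell_le[of r] by (auto simp: rep_def s)
  then show "rep B (atomic_update (LET r e) s) (fold effect (ld 1 e @ [Const 2 0, Add (cell r) 1 2]) M)"
    by (simp add: fold_effect_ld[OF r] s)
qed auto

lemma hwp_GET:
  assumes "Q (atomic_update (GET r a e) s)"
  shows "hwp (GET r a e) (clen (tr (GET r a e))) Q s"
proof (rule hwp_block[where Q = Q, rotated 4, OF assms])
  obtain \<rho> \<sigma> where s: "s = (\<rho>, \<sigma>)" by fastforce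
  fix B M assume r: "rep B s M"
  have "rep B (atomic_update (GET r a e) s)
      (M(1 := int (B + (6 * lin \<rho> e + slot a)), cell r := int (\<sigma> a (lin \<rho> e))))"
    using r cell_le[of r] by (auto simp: rep_def s)
  moreover have "M (B + (6 * lin \<rho> e + slot a)) = int (\<sigma> a (lin \<rho> e))" "16 < B"
    using r by (auto simp: rep_def s)
  ultimately show "rep B (atomic_update (GET r a e) s) (fold effect (lda 1 a e @ [Load (cell r) 1]) M)"
    by (simp add: fold_effect_lda[OF r] s nat_add_distrib nat_mult_distrib)
qed auto

lemma hwp_PUT:
  assumes "Q (atomic_update (PUT a e e') s)"
  shows "hwp (PUT a e e') (clen (tr (PUT a e e'))) Q s"
proof (rule hwp_block[where Q = Q, rotated 4, OF assms])
  obtain \<rho> \<sigma> where s: "s = (\<rho>, \<sigma>)" by fastforce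
  fix B M assume r: "rep B s M"
  let ?M = "M(1 := int (B + (6 * lin \<rho> e + slot a)))"
  have r': "rep B s ?M" using rep_scratch[OF r] by blast
  have "B + (6 * lin \<rho> e + slot a) \<noteq> cell q" "cell q \<noteq> B + (6 * lin \<rho> e + slot a)"
    "B + (6 * lin \<rho> e + slot a) \<noteq> 3" for q
    using r cell_le[of q] by (auto simp: rep_def)
  then have "rep B (atomic_update (PUT a e e') s)
      (?M(2 := int (lin \<rho> e'), B + (6 * lin \<rho> e + slot a) := int (lin \<rho> e')))"
    using r by (auto simp: rep_def s)
  moreover have "nat (int B + (6 * int (lin \<rho> e) + int (slot a))) = B + (6 * lin \<rho> e + slot a)"
    by (simp add: nat_add_distrib nat_mult_distrib)
  ultimately show "rep B (atomic_update (PUT a e e') s) (fold effect (lda 1 a e @ ld 2 e' @ [Store 1 2]) M)"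
    using fold_effect_lda[OF r, of 1 a e] fold_effect_ld[OF r', of 2 e'] by (simp add: s)
qed auto

lemma hwp_DEC:
  assumes "Q (atomic_update (DEC r) s)"
  shows "hwp (DEC r) 5 Q s"
proof (rule hwpI)
  obtain \<rho> \<sigma> where s: "s = (\<rho>, \<sigma>)" by fastforce
  fix B M assume r: "rep B s M"
  let ?M = "M(1 := 0)"
  have b: "lrun (Block [Const 1 0]) M 1 ?M"
    using lrun.Block[of "[Const 1 0]" M] by simp
  have r1: "rep B s ?M" using rep_scratch[OF r] by blast
  have m: "M (cell r) = int (\<rho> r)" using r by (simp add: rep_def s)
  show "\<exists>k M' s'. lrun (tr (DEC r)) M k M' \<and> k \<le> 5 \<and> rep B s' M' \<and> Q s'"
  proof (cases "\<rho> r = 0")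
    case True
    then have "lrun (If_lt 1 (cell r) (Block [Const 1 1, Sub (cell r) (cell r) 1]) (Block [])) ?M 2 ?M"
      using lrun.If_false[OF _ lrun.Block[of "[]" ?M], of 1 "cell r"] m by (simp add: numeral_2_eq_2)
    from lrun.Sq[OF b this] have "lrun (tr (DEC r)) M 3 ?M" by (simp add: numeral_3_eq_3)
    moreover have "atomic_update (DEC r) s = s" using True by (auto simp: s)
    then have "Q s" using assms by simp
    moreover have "(3::nat) \<le> 5" by simp
    ultimately show ?thesis using r1 by blast
  next
    case False
    let ?is = "[Const 1 1, Sub (cell r) (cell r) 1]"
    let ?M' = "fold effect ?is ?M"
    have "?M 1 < ?M (cell r)" using False m by simp
    then have "lrun (If_lt 1 (cell r) (Block ?is) (Block [])) ?M (Suc (length ?is)) ?M'"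
      by (rule lrun.If_true[OF _ lrun.Block]) simp
    from lrun.Sq[OF b this] have "lrun (tr (DEC r)) M (1 + Suc (length ?is)) ?M'"
      unfolding tr.simps .
    moreover have "1 + Suc (length ?is) \<le> 5" by simp
    moreover have "rep B (atomic_update (DEC r) s) ?M'"
      using r False cell_le[of r] by (auto simp: rep_def s of_nat_diff)
    ultimately show ?thesis using assms by blast
  qed
qed

lemma hwp_Seq:
  assumes "hwp c1 t1 (\<lambda>s'. hwp c2 t2 Q s') s"
  shows "hwp (c1 ;; c2) (t1 + t2) Q s"
proof (rule hwpI)
  fix B M assume "rep B s M"
  then obtain k M' s' where 1: "lrun (tr c1) M k M'" "k \<le> t1" "rep B s' M'" "hwp c2 t2 Q s'"
    using assms unfolding hwp_def by blast
  then obtain k' M'' s'' where 2: "lrun (tr c2) M' k' M''" "k' \<le> t2" "rep B s'' M''" "Q s''"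
    unfolding hwp_def by blast
  show "\<exists>k M' s'. lrun (tr (c1 ;; c2)) M k M' \<and> k \<le> t1 + t2 \<and> rep B s' M' \<and> Q s'"
    using lrun.Sq[OF 1(1) 2(1)] 1 2 by (metis add_mono tr.simps(6))
qed

lemma fold_effect_guard:
  fixes e e' :: lexp
  assumes "rep B s M"
  defines "M' \<equiv> fold effect (ld 1 e @ ld 2 e') M"
  shows "rep B s M'" "M' 1 < M' 2 \<longleftrightarrow> lin (fst s) e < lin (fst s) e'"
proof -
  have r: "rep B s (M(1 := k))" for k using rep_scratch[OF assms(1)] by blast
  have "M' = M(1 := int (lin (fst s) e), 2 := int (lin (fst s) e'))"
    unfolding M'_def by (simp add: fold_effect_ld[OF assms(1)] fold_effect_ld[OF r] del: One_nat_def)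
  then show "rep B s M'" "M' 1 < M' 2 \<longleftrightarrow> lin (fst s) e < lin (fst s) e'"
    using rep_scratch[OF r] by auto
qed

lemma hwp_IFLT:
  assumes "lin (fst s) e < lin (fst s) e' \<Longrightarrow> hwp c1 t Q s"
    and "\<not> lin (fst s) e < lin (fst s) e' \<Longrightarrow> hwp c2 t Q s"
  shows "hwp (IFLT e e' c1 c2) (guard_cost e e' + t) Q s"
proof (rule hwpI)
  fix B M assume r: "rep B s M"
  let ?is = "ld 1 e @ ld 2 e'"
  let ?M = "fold effect ?is M"
  have b: "lrun (Block ?is) M (length ?is) ?M" by (rule lrun.Block) simp
  note g = fold_effect_guard[OF r, of e e']
  show "\<exists>k M' s'. lrun (tr (IFLT e e' c1 c2)) M k M' \<and> k \<le> guard_cost e e' + t \<and> rep B s' M' \<and> Q s'"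
  proof (cases "lin (fst s) e < lin (fst s) e'")
    case True
    then obtain k M' s' where k: "lrun (tr c1) ?M k M'" "k \<le> t" "rep B s' M'" "Q s'"
      using assms(1) g(1) unfolding hwp_def by blast
    have "lrun (tr (IFLT e e' c1 c2)) M (length ?is + Suc k) M'"
      using lrun.Sq[OF b lrun.If_true[OF _ k(1)]] g(2) True by simp
    moreover have "length ?is + Suc k \<le> guard_cost e e' + t"
      using k by (simp add: guard_cost_def)
    ultimately show ?thesis using k by blast
  next
    case False
    then obtain k M' s' where k: "lrun (tr c2) ?M k M'" "k \<le> t" "rep B s' M'" "Q s'"
      using assms(2) g(1) unfolding hwp_def by blast
    have "lrun (tr (IFLT e e' c1 c2)) M (length ?is + Suc (k + 1)) M'"
      using lrun.Sq[OF b lrun.If_false[OF _ k(1)]] g(2) False by simp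
    moreover have "length ?is + Suc (k + 1) \<le> guard_cost e e' + t"
      using k by (simp add: guard_cost_def)
    ultimately show ?thesis using k by blast
  qed
qed

lemma hwp_WHILE_done:
  assumes "\<not> lin (fst s) e < lin (fst s) e'" "Q s"
  shows "hwp (WHILE e e' c) (guard_cost e e') Q s"
proof (rule hwpI)
  fix B M assume r: "rep B s M"
  let ?is = "ld 1 e @ ld 2 e'"
  have "lrun (tr (WHILE e e' c)) M (length ?is + 2) (fold effect ?is M)"
    unfolding tr.simps using fold_effect_guard(2)[OF r, of e e'] assms
    by (intro lrun.While_false) auto
  then show "\<exists>k M' s'. lrun (tr (WHILE e e' c)) M k M' \<and> k \<le> guard_cost e e' \<and> rep B s' M' \<and> Q s'"
    unfolding guard_cost_def using fold_effect_guard(1)[OF r] assms by blast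
qed

lemma hwp_WHILE_step:
  assumes "lin (fst s) e < lin (fst s) e'" "hwp c t (\<lambda>s'. hwp (WHILE e e' c) t' Q s') s"
  shows "hwp (WHILE e e' c) (guard_cost e e' + t + t') Q s"
proof (rule hwpI)
  fix B M assume r: "rep B s M"
  let ?is = "ld 1 e @ ld 2 e'"
  let ?M = "fold effect ?is M"
  note g = fold_effect_guard[OF r, of e e']
  obtain k M' s' where k: "lrun (tr c) ?M k M'" "k \<le> t" "rep B s' M'" "hwp (WHILE e e' c) t' Q s'"
    using assms(2) g(1) unfolding hwp_def by blast
  then obtain k' M'' s'' where k': "lrun (tr (WHILE e e' c)) M' k' M''" "k' \<le> t'" "rep B s'' M''" "Q s''"
    unfolding hwp_def by blast
  have "lrun (tr (WHILE e e' c)) M (length ?is + Suc (k + Suc k')) M''"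
    unfolding tr.simps using g(2) assms(1) k(1) k'(1)
    by (intro lrun.While_true[where M' = ?M]) auto
  moreover have "length ?is + Suc (k + Suc k') \<le> guard_cost e e' + t + t'"
    using k k' by (simp add: guard_cost_def)
  ultimately show "\<exists>k M' s'. lrun (tr (WHILE e e' c)) M k M' \<and> k \<le> guard_cost e e' + t + t' \<and> rep B s' M' \<and> Q s'"
    using k' by blast
qed

text \<open>The invariant is indexed by the iteration number and decides the guard. Charging for
  \<open>N'\<close> instead of the true count \<open>N\<close> admits bounds that are known in
  advance.\<close>

lemma hwp_for:
  assumes "I 0 s" and "N \<le> N'"
    and guard: "\<And>k s. k \<le> N \<Longrightarrow> I k s \<Longrightarrow> lin (fst s) e < lin (fst s) e' \<longleftrightarrow> k < N"
    and body: "\<And>k s. k < N \<Longrightarrow> I k s \<Longrightarrow> hwp c t (I (Suc k)) s"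
  shows "hwp (WHILE e e' c) (N' * (guard_cost e e' + t) + guard_cost e e') (I N) s"
proof -
  have "hwp (WHILE e e' c) ((N - k) * (guard_cost e e' + t) + guard_cost e e') (I N) s"
    if "k \<le> N" "I k s" for k s
    using that
  proof (induction "N - k" arbitrary: k s)
    case 0
    then have "k = N" by simp
    with 0 guard[of k s] show ?case by (auto intro: hwp_WHILE_done)
  next
    case (Suc r)
    then have k: "k < N" "r = N - Suc k" by auto
    have "hwp (WHILE e e' c) (guard_cost e e' + t + (r * (guard_cost e e' + t) + guard_cost e e')) (I N) s"
    proof (rule hwp_WHILE_step)
      show "hwp c t (\<lambda>s'. hwp (WHILE e e' c) (r * (guard_cost e e' + t) + guard_cost e e') (I N) s') s"
        using body[OF k(1) Suc.prems(2)] by (rule hwp_mono) (use Suc k in auto)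
    qed (use guard[of k s] k Suc in auto)
    then show ?case by (simp add: Suc(2)[symmetric] algebra_simps)
  qed
  from this[of 0 s] assms(1) have "hwp (WHILE e e' c) (N * (guard_cost e e' + t) + guard_cost e e') (I N) s"
    by simp
  then show ?thesis by (rule hwp_mono) (use assms(2) in auto)
qed

section \<open>Loop-free commands: functional semantics and syntactic cost\<close>

fun loopfree :: "com \<Rightarrow> bool" where
  "loopfree (c1 ;; c2) = (loopfree c1 \<and> loopfree c2)"
| "loopfree (IFLT _ _ c1 c2) = (loopfree c1 \<and> loopfree c2)"
| "loopfree (WHILE _ _ _) = False"
| "loopfree _ = True"

fun sem :: "com \<Rightarrow> state \<Rightarrow> state" where
  "sem (c1 ;; c2) s = sem c2 (sem c1 s)"
| "sem (IFLT e e' c1 c2) s = (if lin (fst s) e < lin (fst s) e' then sem c1 s else sem c2 s)"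
| "sem c s = atomic_update c s"

fun cost :: "com \<Rightarrow> nat" where
  "cost (c1 ;; c2) = cost c1 + cost c2"
| "cost (IFLT e e' c1 c2) = guard_cost e e' + max (cost c1) (cost c2)"
| "cost (DEC r) = 5"
| "cost c = clen (tr c)"

lemma hwp_loopfree: "loopfree c \<Longrightarrow> Q (sem c s) \<Longrightarrow> hwp c (cost c) Q s"
proof (induction c arbitrary: s Q)
  case SKIP
  then show ?case using hwp_SKIP[of Q s] by simp
next
  case (LET r e)
  then show ?case using hwp_LET[of Q r e s] by simp
next
  case (GET r a e)
  then show ?case using hwp_GET[of Q r a e s] by simp
next
  case (PUT a e e')
  then show ?case using hwp_PUT[of Q a e e' s] by simp
next
  case (DEC r)
  then show ?case using hwp_DEC[of Q r s] by simp
next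
  case (Seq c1 c2)
  have "hwp c1 (cost c1) (\<lambda>s'. hwp c2 (cost c2) Q s') s"
    by (rule Seq.IH(1)) (use Seq in auto)
  then show ?case by (auto intro: hwp_Seq)
next
  case (IFLT e e' c1 c2)
  have "hwp c1 (max (cost c1) (cost c2)) Q s" if "lin (fst s) e < lin (fst s) e'"
    by (rule hwp_mono[OF IFLT.IH(1)]) (use that IFLT in auto)
  moreover have "hwp c2 (max (cost c1) (cost c2)) Q s" if "\<not> lin (fst s) e < lin (fst s) e'"
    by (rule hwp_mono[OF IFLT.IH(2)]) (use that IFLT in auto)
  ultimately show ?case by (auto intro: hwp_IFLT)
next
  case (WHILE e e' c)
  then show ?case by simp
qed

section \<open>The decoding program\<close>

lemma lin_pair [simp]: "lin \<rho> (k, rs) = k + sum_list (map \<rho> rs)"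
  by (simp add: lin_def)

abbreviation K :: "nat \<Rightarrow> lexp" where "K k \<equiv> (k, [])"
abbreviation V :: "reg \<Rightarrow> lexp" where "V r \<equiv> (0, [r])"

definition IFEQ :: "lexp \<Rightarrow> lexp \<Rightarrow> com \<Rightarrow> com \<Rightarrow> com" where
  "IFEQ e e' p q = IFLT e e' q (IFLT e' e q p)"

lemma IFEQ_simps [simp]:
  "sem (IFEQ e e' p q) s = (if lin (fst s) e = lin (fst s) e' then sem p s else sem q s)"
  "loopfree (IFEQ e e' p q) \<longleftrightarrow> loopfree p \<and> loopfree q"
  by (auto simp: IFEQ_def)

fun seqs :: "com list \<Rightarrow> com" where
  "seqs [] = SKIP"
| "seqs (p # ps) = p ;; seqs ps"

lemma sem_seqs_snoc [simp]: "sem (seqs (ps @ [p])) s = sem p (sem (seqs ps) s)"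
  by (induction ps arbitrary: s) auto

lemma loopfree_seqs [simp]: "loopfree (seqs ps) \<longleftrightarrow> (\<forall>p\<in>set ps. loopfree p)"
  by (induction ps) auto

section \<open>Sets with constant-time insertion and deletion\<close>

text \<open>A set is stored as an array \<open>A\<close> listing its \<open>U\<close> elements from index 1 on, together with
  the positions \<open>P\<close> of the elements in this array; position 0 marks the non-elements.\<close>

definition enum :: "(nat \<Rightarrow> nat) \<Rightarrow> (nat \<Rightarrow> nat) \<Rightarrow> nat \<Rightarrow> nat set \<Rightarrow> bool" where
  "enum A P U S \<longleftrightarrow> (\<forall>v. v \<in> S \<longleftrightarrow> P v \<noteq> 0) \<and> (\<forall>v\<in>S. P v \<le> U \<and> A (P v) = v) \<and>
     (\<forall>p. 1 \<le> p \<and> p \<le> U \<longrightarrow> A p \<in> S \<and> P (A p) = p)"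

lemma enum_insert:
  assumes "enum A P U S" "v \<notin> S"
  shows "enum (A(Suc U := v)) (P(v := Suc U)) (Suc U) (insert v S)"
proof -
  have S: "\<And>w. w \<in> S \<longleftrightarrow> P w \<noteq> 0" "\<And>w. w \<in> S \<Longrightarrow> P w \<le> U \<and> A (P w) = w"
    and A: "\<And>p. 1 \<le> p \<Longrightarrow> p \<le> U \<Longrightarrow> A p \<in> S \<and> P (A p) = p"
    using assms(1) unfolding enum_def by blast+
  show ?thesis
    unfolding enum_def
  proof (intro conjI ballI allI impI)
    show "w \<in> insert v S \<longleftrightarrow> (P(v := Suc U)) w \<noteq> 0" for w
      using S(1)[of w] by simp
  next
    fix w assume "w \<in> insert v S"
    then show "(P(v := Suc U)) w \<le> Suc U" "(A(Suc U := v)) ((P(v := Suc U)) w) = w"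
      using S(2)[of w] by (cases "w = v"; force)+
  next
    fix p assume p: "1 \<le> p \<and> p \<le> Suc U"
    show "(A(Suc U := v)) p \<in> insert v S" "(P(v := Suc U)) ((A(Suc U := v)) p) = p"
      using A[of p] p assms(2) by (cases "p = Suc U"; force)+
  qed
qed

text \<open>The last element \<open>A U\<close> fills the gap left by \<open>v\<close>. Clearing the
  position of \<open>v\<close> comes last, so that it prevails when \<open>v\<close> itself is the
  last element.\<close>

lemma enum_remove:
  assumes "enum A P U S" "v \<in> S"
  shows "enum (A(P v := A U)) ((P(A U := P v))(v := 0)) (U - 1) (S - {v})"
proof -
  have S: "\<And>w. w \<in> S \<longleftrightarrow> P w \<noteq> 0" "\<And>w. w \<in> S \<Longrightarrow> P w \<le> U \<and> A (P w) = w"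
    and A: "\<And>p. 1 \<le> p \<Longrightarrow> p \<le> U \<Longrightarrow> A p \<in> S \<and> P (A p) = p"
    using assms(1) unfolding enum_def by blast+
  have v: "P v \<noteq> 0" "P v \<le> U" "A (P v) = v"
    using S assms(2) by blast+
  have U: "1 \<le> U" using v by linarith
  with A have AU: "A U \<in> S" "P (A U) = U" by blast+
  show ?thesis
    unfolding enum_def
  proof (intro conjI ballI allI impI)
    show "w \<in> S - {v} \<longleftrightarrow> ((P(A U := P v))(v := 0)) w \<noteq> 0" for w
      by (cases "w = v"; cases "w = A U") (use S(1)[of w] AU(1) v(1) in simp_all)
  next
    fix w assume w: "w \<in> S - {v}"
    then have w': "w \<noteq> v" "P w \<le> U" "A (P w) = w" using S(2)[of w] by blast+
    have eq: "w = A U" if "P w = U" using that w'(3) by simp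
    show "((P(A U := P v))(v := 0)) w \<le> U - 1"
    proof (cases "w = A U")
      case True
      with w' AU(2) have "P v \<noteq> U" using v(3) by metis
      with v(2) True w' show ?thesis by simp
    next
      case False
      with eq w' show ?thesis by force
    qed
    have "P w \<noteq> P v" using w' v(3) by metis
    then show "(A(P v := A U)) (((P(A U := P v))(v := 0)) w) = w"
      using w' by (cases "w = A U") simp_all
  next
    fix p assume p: "1 \<le> p \<and> p \<le> U - 1"
    then have "p \<le> U" by linarith
    with A[of p] p have Ap: "A p \<in> S" "P (A p) = p" by blast+
    then have ne: "A p \<noteq> v" if "p \<noteq> P v" using that by metis
    have neU: "A p \<noteq> A U"
    proof
      assume "A p = A U"
      then have "p = U" using Ap(2) AU(2) by metis
      then show False using p U by linarith
    qed
    have neV: "A U \<noteq> v" if "p = P v"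
    proof
      assume "A U = v"
      then have "P v = U" using AU(2) by metis
      then show False using p U that by linarith
    qed
    have "(A(P v := A U)) p \<in> S - {v} \<and> ((P(A U := P v))(v := 0)) ((A(P v := A U)) p) = p"
    proof (cases "p = P v")
      case True
      then have "(A(P v := A U)) p = A U" by simp
      with True neV AU(1) show ?thesis by simp
    next
      case False
      then have "(A(P v := A U)) p = A p" by simp
      with ne[OF False] neU Ap show ?thesis by simp
    qed
    then show "(A(P v := A U)) p \<in> S - {v}"
      and "((P(A U := P v))(v := 0)) ((A(P v := A U)) p) = p" by blast+
  qed
qed

lemma enum_card:
  assumes "enum A P U S"
  shows "A ` {1..U} = S" "inj_on A {1..U}" "card S = U" "finite S"
proof -
  show 1: "A ` {1..U} = S"
  proof (intro equalityI subsetI)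
    fix v assume "v \<in> A ` {1..U}"
    then obtain p where "v = A p" "1 \<le> p" "p \<le> U" by auto
    then show "v \<in> S" using assms unfolding enum_def by blast
  next
    fix v assume "v \<in> S"
    then have "P v \<noteq> 0" "P v \<le> U" "A (P v) = v" using assms unfolding enum_def by blast+
    then have "P v \<in> {1..U}" "A (P v) = v" by simp_all
    then show "v \<in> A ` {1..U}" by (metis imageI)
  qed
  show 2: "inj_on A {1..U}"
  proof (rule inj_on_inverseI[of _ P])
    fix p assume "p \<in> {1..U}"
    then have "1 \<le> p" "p \<le> U" by simp_all
    then show "P (A p) = p" using assms unfolding enum_def by blast
  qed
  show "card S = U" using card_image[OF 2] 1 by simp
  show "finite S" using 1 by blast
qed

section \<open>The text of the program\<close>

type_synonym branch = "bool list \<times> nat \<times> nat"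

locale decoder =
  fixes c d :: nat and C0 :: "bool list set"
begin

definition branches :: "branch set" where
  "branches = {w. length w = d} \<times> {..<d} \<times> {..<c}"

text \<open>The cell of \<open>nbL i j\<close> with \<open>i\<close> in register \<open>rI\<close>, and below that of \<open>nbR v k\<close> with \<open>v\<close> in \<open>rV\<close>.\<close>

definition left_index :: "nat \<Rightarrow> lexp" where
  "left_index j = (2 + j, rN # replicate c rI)"

definition right_index :: "nat \<Rightarrow> lexp" where
  "right_index k = (2 + k, rN # replicate c rN @ replicate d rV)"

text \<open>A decision tree with one leaf per local word. The word is never stored, it is known from
  the place in the program text, so questions such as \<open>w \<in> C0\<close> are settled when the
  program is written.\<close>

fun viewcase :: "nat \<Rightarrow> bool list \<Rightarrow> (bool list \<Rightarrow> com) \<Rightarrow> com" where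
  "viewcase 0 w f = f w"
| "viewcase (Suc r) w f =
     GET rT aIN (right_index (length w)) ;; GET rT aWD (V rT) ;;
     IFLT (V rT) (K 1) (viewcase r (w @ [False]) f) (viewcase r (w @ [True]) f)"

definition ins :: com where
  "ins = IFLT (V rPP) (K 1)
     (LET rU (1, [rU]) ;; PUT aARR (V rU) (V rV) ;; PUT aPOS (V rV) (V rU)) SKIP"

definition del :: com where
  "del = IFLT (K 0) (V rPP)
     (GET rLL aARR (V rU) ;; PUT aARR (V rPP) (V rLL) ;; PUT aPOS (V rLL) (V rPP) ;;
      PUT aPOS (V rV) (K 0) ;; DEC rU) SKIP"

text \<open>\<open>rPP\<close> tells \<open>ins\<close> and \<open>del\<close> whether the
  constraint is already listed, so rechecking a constraint whose status did not change does
  nothing.\<close>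

definition refresh :: com where
  "refresh = GET rPP aPOS (V rV) ;; viewcase d [] (\<lambda>w. if w \<in> C0 then del else ins)"

definition flip :: com where
  "flip = GET rT aWD (V rI) ;; IFLT (V rT) (K 1) (PUT aWD (V rI) (K 1)) (PUT aWD (V rI) (K 0)) ;;
     seqs (map (\<lambda>j. GET rV aIN (left_index j) ;; refresh) [0..<c])"

text \<open>This serves both to carry out the positions just selected and, with \<open>rQ\<close>
  set to 0, to undo a whole trial: flips commute and are involutions, so the log may be replayed in
  its original order.\<close>

definition flips :: com where
  "flips = WHILE (V rQ) (V rLG) (GET rI aLOG (V rQ) ;; flip ;; LET rQ (1, [rQ]))"

definition select :: "branch \<Rightarrow> com" where
  "select = (\<lambda>(w, k, j). LET rP (1, [rP]) ;; GET rV aARR (V rP) ;;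
     viewcase d [] (\<lambda>w'. if w' = w then
       GET rI aIN (right_index k) ;; GET rT aIN (left_index j) ;;
       IFEQ (V rT) (V rV) (PUT aLOG (V rLG) (V rI) ;; LET rLG (1, [rLG])) SKIP
     else SKIP))"

text \<open>Selecting and flipping are separate passes, because flipping rearranges the list of
  violated constraints that the selection scans. \<open>rQ\<close> marks where the new part of the
  log begins.\<close>

definition round :: "branch \<Rightarrow> com" where
  "round p = LET rQ (V rLG) ;; LET rP (K 0) ;; WHILE (V rP) (V rU) (select p) ;; flips"

fun rounds :: "branch list \<Rightarrow> com" where
  "rounds [] = SKIP"
| "rounds (p # \<tau>) = round p ;; rounds \<tau>"

text \<open>\<open>rG\<close> controls the loop of \<open>descend\<close>. It becomes 0 both when no
  constraint is violated any more and when every trial has failed; \<open>attempt\<close> tells the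
  two apart by \<open>rU\<close>.\<close>

fun tries :: "branch list list \<Rightarrow> com" where
  "tries [] = LET rG (K 0)"
| "tries (\<tau> # ts) = LET rLG (K 0) ;; rounds \<tau> ;;
     IFLT (V rU0) (0, [rU, rU]) (LET rQ (K 0) ;; flips ;; tries ts) (LET rG (V rU))"

definition descend :: "branch list list \<Rightarrow> com" where
  "descend ts = WHILE (K 0) (V rG) (LET rU0 (V rU) ;; tries ts)"

text \<open>The input is loaded by flipping the positions where the working word differs from it.
  The list of violated constraints is thereby maintained, starting from the zero word, which
  violates none; the same code resets the word between attempts.\<close>

definition load_body :: com where
  "load_body = GET rT aIN (2, [rI]) ;; GET rPP aWD (V rI) ;; IFEQ (V rPP) (V rT) SKIP flip ;;
     LET rI (1, [rI])"

definition load :: com where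
  "load = LET rI (K 0) ;; WHILE (V rI) (V rN) load_body"

definition distance_body :: com where
  "distance_body = GET rT aIN (2, [rI]) ;; GET rPP aWD (V rI) ;;
     IFEQ (V rPP) (V rT) SKIP (LET rH (1, [rH])) ;; LET rI (1, [rI])"

definition distance :: com where
  "distance = LET rH (K 0) ;; LET rI (K 0) ;; WHILE (V rI) (V rN) distance_body"

definition save_body :: com where
  "save_body = GET rT aWD (V rI) ;; PUT aBEST (V rI) (V rT) ;; LET rI (1, [rI])"

definition save :: com where
  "save = LET rI (K 0) ;; WHILE (V rI) (V rN) save_body"

definition attempt :: "branch list list \<Rightarrow> branch list \<Rightarrow> com" where
  "attempt ts \<tau> = load ;; LET rLG (K 0) ;; rounds \<tau> ;; LET rG (V rU) ;; descend ts ;;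
     IFLT (V rU) (K 1) (distance ;; IFLT (V rH) (V rBD) (LET rBD (V rH) ;; save) SKIP) SKIP"

definition decode :: "branch list list \<Rightarrow> branch list list \<Rightarrow> com" where
  "decode ts ts1 = LET rU (K 0) ;; LET rLG (K 0) ;; LET rBD (1, [rN]) ;; seqs (map (attempt ts) ts1)"

section \<open>Time bounds\<close>

definition flips_unit :: nat where
  "flips_unit = guard_cost (V rQ) (V rLG) + cost (GET rI aLOG (V rQ) ;; flip ;; LET rQ (1, [rQ]))"

definition round_cost :: "branch \<Rightarrow> nat" where
  "round_cost p = clen (tr (LET rQ (V rLG))) + clen (tr (LET rP (K 0))) +
     2 * guard_cost (V rP) (V rU) + cost (select p) + flips_unit + guard_cost (V rQ) (V rLG)"

text \<open>Costs are per unit of \<open>u x + 1\<close>. A round may multiply the number of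
  violated constraints by \<open>1 + c\<close>, see \<open>u_app\<close>, and all later rounds pay
  this factor.\<close>

fun rounds_cost :: "branch list \<Rightarrow> nat" where
  "rounds_cost [] = 0"
| "rounds_cost (p # \<tau>) = round_cost p + rounds_cost \<tau> * (1 + c)"

fun log_bound :: "branch list \<Rightarrow> nat" where
  "log_bound [] = 0"
| "log_bound (p # \<tau>) = 1 + log_bound \<tau> * (1 + c)"

fun tries_cost :: "branch list list \<Rightarrow> nat" where
  "tries_cost [] = clen (tr (LET rG (K 0)))"
| "tries_cost (\<tau> # ts) = clen (tr (LET rLG (K 0))) + rounds_cost \<tau> + guard_cost (V rU0) (0, [rU, rU]) +
     clen (tr (LET rQ (K 0))) + log_bound \<tau> * flips_unit + guard_cost (V rQ) (V rLG) +
     clen (tr (LET rG (V rU))) + tries_cost ts"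

text \<open>The outer factor 2 is the sum of the geometric series of halvings, the inner one absorbs
  \<open>u x + 1 \<le> 2 * u x\<close> for \<open>u x \<noteq> 0\<close>.\<close>

definition descend_cost :: "branch list list \<Rightarrow> nat" where
  "descend_cost ts = 2 * (2 * (clen (tr (LET rU0 (V rU))) + tries_cost ts) + guard_cost (K 0) (V rG))"

definition attempt_cost :: "branch list list \<Rightarrow> branch list \<Rightarrow> nat" where
  "attempt_cost ts \<tau> = sum_list (map (\<lambda>p. clen (tr p))
       [LET rI (K 0), LET rI (K 0), LET rI (K 0), LET rLG (K 0), LET rG (V rU), LET rH (K 0), LET rBD (V rH)]) +
     6 * guard_cost (V rI) (V rN) + cost load_body + cost distance_body + cost save_body +
     rounds_cost \<tau> * (1 + c) + descend_cost ts * c + guard_cost (K 0) (V rG) +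
     guard_cost (V rU) (K 1) + guard_cost (V rH) (V rBD)"

definition decode_cost :: "branch list list \<Rightarrow> branch list list \<Rightarrow> nat" where
  "decode_cost ts ts1 = sum_list (map (\<lambda>p. clen (tr p)) [LET rU (K 0), LET rLG (K 0), LET rBD (1, [rN])]) +
     sum_list (map (attempt_cost ts) ts1)"

lemma loopfree_viewcase: "(\<And>w. loopfree (f w)) \<Longrightarrow> loopfree (viewcase r w f)"
  by (induction r arbitrary: w) auto

lemma loopfree_refresh: "loopfree refresh"
  by (auto simp: refresh_def ins_def del_def intro!: loopfree_viewcase)

lemma loopfree_flip: "loopfree flip"
  by (auto simp: flip_def loopfree_refresh)

lemma loopfree_bodies: "loopfree load_body" "loopfree distance_body" "loopfree save_body"
  by (auto simp: load_body_def distance_body_def save_body_def loopfree_flip)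

lemma loopfree_select: "loopfree (select p)"
  by (cases p) (auto simp: select_def intro!: loopfree_viewcase)

end

section \<open>Violated constraints and rounds on a fixed graph and input\<close>

text \<open>Only regularity enters here, not expansion, so semantics and time bounds cover words far
  from the code, too. Words are total functions that are False from \<open>n\<close> on; the edge
  set survives only as the agreement of the two families of lists.\<close>

locale decoder_run = decoder +
  fixes n m :: nat and nbL nbR :: "nat \<Rightarrow> nat \<Rightarrow> nat" and inp :: "nat \<Rightarrow> bool"
  assumes nbL_less: "i < n \<Longrightarrow> j < c \<Longrightarrow> nbL i j < m"
    and nbR_less: "v < m \<Longrightarrow> k < d \<Longrightarrow> nbR v k < n"
    and adjacent: "i < n \<Longrightarrow> v < m \<Longrightarrow> (\<exists>j<c. nbL i j = v) \<longleftrightarrow> (\<exists>k<d. nbR v k = i)"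
    and edges: "c * n = d * m" "0 < d"
    and inp_less: "inp i \<Longrightarrow> i < n"
    and zero_code: "replicate d False \<in> C0"
begin

definition view :: "(nat \<Rightarrow> bool) \<Rightarrow> nat \<Rightarrow> bool list" where
  "view x v = map (\<lambda>k. x (nbR v k)) [0..<d]"

definition unsat :: "(nat \<Rightarrow> bool) \<Rightarrow> nat set" where
  "unsat x = {v. v < m \<and> view x v \<notin> C0}"

abbreviation u :: "(nat \<Rightarrow> bool) \<Rightarrow> nat" where
  "u x \<equiv> card (unsat x)"

definition tog :: "nat \<Rightarrow> (nat \<Rightarrow> bool) \<Rightarrow> nat \<Rightarrow> bool" where
  "tog i x = x(i := \<not> x i)"

text \<open>Fixing the place \<open>j\<close> of the constraint among the neighbors of the flipped position ensures
  that no position is flipped twice in a round.\<close>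

definition flipset :: "branch \<Rightarrow> (nat \<Rightarrow> bool) \<Rightarrow> nat set" where
  "flipset = (\<lambda>(w, k, j) x. {nbR v k |v. v \<in> unsat x \<and> view x v = w \<and> nbL (nbR v k) j = v})"

definition app :: "branch \<Rightarrow> (nat \<Rightarrow> bool) \<Rightarrow> nat \<Rightarrow> bool" where
  "app p x = (\<lambda>i. if i \<in> flipset p x then \<not> x i else x i)"

lemma finite_unsat [simp]: "finite (unsat x)"
  by (simp add: unsat_def)

lemma u_le: "u x \<le> m"
  using card_mono[of "{..<m}" "unsat x"] by (auto simp: unsat_def)

lemma tog_tog: "tog i (tog i x) = x"
  by (auto simp: tog_def)

lemma tog_commute: "tog i (tog j x) = tog j (tog i x)"
  by (rule ext) (auto simp: tog_def)

lemma fold_tog_tog: "fold tog l (tog i x) = tog i (fold tog l x)"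
  by (induction l arbitrary: x) (auto simp: tog_commute[of _ i])

lemma fold_tog_fold_tog: "fold tog l (fold tog l x) = x"
  by (induction l arbitrary: x) (auto simp: fold_tog_tog tog_tog)

lemma fold_tog_distinct:
  "distinct l \<Longrightarrow> fold tog l x = (\<lambda>i. if i \<in> set l then \<not> x i else x i)"
proof (induction l arbitrary: x)
  case (Cons i l)
  then show ?case by (auto simp: fold_tog_tog) (auto simp: tog_def)
qed simp

lemma finite_flipset [simp]: "finite (flipset p x)"
  and card_flipset: "card (flipset p x) \<le> u x"
proof -
  obtain w k j where p: "p = (w, k, j)" by (cases p)
  have "flipset p x = (\<lambda>v. nbR v k) ` {v \<in> unsat x. view x v = w \<and> nbL (nbR v k) j = v}"
    by (auto simp: flipset_def p)
  moreover have "{v \<in> unsat x. view x v = w \<and> nbL (nbR v k) j = v} \<subseteq> unsat x" by auto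
  ultimately have "flipset p x \<subseteq> (\<lambda>v. nbR v k) ` unsat x" by blast
  then show "finite (flipset p x)" "card (flipset p x) \<le> u x"
    using surj_card_le[OF finite_unsat] finite_surj[OF finite_unsat] by auto
qed

lemma flipset_less: "p \<in> branches \<Longrightarrow> i \<in> flipset p x \<Longrightarrow> i < n"
  by (auto simp: flipset_def branches_def unsat_def nbR_less)

text \<open>A newly violated constraint contains a flipped position. Every violated constraint flips
  at most one position, and a position lies in \<open>c\<close> constraints.\<close>

lemma u_app:
  assumes "p \<in> branches"
  shows "u (app p x) \<le> (1 + c) * u x"
proof -
  let ?A = "flipset p x"
  have "unsat (app p x) \<subseteq> unsat x \<union> (\<Union>i\<in>?A. nbL i ` {..<c})"
  proof
    fix v assume v: "v \<in> unsat (app p x)"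
    show "v \<in> unsat x \<union> (\<Union>i\<in>?A. nbL i ` {..<c})"
    proof (rule ccontr)
      assume *: "\<not> ?thesis"
      have "nbR v k \<notin> ?A" if k: "k < d" for k
      proof
        assume A: "nbR v k \<in> ?A"
        have "v < m" using v by (simp add: unsat_def)
        then obtain j where "j < c" "nbL (nbR v k) j = v"
          using adjacent[of "nbR v k" v] nbR_less[of v k] k by blast
        then have "v \<in> nbL (nbR v k) ` {..<c}" by force
        with A * show False by blast
      qed
      then have "view (app p x) v = view x v" by (auto simp: view_def app_def)
      with v * show False by (auto simp: unsat_def)
    qed
  qed
  then have "u (app p x) \<le> card (unsat x \<union> (\<Union>i\<in>?A. nbL i ` {..<c}))"
    by (rule card_mono[rotated]) auto
  also have "\<dots> \<le> u x + card (\<Union>i\<in>?A. nbL i ` {..<c})" by (rule card_Un_le)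
  also have "card (\<Union>i\<in>?A. nbL i ` {..<c}) \<le> (\<Sum>i\<in>?A. card (nbL i ` {..<c}))"
    by (rule card_UN_le) simp
  also have "\<dots> \<le> (\<Sum>i\<in>?A. c)"
    by (rule sum_mono) (use card_image_le[of "{..<c}"] in auto)
  also have "\<dots> \<le> u x * c" using card_flipset[of p x] by simp
  finally show ?thesis by (simp add: algebra_simps)
qed

section \<open>Memory invariants and the correctness of a flip\<close>

text \<open>The part of the state that no command of the program writes. From index 2 on,
  \<open>aIN\<close> keeps the addresses of the original input.\<close>

definition stat :: "(reg \<Rightarrow> nat) \<Rightarrow> (arr \<Rightarrow> nat \<Rightarrow> nat) \<Rightarrow> bool" where
  "stat \<rho> \<sigma> \<longleftrightarrow> \<rho> rN = n \<and> (\<forall>i<n. \<sigma> aIN (2 + i) = of_bool (inp i)) \<and>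
     (\<forall>i<n. \<forall>j<c. \<sigma> aIN (2 + j + n + c * i) = nbL i j) \<and>
     (\<forall>v<m. \<forall>k<d. \<sigma> aIN (2 + k + n + c * n + d * v) = nbR v k)"

lemma stat_cong: "stat \<rho> \<sigma> \<Longrightarrow> \<rho>' rN = \<rho> rN \<Longrightarrow> \<sigma>' aIN = \<sigma> aIN \<Longrightarrow> stat \<rho>' \<sigma>'"
  by (simp add: stat_def)

lemma stat_left:
  "stat \<rho> \<sigma> \<Longrightarrow> \<rho> rI < n \<Longrightarrow> j < c \<Longrightarrow> \<sigma> aIN (lin \<rho> (left_index j)) = nbL (\<rho> rI) j"
  by (simp add: stat_def left_index_def sum_list_replicate add_ac)

lemma stat_right:
  "stat \<rho> \<sigma> \<Longrightarrow> \<rho> rV < m \<Longrightarrow> k < d \<Longrightarrow> \<sigma> aIN (lin \<rho> (right_index k)) = nbR (\<rho> rV) k"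
  by (simp add: stat_def right_index_def sum_list_replicate add_ac)

lemma sem_viewcase:
  assumes "stat \<rho> \<sigma>" "\<rho> rV < m" "\<forall>i. \<sigma> aWD i = of_bool (x i)" "r + length w = d"
  shows "\<exists>t. sem (viewcase r w f) (\<rho>, \<sigma>) =
    sem (f (w @ map (\<lambda>k. x (nbR (\<rho> rV) k)) [length w..<d])) (\<rho>(rT := t), \<sigma>)"
  using assms
proof (induction r arbitrary: w \<rho>)
  case 0
  have "\<rho>(rT := \<rho> rT) = \<rho>" by simp
  then show ?case using 0 by (intro exI[of _ "\<rho> rT"]) simp
next
  case (Suc r)
  let ?b = "x (nbR (\<rho> rV) (length w))"
  let ?\<rho> = "\<rho>(rT := of_bool ?b)"
  have l: "length w < d" using Suc.prems by auto
  have "sem (viewcase (Suc r) w f) (\<rho>, \<sigma>) = sem (viewcase r (w @ [?b]) f) (?\<rho>, \<sigma>)"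
    using stat_right[OF Suc.prems(1,2) l] Suc.prems(3) by simp
  moreover have "\<exists>t. sem (viewcase r (w @ [?b]) f) (?\<rho>, \<sigma>) =
      sem (f ((w @ [?b]) @ map (\<lambda>k. x (nbR (?\<rho> rV) k)) [length (w @ [?b])..<d])) (?\<rho>(rT := t), \<sigma>)"
    by (rule Suc.IH[OF stat_cong[OF Suc.prems(1)]]) (use Suc.prems in simp_all)
  ultimately obtain t where "sem (viewcase (Suc r) w f) (\<rho>, \<sigma>) =
      sem (f ((w @ [?b]) @ map (\<lambda>k. x (nbR (?\<rho> rV) k)) [length (w @ [?b])..<d])) (?\<rho>(rT := t), \<sigma>)"
    by metis
  moreover have "map (\<lambda>k. x (nbR (\<rho> rV) k)) [length w..<d] =
      ?b # map (\<lambda>k. x (nbR (\<rho> rV) k)) [length (w @ [?b])..<d]"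
    using l by (simp add: upt_conv_Cons)
  ultimately have "sem (viewcase (Suc r) w f) (\<rho>, \<sigma>) =
      sem (f (w @ map (\<lambda>k. x (nbR (\<rho> rV) k)) [length w..<d])) (\<rho>(rT := t), \<sigma>)"
    by (simp del: viewcase.simps)
  then show ?case by blast
qed

lemma sem_viewcase_d:
  assumes "stat \<rho> \<sigma>" "\<rho> rV < m" "\<forall>i. \<sigma> aWD i = of_bool (x i)"
  shows "\<exists>t. sem (viewcase d [] f) (\<rho>, \<sigma>) = sem (f (view x (\<rho> rV))) (\<rho>(rT := t), \<sigma>)"
  using sem_viewcase[OF assms, of d "[]" f] by (simp add: view_def)

text \<open>The frame condition of \<open>refresh\<close> and \<open>flip\<close>: everything except
  their temporaries, the word and the list of violated constraints.\<close>

definition unchanged :: "state \<Rightarrow> state \<Rightarrow> bool" where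
  "unchanged = (\<lambda>(\<rho>, \<sigma>) (\<rho>', \<sigma>'). (\<forall>r. r \<notin> {rT, rV, rPP, rLL, rU} \<longrightarrow> \<rho>' r = \<rho> r) \<and>
     (\<forall>a. a \<notin> {aWD, aPOS, aARR} \<longrightarrow> \<sigma>' a = \<sigma> a))"

lemma sem_refresh:
  assumes "stat \<rho> \<sigma>" "\<rho> rV < m" "\<forall>i. \<sigma> aWD i = of_bool (x i)"
    and "enum (\<sigma> aARR) (\<sigma> aPOS) (\<rho> rU) S"
    and "sem refresh (\<rho>, \<sigma>) = (\<rho>', \<sigma>')"
  shows "enum (\<sigma>' aARR) (\<sigma>' aPOS) (\<rho>' rU)
      (if view x (\<rho> rV) \<in> C0 then S - {\<rho> rV} else insert (\<rho> rV) S)"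
    and "\<sigma>' aWD = \<sigma> aWD" and "unchanged (\<rho>, \<sigma>) (\<rho>', \<sigma>')"
proof -
  let ?v = "\<rho> rV"
  let ?\<rho> = "\<rho>(rPP := \<sigma> aPOS ?v)"
  obtain t where "sem (viewcase d [] (\<lambda>w. if w \<in> C0 then del else ins)) (?\<rho>, \<sigma>) =
      sem (if view x (?\<rho> rV) \<in> C0 then del else ins) (?\<rho>(rT := t), \<sigma>)"
    using sem_viewcase_d[of ?\<rho> \<sigma> x] assms(2,3) stat_cong[OF assms(1), of ?\<rho> \<sigma>] by force
  with assms(5) have s: "(\<rho>', \<sigma>') = sem (if view x ?v \<in> C0 then del else ins) (?\<rho>(rT := t), \<sigma>)"
    by (simp add: refresh_def)
  have pos: "\<sigma> aPOS ?v = 0 \<longleftrightarrow> ?v \<notin> S" using assms(4) by (auto simp: enum_def)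
  have "enum (\<sigma>' aARR) (\<sigma>' aPOS) (\<rho>' rU) (if view x ?v \<in> C0 then S - {?v} else insert ?v S)
    \<and> \<sigma>' aWD = \<sigma> aWD \<and> unchanged (\<rho>, \<sigma>) (\<rho>', \<sigma>')"
  proof (cases "view x ?v \<in> C0"; cases "?v \<in> S")
    assume v: "view x ?v \<in> C0" "?v \<in> S"
    with pos have "0 < \<sigma> aPOS ?v" by simp
    with v s have "\<rho>' = ?\<rho>(rT := t, rLL := \<sigma> aARR (\<rho> rU), rU := \<rho> rU - 1)"
      and "\<sigma>' = \<sigma>(aARR := (\<sigma> aARR)(\<sigma> aPOS ?v := \<sigma> aARR (\<rho> rU)),
        aPOS := (\<sigma> aPOS)(\<sigma> aARR (\<rho> rU) := \<sigma> aPOS ?v, ?v := 0))"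
      by (simp_all add: del_def)
    with v enum_remove[OF assms(4) v(2)] show ?thesis by (simp add: unchanged_def)
  next
    assume "view x ?v \<in> C0" "?v \<notin> S"
    then show ?thesis using s pos assms(4) by (simp add: del_def unchanged_def)
  next
    assume "view x ?v \<notin> C0" "?v \<in> S"
    then show ?thesis using s pos assms(4) by (simp add: ins_def unchanged_def insert_absorb)
  next
    assume "view x ?v \<notin> C0" "?v \<notin> S"
    then show ?thesis using s pos enum_insert[OF assms(4)]
      by (simp add: ins_def unchanged_def)
  qed
  then show "enum (\<sigma>' aARR) (\<sigma>' aPOS) (\<rho>' rU)
      (if view x (\<rho> rV) \<in> C0 then S - {\<rho> rV} else insert (\<rho> rV) S)"
    and "\<sigma>' aWD = \<sigma> aWD" and "unchanged (\<rho>, \<sigma>) (\<rho>', \<sigma>')" by auto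
qed

lemma unchanged_trans: "unchanged s s' \<Longrightarrow> unchanged s' s'' \<Longrightarrow> unchanged s s''"
  by (auto simp: unchanged_def)

lemma unchanged_stat: "unchanged (\<rho>, \<sigma>) (\<rho>', \<sigma>') \<Longrightarrow> stat \<rho> \<sigma> \<Longrightarrow> stat \<rho>' \<sigma>'"
  by (rule stat_cong) (auto simp: unchanged_def)

lemma sem_flip:
  assumes "stat \<rho> \<sigma>" "i < n" "\<rho> rI = i" "\<forall>q. \<sigma> aWD q = of_bool (x q)"
    and "enum (\<sigma> aARR) (\<sigma> aPOS) (\<rho> rU) (unsat x)"
    and "sem flip (\<rho>, \<sigma>) = (\<rho>', \<sigma>')"
  shows "\<forall>q. \<sigma>' aWD q = of_bool (tog i x q)" and "enum (\<sigma>' aARR) (\<sigma>' aPOS) (\<rho>' rU) (unsat (tog i x))"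
    and "unchanged (\<rho>, \<sigma>) (\<rho>', \<sigma>')"
proof -
  let ?x = "tog i x"
  \<comment> \<open>After \<open>q\<close> of the neighbors of \<open>i\<close> have been rechecked,
    these are judged by the new word and all other constraints by the old one. This interpolates
    between the violated sets of the two words.\<close>
  define S where "S q = {v. v < m \<and> (if v \<in> nbL i ` {..<q} then view ?x v \<notin> C0 else view x v \<notin> C0)}" for q
  define f where "f = (\<lambda>j. GET rV aIN (left_index j) ;; refresh)"
  let ?\<rho>1 = "\<rho>(rT := \<sigma> aWD i)"
  let ?\<sigma>1 = "\<sigma>(aWD := (\<sigma> aWD)(i := of_bool (?x i)))"
  have end_eq: "(\<rho>', \<sigma>') = sem (seqs (map f [0..<c])) (?\<rho>1, ?\<sigma>1)"
    using assms(3,4,6) by (cases "x i") (simp_all add: flip_def f_def tog_def)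
  have wd: "\<forall>q. ?\<sigma>1 aWD q = of_bool (?x q)" using assms(4) by (simp add: tog_def)
  have "\<exists>\<rho>2 \<sigma>2. sem (seqs (map f [0..<q])) (?\<rho>1, ?\<sigma>1) = (\<rho>2, \<sigma>2) \<and> \<sigma>2 aWD = ?\<sigma>1 aWD \<and>
      unchanged (\<rho>, \<sigma>) (\<rho>2, \<sigma>2) \<and> enum (\<sigma>2 aARR) (\<sigma>2 aPOS) (\<rho>2 rU) (S q)" if "q \<le> c" for q
    using that
  proof (induction q)
    case 0
    have "S 0 = unsat x" by (auto simp: S_def unsat_def)
    then show ?case using assms(5) by (simp add: unchanged_def)
  next
    case (Suc q)
    from Suc.IH[OF Suc_leD[OF Suc.prems]]
    obtain \<rho>2 \<sigma>2 where 2: "sem (seqs (map f [0..<q])) (?\<rho>1, ?\<sigma>1) = (\<rho>2, \<sigma>2)"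
      "\<sigma>2 aWD = ?\<sigma>1 aWD" "unchanged (\<rho>, \<sigma>) (\<rho>2, \<sigma>2)" "enum (\<sigma>2 aARR) (\<sigma>2 aPOS) (\<rho>2 rU) (S q)"
      by blast
    let ?v = "nbL i q"
    let ?\<rho>2 = "\<rho>2(rV := ?v)"
    obtain \<rho>3 \<sigma>3 where 3: "sem refresh (?\<rho>2, \<sigma>2) = (\<rho>3, \<sigma>3)" by fastforce
    have st: "stat \<rho>2 \<sigma>2" using unchanged_stat[OF 2(3) assms(1)] .
    have I: "\<rho>2 rI = i" using 2(3) assms(3) by (simp add: unchanged_def)
    have "\<sigma>2 aIN (lin \<rho>2 (left_index q)) = ?v"
      using stat_left[OF st, of q] I assms(2) Suc.prems by simp
    then have s: "sem (seqs (map f [0..<Suc q])) (?\<rho>1, ?\<sigma>1) = (\<rho>3, \<sigma>3)"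
      using 2(1) 3 by (simp add: f_def)
    have st2: "stat ?\<rho>2 \<sigma>2" using stat_cong[OF st] by simp
    have v: "?v < m" using nbL_less assms(2) Suc.prems by simp
    have wd2: "\<forall>q. \<sigma>2 aWD q = of_bool (?x q)" using 2(2) wd by simp
    have en: "enum (\<sigma>2 aARR) (\<sigma>2 aPOS) (?\<rho>2 rU) (S q)" using 2(4) by simp
    have v2: "?\<rho>2 rV < m" using v by simp
    note r = sem_refresh[OF st2 v2 wd2 en 3]
    have Sq: "S (Suc q) = (if view ?x ?v \<in> C0 then S q - {?v} else insert ?v (S q))"
      using v by (auto simp: S_def lessThan_Suc)
    have "unchanged (\<rho>2, \<sigma>2) (?\<rho>2, \<sigma>2)" by (simp add: unchanged_def)
    then have "unchanged (\<rho>, \<sigma>) (\<rho>3, \<sigma>3)"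
      using unchanged_trans[OF 2(3) unchanged_trans] r(3) by blast
    moreover have "enum (\<sigma>3 aARR) (\<sigma>3 aPOS) (\<rho>3 rU) (S (Suc q))"
      unfolding Sq using r(1) by (simp only: fun_upd_same)
    moreover have "\<sigma>3 aWD = ?\<sigma>1 aWD" using r(2) 2(2) by (simp only:)
    ultimately show ?case using s by blast
  qed
  from this[of c] end_eq have
    fin: "\<sigma>' aWD = ?\<sigma>1 aWD" "unchanged (\<rho>, \<sigma>) (\<rho>', \<sigma>')" "enum (\<sigma>' aARR) (\<sigma>' aPOS) (\<rho>' rU) (S c)"
    by auto
  have "view ?x v = view x v" if "v < m" "v \<notin> nbL i ` {..<c}" for v
  proof -
    have "nbR v k \<noteq> i" if "k < d" for k
      using adjacent[OF assms(2) \<open>v < m\<close>] \<open>v \<notin> nbL i ` {..<c}\<close> that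
      by (metis imageI lessThan_iff)
    then show ?thesis by (auto simp: view_def tog_def)
  qed
  then have "S c = unsat ?x" by (auto simp: S_def unsat_def)
  with fin wd show "\<forall>q. \<sigma>' aWD q = of_bool (tog i x q)"
    and "enum (\<sigma>' aARR) (\<sigma>' aPOS) (\<rho>' rU) (unsat (tog i x))" and "unchanged (\<rho>, \<sigma>) (\<rho>', \<sigma>')"
    by simp_all
qed

text \<open>\<open>l\<close> is the contents of the log. \<open>\<kappa>\<close> collects the
  variables that flips and rounds leave alone; as a parameter of the invariant it makes their
  preservation part of it.\<close>

definition Inv :: "nat \<times> nat \<times> (nat \<Rightarrow> nat) \<Rightarrow> (nat \<Rightarrow> bool) \<Rightarrow> nat list \<Rightarrow> state \<Rightarrow> bool" where
  "Inv \<kappa> x l = (\<lambda>(\<rho>, \<sigma>). stat \<rho> \<sigma> \<and> (\<forall>q. \<sigma> aWD q = of_bool (x q)) \<and>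
     enum (\<sigma> aARR) (\<sigma> aPOS) (\<rho> rU) (unsat x) \<and>
     \<rho> rLG = length l \<and> (\<forall>q<length l. \<sigma> aLOG q = l ! q) \<and> set l \<subseteq> {..<n} \<and> (\<forall>q. x q \<longrightarrow> q < n) \<and>
     \<kappa> = (\<rho> rU0, \<rho> rBD, \<sigma> aBEST))"

lemma Inv_upd [simp]:
  "r \<notin> {rN, rU, rLG, rU0, rBD} \<Longrightarrow> Inv \<kappa> x l (\<rho>(r := k), \<sigma>) \<longleftrightarrow> Inv \<kappa> x l (\<rho>, \<sigma>)"
  by (auto simp: Inv_def stat_def)

lemma Inv_N: "Inv \<kappa> x l s \<Longrightarrow> fst s rN = n"
  by (auto simp: Inv_def stat_def)

lemma Inv_U: "Inv \<kappa> x l s \<Longrightarrow> fst s rU = u x"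
  using enum_card(3) by (fastforce simp: Inv_def)

lemma Inv_LG: "Inv \<kappa> x l s \<Longrightarrow> fst s rLG = length l"
  by (auto simp: Inv_def)

lemma Inv_less: "Inv \<kappa> x l s \<Longrightarrow> x q \<Longrightarrow> q < n"
  by (auto simp: Inv_def)

lemma Inv_flip:
  assumes "Inv \<kappa> x l (\<rho>, \<sigma>)" "\<rho> rI < n"
  shows "Inv \<kappa> (tog (\<rho> rI) x) l (sem flip (\<rho>, \<sigma>))" "unchanged (\<rho>, \<sigma>) (sem flip (\<rho>, \<sigma>))"
proof -
  obtain \<rho>' \<sigma>' where s: "sem flip (\<rho>, \<sigma>) = (\<rho>', \<sigma>')" by fastforce
  have "stat \<rho> \<sigma>" "\<forall>q. \<sigma> aWD q = of_bool (x q)" "enum (\<sigma> aARR) (\<sigma> aPOS) (\<rho> rU) (unsat x)"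
    using assms(1) by (auto simp: Inv_def)
  note f = sem_flip[OF this(1) assms(2) refl this(2,3) s]
  show "unchanged (\<rho>, \<sigma>) (sem flip (\<rho>, \<sigma>))" using f(3) s by simp
  show "Inv \<kappa> (tog (\<rho> rI) x) l (sem flip (\<rho>, \<sigma>))"
    using f assms unchanged_stat[OF f(3)]
    by (auto simp: Inv_def s unchanged_def tog_def)
qed

lemma hwp_LET_Seq:
  "hwp p t Q (atomic_update (LET r e) s) \<Longrightarrow> hwp (LET r e ;; p) (clen (tr (LET r e)) + t) Q s"
  by (intro hwp_Seq hwp_LET)

lemma hwp_flips:
  assumes "Inv \<kappa> x l s" "fst s rQ = q" "q \<le> length l" "length l - q \<le> N"
  shows "hwp flips (N * flips_unit + guard_cost (V rQ) (V rLG)) (Inv \<kappa> (fold tog (drop q l) x) l) s"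
proof -
  let ?I = "\<lambda>k s. Inv \<kappa> (fold tog (take k (drop q l)) x) l s \<and> fst s rQ = q + k"
  have "hwp flips (N * flips_unit + guard_cost (V rQ) (V rLG)) (?I (length l - q)) s"
    unfolding flips_def flips_unit_def
  proof (rule hwp_for[where I = ?I])
    show "?I 0 s" using assms by simp
    show "lin (fst s) (V rQ) < lin (fst s) (V rLG) \<longleftrightarrow> k < length l - q" if "?I k s" for k s
      using that Inv_LG[of \<kappa> _ l s] by auto
  next
    fix k s assume k: "k < length l - q" and I: "?I k s"
    obtain \<rho> \<sigma> where s: "s = (\<rho>, \<sigma>)" by fastforce
    let ?i = "l ! (q + k)"
    let ?\<rho> = "\<rho>(rI := ?i)"
    have i: "\<sigma> aLOG (\<rho> rQ) = ?i" "?i < n"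
      using I k by (auto simp: s Inv_def subset_iff)
    have I': "Inv \<kappa> (fold tog (take k (drop q l)) x) l (?\<rho>, \<sigma>)" using I s by simp
    obtain \<rho>' \<sigma>' where s': "sem flip (?\<rho>, \<sigma>) = (\<rho>', \<sigma>')" by fastforce
    note f = Inv_flip[OF I', unfolded s']
    have "take (Suc k) (drop q l) = take k (drop q l) @ [?i]"
      using k assms(3) by (simp add: take_Suc_conv_app_nth)
    then have "?I (Suc k) (\<rho>'(rQ := Suc (\<rho>' rQ)), \<sigma>')"
      using f i I by (simp add: s unchanged_def)
    then have "?I (Suc k) (sem (GET rI aLOG (V rQ) ;; flip ;; LET rQ (1, [rQ])) s)"
      using i s' by (simp add: s)
    then show "hwp (GET rI aLOG (V rQ) ;; flip ;; LET rQ (1, [rQ]))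
        (cost (GET rI aLOG (V rQ) ;; flip ;; LET rQ (1, [rQ]))) (?I (Suc k)) s"
      by (intro hwp_loopfree) (auto simp: loopfree_flip)
  qed (use assms in auto)
  then show ?thesis by (rule hwp_mono) (use assms in auto)
qed

section \<open>Correctness and cost of rounds and trials\<close>

definition cand :: "branch \<Rightarrow> (nat \<Rightarrow> bool) \<Rightarrow> nat \<Rightarrow> nat list" where
  "cand = (\<lambda>(w, k, j) x v. if view x v = w \<and> nbL (nbR v k) j = v then [nbR v k] else [])"

lemma sem_select:
  assumes "p \<in> branches" "Inv \<kappa> x l (\<rho>, \<sigma>)" "\<rho> rP < \<rho> rU" "v = \<sigma> aARR (Suc (\<rho> rP))"
    and "sem (select p) (\<rho>, \<sigma>) = (\<rho>', \<sigma>')"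
  shows "Inv \<kappa> x (l @ cand p x v) (\<rho>', \<sigma>')" "\<rho>' rP = Suc (\<rho> rP)" "\<rho>' rQ = \<rho> rQ" "\<sigma>' aARR = \<sigma> aARR"
proof -
  obtain w k j where p: "p = (w, k, j)" by (cases p)
  have kj: "k < d" "j < c" using assms(1) by (auto simp: p branches_def)
  have st: "stat \<rho> \<sigma>" and wd: "\<forall>q. \<sigma> aWD q = of_bool (x q)"
    and en: "enum (\<sigma> aARR) (\<sigma> aPOS) (\<rho> rU) (unsat x)" using assms(2) by (auto simp: Inv_def)
  have "v \<in> unsat x"
    using en assms(3,4) unfolding enum_def by (metis One_nat_def Suc_leI le_numeral_extra(4) less_eq_Suc_le not_less_eq_eq zero_less_Suc)
  then have v: "v < m" by (simp add: unsat_def)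
  let ?\<rho>1 = "\<rho>(rP := Suc (\<rho> rP), rV := v)"
  define f where "f = (\<lambda>w'. if w' = w then
       GET rI aIN (right_index k) ;; GET rT aIN (left_index j) ;;
       IFEQ (V rT) (V rV) (PUT aLOG (V rLG) (V rI) ;; LET rLG (1, [rLG])) SKIP
     else SKIP)"
  have st1: "stat ?\<rho>1 \<sigma>" using stat_cong[OF st] by simp
  obtain t where "sem (viewcase d [] f) (?\<rho>1, \<sigma>) = sem (f (view x v)) (?\<rho>1(rT := t), \<sigma>)"
    using sem_viewcase_d[OF st1 _ wd, of f] v by auto
  then have s: "(\<rho>', \<sigma>') = sem (f (view x v)) (?\<rho>1(rT := t), \<sigma>)"
    using assms(4,5) by (simp add: select_def p f_def)
  let ?\<rho>2 = "?\<rho>1(rT := t)"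
  have I2: "Inv \<kappa> x l (?\<rho>2, \<sigma>)" using assms(2) by simp
  have "Inv \<kappa> x (l @ cand p x v) (\<rho>', \<sigma>') \<and> \<rho>' rP = Suc (\<rho> rP) \<and> \<rho>' rQ = \<rho> rQ \<and> \<sigma>' aARR = \<sigma> aARR"
  proof (cases "view x v = w")
    case False
    then show ?thesis using s I2 by (simp add: f_def p cand_def)
  next
    case True
    let ?i = "nbR v k"
    let ?\<rho>3 = "?\<rho>2(rI := ?i)"
    let ?\<rho>4 = "?\<rho>3(rT := nbL ?i j)"
    have i: "?i < n" using nbR_less v kj by simp
    have "\<sigma> aIN (lin ?\<rho>2 (right_index k)) = ?i"
      using stat_right[OF stat_cong[OF st], of ?\<rho>2 \<sigma> k] v kj by simp
    moreover have "\<sigma> aIN (lin ?\<rho>3 (left_index j)) = nbL ?i j"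
      using stat_left[OF stat_cong[OF st], of ?\<rho>3 \<sigma> j] i kj by simp
    ultimately have s4: "(\<rho>', \<sigma>') = (if nbL ?i j = v then
        (?\<rho>4(rLG := Suc (\<rho> rLG)), \<sigma>(aLOG := (\<sigma> aLOG)(\<rho> rLG := ?i))) else (?\<rho>4, \<sigma>))"
      using True s by (simp add: f_def)
    have I4: "Inv \<kappa> x l (?\<rho>4, \<sigma>)" using assms(2) by simp
    show ?thesis
    proof (cases "nbL ?i j = v")
      case True
      have "Inv \<kappa> x (l @ [?i]) (?\<rho>4(rLG := Suc (\<rho> rLG)), \<sigma>(aLOG := (\<sigma> aLOG)(\<rho> rLG := ?i)))"
        using I4 i by (auto simp: Inv_def stat_def nth_append less_Suc_eq)
      with s4 True \<open>view x v = w\<close> show ?thesis by (simp add: cand_def p)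
    next
      case False
      with s4 I4 show ?thesis by (simp add: cand_def p)
    qed
  qed
  then show "Inv \<kappa> x (l @ cand p x v) (\<rho>', \<sigma>')" "\<rho>' rP = Suc (\<rho> rP)" "\<rho>' rQ = \<rho> rQ" "\<sigma>' aARR = \<sigma> aARR"
    by auto
qed

text \<open>A position contributed by two constraints would have both of them as its
  \<open>j\<close>-th neighbor, hence the collected list has no duplicates and flipping along it
  amounts to \<open>app\<close>.\<close>

lemma cands:
  assumes "p \<in> branches" "distinct vs" "set vs = unsat x"
  shows "distinct (concat (map (cand p x) vs))" "set (concat (map (cand p x) vs)) = flipset p x"
proof -
  obtain w k j where p: "p = (w, k, j)" by (cases p)
  show "set (concat (map (cand p x) vs)) = flipset p x"
    using assms(3) by (auto simp: p flipset_def cand_def split: if_splits)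
  have c: "set (cand p x v) \<subseteq> {i. nbL i j = v}" "distinct (cand p x v)" for v
    by (auto simp: cand_def p)
  show "distinct (concat (map (cand p x) vs))"
    using assms(2)
  proof (induction vs)
    case (Cons v vs)
    have "set (cand p x v) \<inter> set (concat (map (cand p x) vs)) = {}"
    proof (rule equals0I)
      fix i assume "i \<in> set (cand p x v) \<inter> set (concat (map (cand p x) vs))"
      then obtain v' where v': "v' \<in> set vs" "i \<in> set (cand p x v)" "i \<in> set (cand p x v')" by auto
      with c(1) have "v' = v" by blast
      with v' Cons.prems show False by simp
    qed
    with Cons c(2) show ?case by simp
  qed simp
qed

lemma hwp_round:
  assumes p: "p \<in> branches" and I: "Inv \<kappa> x l s"
  shows "hwp (round p) (round_cost p * (u x + 1))
    (\<lambda>s'. \<exists>l'. distinct l' \<and> set l' = flipset p x \<and> Inv \<kappa> (app p x) (l @ l') s') s"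
proof -
  obtain \<rho> \<sigma> where s: "s = (\<rho>, \<sigma>)" by fastforce
  let ?s = "(\<rho>(rQ := length l, rP := 0), \<sigma>)"
  have s': "atomic_update (LET rP (K 0)) (atomic_update (LET rQ (V rLG)) s) = ?s"
    using Inv_LG[OF I] by (simp add: s)
  define vs where "vs = map (\<sigma> aARR) [1..<Suc (u x)]"
  have en: "enum (\<sigma> aARR) (\<sigma> aPOS) (u x) (unsat x)"
    using I Inv_U[OF I] by (auto simp: Inv_def s)
  have vs: "distinct vs" "set vs = unsat x"
    using enum_card(1,2)[OF en] by (auto simp: vs_def distinct_map atLeastLessThanSuc_atLeastAtMost simp del: upt_Suc)
  let ?C = "\<lambda>k. concat (map (cand p x) (take k vs))"
  let ?J = "\<lambda>k s. Inv \<kappa> x (l @ ?C k) s \<and> fst s rP = k \<and> fst s rQ = length l \<and> snd s aARR = \<sigma> aARR"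
  let ?Q = "\<lambda>s'. \<exists>l'. distinct l' \<and> set l' = flipset p x \<and> Inv \<kappa> (app p x) (l @ l') s'"
  let ?gs = "guard_cost (V rP) (V rU)" and ?gf = "guard_cost (V rQ) (V rLG)"
  have loop: "hwp (WHILE (V rP) (V rU) (select p)) (u x * (?gs + cost (select p)) + ?gs) (?J (u x)) ?s"
  proof (rule hwp_for[where I = ?J])
    show "?J 0 ?s" using I by (simp add: s)
    show "lin (fst s) (V rP) < lin (fst s) (V rU) \<longleftrightarrow> k < u x" if "?J k s" for k s
      using that Inv_U[of \<kappa> x _ s] by auto
  next
    fix k s assume k: "k < u x" and J: "?J k s"
    obtain \<rho>1 \<sigma>1 where s1: "s = (\<rho>1, \<sigma>1)" by fastforce
    obtain \<rho>2 \<sigma>2 where s2: "sem (select p) (\<rho>1, \<sigma>1) = (\<rho>2, \<sigma>2)" by fastforce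
    have U: "\<rho>1 rU = u x" using J Inv_U s1 by fastforce
    have J1: "Inv \<kappa> x (l @ ?C k) (\<rho>1, \<sigma>1)" and P: "\<rho>1 rP = k" using J s1 by auto
    have "take (Suc k) vs = take k vs @ [\<sigma>1 aARR (Suc (\<rho>1 rP))]"
      using k J by (simp add: vs_def take_Suc_conv_app_nth s1 del: upt_Suc)
    then have "?J (Suc k) (sem (select p) s)"
      using sem_select[OF p J1 _ refl s2] P U J k by (simp add: s1 s2)
    then show "hwp (select p) (cost (select p)) (?J (Suc k)) s"
      by (intro hwp_loopfree loopfree_select)
  qed auto
  have fl: "hwp flips (u x * flips_unit + ?gf) ?Q s'" if "?J (u x) s'" for s'
  proof -
    have "take (u x) vs = vs" by (simp add: vs_def)
    then have J: "Inv \<kappa> x (l @ concat (map (cand p x) vs)) s'" "fst s' rQ = length l"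
      using that by auto
    let ?l = "concat (map (cand p x) vs)"
    note l = cands[OF p vs]
    have "length ?l \<le> u x"
      using distinct_card[OF l(1)] l(2) card_flipset[of p x] by simp
    then have "hwp flips (u x * flips_unit + ?gf) (Inv \<kappa> (fold tog ?l x) (l @ ?l)) s'"
      using hwp_flips[OF J, of "u x"] by simp
    then show ?thesis
    proof (rule hwp_mono)
      fix s'' assume "Inv \<kappa> (fold tog ?l x) (l @ ?l) s''"
      moreover have "fold tog ?l x = app p x"
        unfolding fold_tog_distinct[OF l(1)] l(2) app_def ..
      ultimately show "?Q s''" using l by auto
    qed simp
  qed
  have "hwp (WHILE (V rP) (V rU) (select p) ;; flips)
      (u x * (?gs + cost (select p)) + ?gs + (u x * flips_unit + ?gf)) ?Q ?s"
    by (rule hwp_Seq, rule hwp_mono[OF loop]) (use fl in auto)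
  then have "hwp (round p) (clen (tr (LET rQ (V rLG))) + (clen (tr (LET rP (K 0))) +
      (u x * (?gs + cost (select p)) + ?gs + (u x * flips_unit + ?gf)))) ?Q s"
    unfolding round_def by (intro hwp_LET_Seq) (simp only: s')
  then show ?thesis
    by (rule hwp_mono) (auto simp: round_cost_def algebra_simps)
qed

abbreviation apps :: "branch list \<Rightarrow> (nat \<Rightarrow> bool) \<Rightarrow> nat \<Rightarrow> bool" where
  "apps \<equiv> fold app"

text \<open>The log may repeat positions across rounds, so it is related to \<open>apps\<close> by
  \<open>fold tog\<close> and not as a set; this is the form that undoing a trial needs.\<close>

lemma hwp_rounds:
  assumes "set \<tau> \<subseteq> branches" "Inv \<kappa> x l s"
  shows "hwp (rounds \<tau>) (rounds_cost \<tau> * (u x + 1))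
    (\<lambda>s'. \<exists>l'. Inv \<kappa> (apps \<tau> x) (l @ l') s' \<and> fold tog l' x = apps \<tau> x \<and>
      length l' \<le> log_bound \<tau> * u x) s"
  using assms
proof (induction \<tau> arbitrary: x l s)
  case Nil
  then have "\<exists>l'. Inv \<kappa> x (l @ l') s \<and> fold tog l' x = x \<and> length l' \<le> 0"
    by (intro exI[of _ "[]"]) simp
  then show ?case by (simp add: hwp_SKIP)
next
  case (Cons p \<tau>)
  let ?Q = "\<lambda>s'. \<exists>l'. Inv \<kappa> (apps (p # \<tau>) x) (l @ l') s' \<and> fold tog l' x = apps (p # \<tau>) x \<and>
      length l' \<le> log_bound (p # \<tau>) * u x"
  have p: "p \<in> branches" using Cons.prems by simp
  have u: "u (app p x) \<le> (1 + c) * u x" by (rule u_app[OF p])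
  have le: "k * u (app p x) \<le> k * (1 + c) * u x" for k
    using mult_le_mono2[OF u, of k] by (simp only: mult.assoc)
  have rest: "hwp (rounds \<tau>) (rounds_cost \<tau> * ((1 + c) * u x + 1)) ?Q s1"
    if l1: "distinct l1" "set l1 = flipset p x" and I: "Inv \<kappa> (app p x) (l @ l1) s1" for l1 s1
  proof (rule hwp_mono[OF Cons.IH[OF _ I]])
    show "set \<tau> \<subseteq> branches" using Cons.prems by simp
    show "rounds_cost \<tau> * (u (app p x) + 1) \<le> rounds_cost \<tau> * ((1 + c) * u x + 1)"
      by (rule mult_le_mono2) (use u in simp)
    fix s2
    assume "\<exists>l'. Inv \<kappa> (apps \<tau> (app p x)) ((l @ l1) @ l') s2 \<and> fold tog l' (app p x) = apps \<tau> (app p x) \<and>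
      length l' \<le> log_bound \<tau> * u (app p x)"
    then obtain l2 where l2: "Inv \<kappa> (apps (p # \<tau>) x) (l @ (l1 @ l2)) s2"
      "fold tog l2 (app p x) = apps (p # \<tau>) x" "length l2 \<le> log_bound \<tau> * u (app p x)" by auto
    have "fold tog l1 x = app p x"
      unfolding fold_tog_distinct[OF l1(1)] l1(2) app_def ..
    with l2 have "fold tog (l1 @ l2) x = apps (p # \<tau>) x" by simp
    moreover have "length l1 \<le> u x"
      using distinct_card[OF l1(1)] l1(2) card_flipset[of p x] by simp
    then have "length (l1 @ l2) \<le> log_bound (p # \<tau>) * u x"
      using l2(3) le[of "log_bound \<tau>"] by (simp add: algebra_simps)
    ultimately show "?Q s2" using l2(1) by blast
  qed
  have "hwp (rounds (p # \<tau>)) (round_cost p * (u x + 1) + rounds_cost \<tau> * ((1 + c) * u x + 1)) ?Q s"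
    unfolding rounds.simps
    by (rule hwp_Seq, rule hwp_mono[OF hwp_round[OF p Cons.prems(2)]]) (use rest in auto)
  then show ?case
    by (rule hwp_mono) (auto simp: algebra_simps)
qed

lemma hwp_tries:
  assumes "\<forall>\<tau>\<in>set ts. set \<tau> \<subseteq> branches" "Inv (u x, \<beta>) x l s"
  shows "hwp (tries ts) (tries_cost ts * (u x + 1))
    (\<lambda>s'. \<exists>x' l'. Inv (u x, \<beta>) x' l' s' \<and>
      (x' = x \<and> fst s' rG = 0 \<and> (\<forall>\<tau>\<in>set ts. u x < 2 * u (apps \<tau> x)) \<or>
       (\<exists>\<tau>\<in>set ts. x' = apps \<tau> x \<and> 2 * u x' \<le> u x \<and> fst s' rG = u x'))) s"
  using assms
proof (induction ts arbitrary: l s)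
  case Nil
  obtain \<rho> \<sigma> where s: "s = (\<rho>, \<sigma>)" by fastforce
  have "hwp (tries []) (tries_cost []) (\<lambda>s'. Inv (u x, \<beta>) x l s' \<and> fst s' rG = 0) s"
    unfolding tries.simps tries_cost.simps by (rule hwp_LET) (use Nil in \<open>simp add: s\<close>)
  then show ?case by (rule hwp_mono) auto
next
  case (Cons \<tau> ts)
  let ?Q = "\<lambda>ts s'. \<exists>x' l'. Inv (u x, \<beta>) x' l' s' \<and>
      (x' = x \<and> fst s' rG = 0 \<and> (\<forall>\<tau>\<in>set ts. u x < 2 * u (apps \<tau> x)) \<or>
       (\<exists>\<tau>\<in>set ts. x' = apps \<tau> x \<and> 2 * u x' \<le> u x \<and> fst s' rG = u x'))"
  obtain \<rho> \<sigma> where s: "s = (\<rho>, \<sigma>)" by fastforce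
  let ?s = "(\<rho>(rLG := 0), \<sigma>)"
  let ?g = "guard_cost (V rU0) (0, [rU, rU])" and ?gf = "guard_cost (V rQ) (V rLG)"
  let ?undo = "clen (tr (LET rQ (K 0))) + ((log_bound \<tau> * u x * flips_unit + ?gf) + tries_cost ts * (u x + 1))"
  let ?acc = "clen (tr (LET rG (V rU)))"
  have I: "Inv (u x, \<beta>) x [] ?s"
    using Cons.prems(2) by (auto simp: Inv_def stat_def s)
  have branch: "hwp (IFLT (V rU0) (0, [rU, rU]) (LET rQ (K 0) ;; flips ;; tries ts) (LET rG (V rU)))
      (?g + (?undo + ?acc)) (?Q (\<tau> # ts)) s1"
    if I1: "Inv (u x, \<beta>) (apps \<tau> x) l1 s1" and l1: "fold tog l1 x = apps \<tau> x" "length l1 \<le> log_bound \<tau> * u x"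
    for l1 s1
  proof (rule hwp_IFLT)
    obtain \<rho>1 \<sigma>1 where s1: "s1 = (\<rho>1, \<sigma>1)" by fastforce
    have U: "\<rho>1 rU = u (apps \<tau> x)" "\<rho>1 rU0 = u x"
      using Inv_U[OF I1] I1 by (auto simp: s1 Inv_def)
    {
      assume "lin (fst s1) (V rU0) < lin (fst s1) (0, [rU, rU])"
      with U have rej: "u x < 2 * u (apps \<tau> x)" by (simp add: s1)
      have "hwp flips (log_bound \<tau> * u x * flips_unit + ?gf) (Inv (u x, \<beta>) (fold tog (drop 0 l1) (apps \<tau> x)) l1)
          (\<rho>1(rQ := 0), \<sigma>1)"
        by (rule hwp_flips) (use I1 l1 s1 in auto)
      then have undo: "hwp flips (log_bound \<tau> * u x * flips_unit + ?gf) (Inv (u x, \<beta>) x l1) (\<rho>1(rQ := 0), \<sigma>1)"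
        using fold_tog_fold_tog[of l1 x] l1(1) by simp
      have "hwp (LET rQ (K 0) ;; flips ;; tries ts) ?undo (?Q ts) s1"
      proof (rule hwp_LET_Seq, rule hwp_Seq)
        show "hwp flips (log_bound \<tau> * u x * flips_unit + ?gf)
            (\<lambda>s'. hwp (tries ts) (tries_cost ts * (u x + 1)) (?Q ts) s') (atomic_update (LET rQ (K 0)) s1)"
          by (rule hwp_mono[OF _ Cons.IH order_refl]) (use undo Cons.prems in \<open>auto simp: s1\<close>)
      qed
      then show "hwp (LET rQ (K 0) ;; flips ;; tries ts) (?undo + ?acc) (?Q (\<tau> # ts)) s1"
        by (rule hwp_mono) (use rej in auto)
    next
      assume "\<not> lin (fst s1) (V rU0) < lin (fst s1) (0, [rU, rU])"
      with U have acc: "2 * u (apps \<tau> x) \<le> u x" by (simp add: s1)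
      have "hwp (LET rG (V rU)) ?acc (?Q (\<tau> # ts)) s1"
      proof (rule hwp_LET)
        have "Inv (u x, \<beta>) (apps \<tau> x) l1 (atomic_update (LET rG (V rU)) s1)"
          "fst (atomic_update (LET rG (V rU)) s1) rG = u (apps \<tau> x)"
          using I1 U by (auto simp: s1)
        with acc show "?Q (\<tau> # ts) (atomic_update (LET rG (V rU)) s1)" by auto
      qed
      then show "hwp (LET rG (V rU)) (?undo + ?acc) (?Q (\<tau> # ts)) s1"
        by (rule hwp_mono) auto
    }
  qed
  have \<tau>: "set \<tau> \<subseteq> branches" using Cons.prems by simp
  have "hwp (tries (\<tau> # ts)) (clen (tr (LET rLG (K 0))) + (rounds_cost \<tau> * (u x + 1) + (?g + (?undo + ?acc))))
      (?Q (\<tau> # ts)) s"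
    unfolding tries.simps
  proof (rule hwp_LET_Seq, rule hwp_Seq)
    have "atomic_update (LET rLG (K 0)) s = ?s" by (simp add: s)
    then show "hwp (rounds \<tau>) (rounds_cost \<tau> * (u x + 1))
        (\<lambda>s'. hwp (IFLT (V rU0) (0, [rU, rU]) (LET rQ (K 0) ;; flips ;; tries ts) (LET rG (V rU)))
          (?g + (?undo + ?acc)) (?Q (\<tau> # ts)) s') (atomic_update (LET rLG (K 0)) s)"
      using hwp_mono[OF hwp_rounds[OF \<tau> I] _ order_refl] branch by auto
  qed
  then show ?case
    by (rule hwp_mono) (auto simp: algebra_simps)
qed

end

section \<open>The descent and the choice of the answer\<close>

text \<open>Words satisfying \<open>Good\<close> have so few errors that the descent cannot fail on them; the
  descent may get stuck, within the same time bound, on all other words.\<close>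

locale decoder_good = decoder_run +
  fixes ts ts1 :: "branch list list" and Good :: "(nat \<Rightarrow> bool) \<Rightarrow> bool" and y :: "nat \<Rightarrow> bool"
  assumes ts: "\<forall>\<tau>\<in>set ts. set \<tau> \<subseteq> branches" and ts1: "\<forall>\<tau>\<in>set ts1. set \<tau> \<subseteq> branches"
    and progress: "Good x \<Longrightarrow> unsat x \<noteq> {} \<Longrightarrow> \<exists>\<tau>\<in>set ts. 2 * u (apps \<tau> x) \<le> u x"
    and preserved: "Good x \<Longrightarrow> \<tau> \<in> set ts \<Longrightarrow> 2 * u (apps \<tau> x) \<le> u x \<Longrightarrow> Good (apps \<tau> x)"
    and solved: "Good x \<Longrightarrow> unsat x = {} \<Longrightarrow> i < n \<Longrightarrow> x i = y i"
    and reachable: "\<exists>\<tau>\<in>set ts1. Good (apps \<tau> inp)"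
    and unique: "unsat z = {} \<Longrightarrow>
      card {i. i < n \<and> z i \<noteq> inp i} \<le> card {i. i < n \<and> y i \<noteq> inp i} \<Longrightarrow> i < n \<Longrightarrow> z i = y i"
begin

text \<open>Each iteration either halves \<open>u x\<close> or ends the loop, on every word. So the
  bound, linear in \<open>u x\<close>, holds without \<open>Good x\<close>, which only serves to
  exclude that the loop ends early.\<close>

lemma hwp_descend:
  assumes "Inv (u0, \<beta>) x l s" "fst s rG = u x"
  shows "hwp (descend ts) (descend_cost ts * u x + guard_cost (K 0) (V rG))
    (\<lambda>s'. \<exists>u0 x' l'. Inv (u0, \<beta>) x' l' s' \<and> (Good x \<longrightarrow> Good x' \<and> unsat x' = {})) s"
  using assms
proof (induction "u x" arbitrary: u0 x l s rule: less_induct)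
  case less
  let ?Q = "\<lambda>x s'. \<exists>u0 x' l'. Inv (u0, \<beta>) x' l' s' \<and> (Good x \<longrightarrow> Good x' \<and> unsat x' = {})"
  let ?g = "guard_cost (K 0) (V rG)"
  show ?case
  proof (cases "u x = 0")
    case True
    then have "?Q x s" using less.prems by auto
    then have "hwp (descend ts) ?g (?Q x) s"
      unfolding descend_def by (rule hwp_WHILE_done[rotated]) (use True less.prems in simp)
    then show ?thesis by (rule hwp_mono) auto
  next
    case False
    obtain \<rho> \<sigma> where s: "s = (\<rho>, \<sigma>)" by fastforce
    have U: "\<rho> rU = u x" using Inv_U[OF less.prems(1)] by (simp add: s)
    let ?b = "clen (tr (LET rU0 (V rU))) + tries_cost ts * (u x + 1)"
    let ?t = "descend_cost ts * (u x div 2) + ?g"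
    let ?R = "\<lambda>s'. \<exists>x' l'. Inv (u x, \<beta>) x' l' s' \<and>
      (x' = x \<and> fst s' rG = 0 \<and> (\<forall>\<tau>\<in>set ts. u x < 2 * u (apps \<tau> x)) \<or>
       (\<exists>\<tau>\<in>set ts. x' = apps \<tau> x \<and> 2 * u x' \<le> u x \<and> fst s' rG = u x'))"
    have "Inv (u x, \<beta>) x l (\<rho>(rU0 := u x), \<sigma>)"
      using less.prems(1) by (cases \<beta>) (auto simp: Inv_def stat_def s)
    from hwp_tries[OF ts this] have "hwp (LET rU0 (V rU) ;; tries ts) ?b ?R s"
      using U by (intro hwp_LET_Seq) (simp add: s)
    moreover have "hwp (descend ts) ?t (?Q x) s'" if "?R s'" for s'
    proof -
      from that obtain x' l' where I: "Inv (u x, \<beta>) x' l' s'"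
        and "x' = x \<and> fst s' rG = 0 \<and> (\<forall>\<tau>\<in>set ts. u x < 2 * u (apps \<tau> x)) \<or>
          (\<exists>\<tau>\<in>set ts. x' = apps \<tau> x \<and> 2 * u x' \<le> u x \<and> fst s' rG = u x')"
        by blast
      then consider (rej) "x' = x" "fst s' rG = 0" "\<forall>\<tau>\<in>set ts. u x < 2 * u (apps \<tau> x)"
        | (acc) \<tau> where "\<tau> \<in> set ts" "x' = apps \<tau> x" "2 * u x' \<le> u x" "fst s' rG = u x'"
        by metis
      then show ?thesis
      proof cases
        case rej
        have "\<not> Good x" using progress[of x] rej(3) False by fastforce
        then have "?Q x s'" using I by blast
        then have "hwp (descend ts) ?g (?Q x) s'"
          unfolding descend_def by (rule hwp_WHILE_done[rotated]) (use rej in simp)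
        then show ?thesis by (rule hwp_mono) auto
      next
        case acc
        have "u x' < u x" using acc(3) False by linarith
        from less.hyps[OF this I acc(4)] show ?thesis
        proof (rule hwp_mono)
          show "?Q x s''" if "?Q x' s''" for s''
            using that preserved[of x \<tau>] acc by blast
          have "u x' \<le> u x div 2" using acc(3) by linarith
          then show "descend_cost ts * u x' + ?g \<le> ?t" by simp
        qed
      qed
    qed
    ultimately have "hwp (LET rU0 (V rU) ;; tries ts) ?b (\<lambda>s'. hwp (descend ts) ?t (?Q x) s') s"
      by (rule hwp_mono) auto
    then have "hwp (descend ts) (?g + ?b + ?t) (?Q x) s"
      unfolding descend_def
      by (rule hwp_WHILE_step[rotated]) (use False less.prems in \<open>simp add: card_gt_0_iff\<close>)
    then show ?thesis
    proof (rule hwp_mono)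
      let ?k = "clen (tr (LET rU0 (V rU))) + tries_cost ts"
      have "?b \<le> ?k * (u x + 1)" by (simp add: algebra_simps)
      also have "\<dots> \<le> ?k * (2 * u x)" using False by (intro mult_le_mono2) linarith
      finally have b: "?b \<le> 2 * ?k * u x" by (simp only: mult_ac)
      have "1 \<le> u x" using False by linarith
      from mult_le_mono2[OF this, of ?g] have g: "?g \<le> ?g * u x" by simp
      have "descend_cost ts * (u x div 2) = (2 * ?k + ?g) * (2 * (u x div 2))"
        by (simp add: descend_cost_def)
      also have "\<dots> \<le> (2 * ?k + ?g) * u x" by (intro mult_le_mono2) simp
      finally have "?g + ?b + ?t \<le> ?g * u x + 2 * ?k * u x + ((2 * ?k + ?g) * u x + ?g)"
        using b g by linarith
      also have "\<dots> = descend_cost ts * u x + ?g"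
        by (simp add: descend_cost_def algebra_simps)
      finally show "?g + ?b + ?t \<le> descend_cost ts * u x + ?g" .
    qed
  qed
qed

lemma hwp_scan:
  assumes "J 0 (atomic_update (LET rI (K 0)) s)"
    and "\<And>k s. J k s \<Longrightarrow> fst s rI = k \<and> fst s rN = n"
    and "\<And>k s. k < n \<Longrightarrow> J k s \<Longrightarrow> J (Suc k) (sem p s)" and "loopfree p"
  shows "hwp (LET rI (K 0) ;; WHILE (V rI) (V rN) p)
    (clen (tr (LET rI (K 0))) + (n * (guard_cost (V rI) (V rN) + cost p) + guard_cost (V rI) (V rN))) (J n) s"
proof (rule hwp_LET_Seq, rule hwp_for[where I = J])
  show "lin (fst s) (V rI) < lin (fst s) (V rN) \<longleftrightarrow> k < n" if "J k s" for k s
    using assms(2)[OF that] by simp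
qed (use assms hwp_loopfree in auto)

lemma hwp_load:
  assumes "Inv \<kappa> x l s"
  shows "hwp load (clen (tr (LET rI (K 0))) +
    (n * (guard_cost (V rI) (V rN) + cost load_body) + guard_cost (V rI) (V rN))) (Inv \<kappa> inp l) s"
proof -
  let ?x = "\<lambda>k i. if i < k then inp i else x i"
  let ?J = "\<lambda>k s. Inv \<kappa> (?x k) l s \<and> fst s rI = k"
  have "hwp load (clen (tr (LET rI (K 0))) +
    (n * (guard_cost (V rI) (V rN) + cost load_body) + guard_cost (V rI) (V rN))) (?J n) s"
    unfolding load_def
  proof (rule hwp_scan[where J = ?J])
    show "?J 0 (atomic_update (LET rI (K 0)) s)" using assms by (cases s) simp
    show "fst s rI = k \<and> fst s rN = n" if "?J k s" for k s
      using that Inv_N by blast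
  next
    fix k s assume k: "k < n" and J: "?J k s"
    obtain \<rho> \<sigma> where s: "s = (\<rho>, \<sigma>)" by fastforce
    let ?\<rho> = "\<rho>(rT := of_bool (inp k), rPP := of_bool (x k))"
    have I: "Inv \<kappa> (?x k) l (?\<rho>, \<sigma>)" "?\<rho> rI = k" using J by (simp_all add: s)
    have "\<sigma> aIN (2 + k) = of_bool (inp k)" "\<sigma> aWD k = of_bool (x k)"
      using J k by (auto simp: s Inv_def stat_def)
    then have e: "sem load_body s = (if x k = inp k then (?\<rho>(rI := Suc k), \<sigma>)
        else (case sem flip (?\<rho>, \<sigma>) of (\<rho>', \<sigma>') \<Rightarrow> (\<rho>'(rI := Suc (\<rho>' rI)), \<sigma>')))"
      using J by (auto simp: load_body_def s split: prod.splits)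
    show "?J (Suc k) (sem load_body s)"
    proof (cases "x k = inp k")
      case True
      then have "?x (Suc k) = ?x k" by (auto simp: less_Suc_eq)
      then show ?thesis using True e I by simp
    next
      case False
      then have "?x (Suc k) = tog k (?x k)" by (auto simp: less_Suc_eq tog_def)
      moreover obtain \<rho>' \<sigma>' where s': "sem flip (?\<rho>, \<sigma>) = (\<rho>', \<sigma>')" by fastforce
      have "sem load_body s = (\<rho>'(rI := Suc (\<rho>' rI)), \<sigma>')"
        unfolding e s' using False by simp
      moreover have "Inv \<kappa> (tog k (?x k)) l (\<rho>', \<sigma>')" "\<rho>' rI = k"
        using Inv_flip[OF I(1)] I(2) k unfolding s' by (simp_all add: unchanged_def)
      ultimately show ?thesis by simp
    qed
  qed (rule loopfree_bodies)
  then show ?thesis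
  proof (rule hwp_mono)
    fix s assume J: "?J n s"
    \<comment> \<open>The invariant makes words False from \<open>n\<close> on, so agreement below
      \<open>n\<close> is equality.\<close>
    then have x: "?x n q \<Longrightarrow> q < n" for q using Inv_less[of \<kappa> "?x n" l s q] by blast
    have "?x n = inp"
    proof
      show "?x n i = inp i" for i using x[of i] inp_less[of i] by (cases "i < n") auto
    qed
    with J show "Inv \<kappa> inp l s" by simp
  qed simp
qed

definition dist :: "(nat \<Rightarrow> bool) \<Rightarrow> nat" where
  "dist z = card {i. i < n \<and> z i \<noteq> inp i}"

lemma hwp_distance:
  assumes "Inv \<kappa> x l s"
  shows "hwp distance (clen (tr (LET rH (K 0))) + (clen (tr (LET rI (K 0))) +
    (n * (guard_cost (V rI) (V rN) + cost distance_body) + guard_cost (V rI) (V rN))))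
    (\<lambda>s'. Inv \<kappa> x l s' \<and> fst s' rH = dist x) s"
proof -
  let ?d = "\<lambda>k. card {i. i < k \<and> x i \<noteq> inp i}"
  let ?J = "\<lambda>k s. Inv \<kappa> x l s \<and> fst s rI = k \<and> fst s rH = ?d k"
  have "hwp distance (clen (tr (LET rH (K 0))) + (clen (tr (LET rI (K 0))) +
    (n * (guard_cost (V rI) (V rN) + cost distance_body) + guard_cost (V rI) (V rN)))) (?J n) s"
    unfolding distance_def
  proof (rule hwp_LET_Seq, rule hwp_scan[where J = ?J])
    show "?J 0 (atomic_update (LET rI (K 0)) (atomic_update (LET rH (K 0)) s))"
      using assms by (cases s) simp
    show "fst s rI = k \<and> fst s rN = n" if "?J k s" for k s
      using that Inv_N by blast
  next
    fix k s assume k: "k < n" and J: "?J k s"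
    obtain \<rho> \<sigma> where s: "s = (\<rho>, \<sigma>)" by fastforce
    have "\<sigma> aIN (2 + k) = of_bool (inp k)" "\<sigma> aWD k = of_bool (x k)"
      using J k by (auto simp: s Inv_def stat_def)
    moreover have "{i. i < Suc k \<and> x i \<noteq> inp i} =
        (if x k = inp k then {i. i < k \<and> x i \<noteq> inp i} else insert k {i. i < k \<and> x i \<noteq> inp i})"
      by (auto simp: less_Suc_eq)
    then have "?d (Suc k) = (if x k = inp k then ?d k else Suc (?d k))" by simp
    ultimately show "?J (Suc k) (sem distance_body s)"
      using J by (auto simp: distance_body_def s)
  qed (rule loopfree_bodies)
  then show ?thesis by (rule hwp_mono) (auto simp: dist_def)
qed

lemma hwp_save:
  assumes "Inv (u0, bd, bst) x l s"
  shows "hwp save (clen (tr (LET rI (K 0))) +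
    (n * (guard_cost (V rI) (V rN) + cost save_body) + guard_cost (V rI) (V rN)))
    (\<lambda>s'. \<exists>bst'. Inv (u0, bd, bst') x l s' \<and> (\<forall>i<n. bst' i = of_bool (x i))) s"
proof -
  let ?J = "\<lambda>k s. (\<exists>bst'. Inv (u0, bd, bst') x l s \<and> (\<forall>i<k. bst' i = of_bool (x i))) \<and> fst s rI = k"
  have "hwp save (clen (tr (LET rI (K 0))) +
    (n * (guard_cost (V rI) (V rN) + cost save_body) + guard_cost (V rI) (V rN))) (?J n) s"
    unfolding save_def
  proof (rule hwp_scan[where J = ?J])
    show "?J 0 (atomic_update (LET rI (K 0)) s)"
      using assms by (cases s) auto
    show "fst s rI = k \<and> fst s rN = n" if "?J k s" for k s
      using that Inv_N by blast
  next
    fix k s assume k: "k < n" and J: "?J k s"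
    obtain \<rho> \<sigma> where s: "s = (\<rho>, \<sigma>)" by fastforce
    obtain bst' where b: "Inv (u0, bd, bst') x l (\<rho>, \<sigma>)" "\<forall>i<k. bst' i = of_bool (x i)" "\<rho> rI = k"
      using J s by auto
    have w: "\<sigma> aWD k = of_bool (x k)" using b by (simp add: Inv_def)
    have "Inv (u0, bd, bst'(k := of_bool (x k))) x l
        (\<rho>(rT := of_bool (x k), rI := Suc k), \<sigma>(aBEST := (\<sigma> aBEST)(k := of_bool (x k))))"
      using b(1) by (auto simp: Inv_def stat_def)
    moreover have "sem save_body s =
        (\<rho>(rT := of_bool (x k), rI := Suc k), \<sigma>(aBEST := (\<sigma> aBEST)(k := of_bool (x k))))"
      using w b(3) by (simp add: save_body_def s)
    ultimately show "?J (Suc k) (sem save_body s)"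
      using b(2) by (auto simp: less_Suc_eq intro!: exI[of _ "bst'(k := of_bool (x k))"])
  qed (rule loopfree_bodies)
  then show ?thesis by (rule hwp_mono) auto
qed

text \<open>\<open>n + 1\<close> exceeds every distance and marks that no codeword has been stored
  yet.\<close>

definition recorded :: "nat \<Rightarrow> (nat \<Rightarrow> nat) \<Rightarrow> bool" where
  "recorded bd bst \<longleftrightarrow> bd = n + 1 \<or>
     (\<exists>z. unsat z = {} \<and> bd = dist z \<and> (\<forall>i<n. bst i = of_bool (z i)))"

definition state_ok :: "nat \<Rightarrow> state \<Rightarrow> bool" where
  "state_ok b s \<longleftrightarrow> (\<exists>u0 bd bst x l. Inv (u0, bd, bst) x l s \<and> bd \<le> b \<and> recorded bd bst)"

text \<open>An attempt that reaches a \<open>Good\<close> word brings the record down to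
  \<open>dist y\<close>. Any other attempt may fail or store a different codeword; this is harmless,
  since the record never increases and a stored one always belongs to a codeword.\<close>

lemma hwp_attempt:
  assumes \<tau>: "set \<tau> \<subseteq> branches" and s: "state_ok b s"
  shows "hwp (attempt ts \<tau>) (attempt_cost ts \<tau> * (n + 1))
    (state_ok (if Good (apps \<tau> inp) then min b (dist y) else b)) s"
proof -
  let ?b = "if Good (apps \<tau> inp) then min b (dist y) else b"
  let ?gI = "guard_cost (V rI) (V rN)" and ?cI = "clen (tr (LET rI (K 0)))"
  let ?tload = "?cI + (n * (?gI + cost load_body) + ?gI)"
  let ?tdist = "clen (tr (LET rH (K 0))) + (?cI + (n * (?gI + cost distance_body) + ?gI))"
  let ?tsave = "?cI + (n * (?gI + cost save_body) + ?gI)"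
  let ?tif2 = "guard_cost (V rH) (V rBD) + (clen (tr (LET rBD (V rH))) + ?tsave)"
  let ?tif1 = "guard_cost (V rU) (K 1) + (?tdist + ?tif2)"
  let ?tdesc = "descend_cost ts * m + guard_cost (K 0) (V rG)"
  let ?trest = "clen (tr (LET rG (V rU))) + (?tdesc + ?tif1)"
  let ?tall = "?tload + (clen (tr (LET rLG (K 0))) + (rounds_cost \<tau> * (m + 1) + ?trest))"
  obtain u0 bd bst x l where I0: "Inv (u0, bd, bst) x l s" and bd: "bd \<le> b" "recorded bd bst"
    using s by (auto simp: state_ok_def)
  have if2: "hwp (IFLT (V rH) (V rBD) (LET rBD (V rH) ;; save) SKIP) ?tif2 (state_ok ?b) s1"
    if I: "Inv (u1, bd, bst) x1 l1 s1" and H: "fst s1 rH = dist x1"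
      and fin: "unsat x1 = {}" "Good (apps \<tau> inp) \<Longrightarrow> dist x1 = dist y" for u1 x1 l1 s1
  proof (rule hwp_IFLT)
    obtain \<rho> \<sigma> where s1: "s1 = (\<rho>, \<sigma>)" by fastforce
    have BD: "\<rho> rBD = bd" using I by (simp add: Inv_def s1)
    {
      assume "lin (fst s1) (V rH) < lin (fst s1) (V rBD)"
      then have lt: "dist x1 < bd" using BD H by (simp add: s1)
      have "Inv (u1, dist x1, bst) x1 l1 (\<rho>(rBD := dist x1), \<sigma>)"
        using I by (auto simp: Inv_def stat_def s1)
      from hwp_save[OF this] have "hwp save ?tsave (state_ok ?b) (\<rho>(rBD := dist x1), \<sigma>)"
      proof (rule hwp_mono)
        fix s2 assume "\<exists>bst'. Inv (u1, dist x1, bst') x1 l1 s2 \<and> (\<forall>i<n. bst' i = of_bool (x1 i))"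
        then obtain bst' where "Inv (u1, dist x1, bst') x1 l1 s2" "\<forall>i<n. bst' i = of_bool (x1 i)" by blast
        moreover from this(2) fin(1) have "recorded (dist x1) bst'" unfolding recorded_def by blast
        moreover have "dist x1 \<le> ?b" using lt bd(1) fin(2) by auto
        ultimately show "state_ok ?b s2" unfolding state_ok_def by blast
      qed simp
      then show "hwp (LET rBD (V rH) ;; save) (clen (tr (LET rBD (V rH))) + ?tsave) (state_ok ?b) s1"
        using H by (intro hwp_LET_Seq) (simp add: s1)
    next
      assume "\<not> lin (fst s1) (V rH) < lin (fst s1) (V rBD)"
      then have "bd \<le> dist x1" using BD H by (simp add: s1)
      then have "bd \<le> ?b" using bd(1) fin(2) by auto
      then have "state_ok ?b s1" using I bd(2) unfolding state_ok_def by blast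
      from hwp_SKIP[of "state_ok ?b", OF this]
      show "hwp SKIP (clen (tr (LET rBD (V rH))) + ?tsave) (state_ok ?b) s1"
        by (rule hwp_mono) auto
    }
  qed

  let ?IF1 = "IFLT (V rU) (K 1) (distance ;; IFLT (V rH) (V rBD) (LET rBD (V rH) ;; save) SKIP) SKIP"
  have if1: "hwp ?IF1 ?tif1 (state_ok ?b) s1"
    if I: "Inv (u1, bd, bst) x1 l1 s1" and fin: "Good (apps \<tau> inp) \<Longrightarrow> Good x1 \<and> unsat x1 = {}" for u1 x1 l1 s1
  proof (rule hwp_IFLT)
    have U: "fst s1 rU = u x1" using Inv_U[OF I] .
    {
      assume "lin (fst s1) (V rU) < lin (fst s1) (K 1)"
      then have x1: "unsat x1 = {}" using U by simp
      have "dist x1 = dist y" if "Good (apps \<tau> inp)"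
      proof -
        have "x1 i = y i" if "i < n" for i using solved fin \<open>Good (apps \<tau> inp)\<close> that by blast
        then show ?thesis unfolding dist_def by (metis (mono_tags, lifting))
      qed
      then show "hwp (distance ;; IFLT (V rH) (V rBD) (LET rBD (V rH) ;; save) SKIP) (?tdist + ?tif2) (state_ok ?b) s1"
        by (intro hwp_Seq hwp_mono[OF hwp_distance[OF I] if2[OF _ _ x1]]) auto
    next
      assume "\<not> lin (fst s1) (V rU) < lin (fst s1) (K 1)"
      then have "unsat x1 \<noteq> {}" using U by auto
      then have "\<not> Good (apps \<tau> inp)" using fin by blast
      moreover have "state_ok b s1" using I bd unfolding state_ok_def by blast
      ultimately have "state_ok ?b s1" by simp
      from hwp_SKIP[of "state_ok ?b", OF this]
      show "hwp SKIP (?tdist + ?tif2) (state_ok ?b) s1"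
        by (rule hwp_mono) auto
    }
  qed

  have desc: "hwp (descend ts ;; ?IF1) (?tdesc + ?tif1) (state_ok ?b) s1"
    if I: "Inv (u0, bd, bst) (apps \<tau> inp) l1 s1" and G: "fst s1 rG = u (apps \<tau> inp)" for l1 s1
  proof (rule hwp_Seq, rule hwp_mono[OF hwp_descend[OF I G]])
    show "descend_cost ts * u (apps \<tau> inp) + guard_cost (K 0) (V rG) \<le> ?tdesc"
      using u_le by simp
  qed (use if1 in blast)

  have rnds: "hwp (rounds \<tau> ;; LET rG (V rU) ;; descend ts ;; ?IF1) (rounds_cost \<tau> * (m + 1) + ?trest) (state_ok ?b) s1"
    if I: "Inv (u0, bd, bst) inp [] s1" for s1
  proof (rule hwp_Seq, rule hwp_mono[OF hwp_rounds[OF \<tau> I]])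
    show "rounds_cost \<tau> * (u inp + 1) \<le> rounds_cost \<tau> * (m + 1)" using u_le by simp
    fix s2 assume "\<exists>l'. Inv (u0, bd, bst) (apps \<tau> inp) ([] @ l') s2 \<and> fold tog l' inp = apps \<tau> inp \<and>
      length l' \<le> log_bound \<tau> * u inp"
    then obtain l2 where I2: "Inv (u0, bd, bst) (apps \<tau> inp) l2 s2" by auto
    obtain \<rho> \<sigma> where s2: "s2 = (\<rho>, \<sigma>)" by fastforce
    show "hwp (LET rG (V rU) ;; descend ts ;; ?IF1) ?trest (state_ok ?b) s2"
    proof (rule hwp_LET_Seq, rule desc)
      show "Inv (u0, bd, bst) (apps \<tau> inp) l2 (atomic_update (LET rG (V rU)) s2)"
        and "fst (atomic_update (LET rG (V rU)) s2) rG = u (apps \<tau> inp)"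
        using I2 Inv_U[OF I2] by (auto simp: s2)
    qed
  qed

  have "hwp (attempt ts \<tau>) ?tall (state_ok ?b) s"
    unfolding attempt_def
  proof (rule hwp_Seq, rule hwp_mono[OF hwp_load[OF I0] _ order_refl], rule hwp_LET_Seq, rule rnds)
    fix s1 assume "Inv (u0, bd, bst) inp l s1"
    then show "Inv (u0, bd, bst) inp [] (atomic_update (LET rLG (K 0)) s1)"
      by (cases s1) (auto simp: Inv_def stat_def)
  qed
  then show ?thesis
  proof (rule hwp_mono)
    \<comment> \<open>Counting edges from both sides makes the number of constraints linear in
      \<open>n\<close>, which turns bounds in \<open>m\<close> into bounds in
      \<open>n\<close>.\<close>
    have m: "m \<le> c * n" using edges by simp
    have "m + 1 \<le> (1 + c) * (n + 1)" using m by simp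
    from mult_le_mono2[OF this, of "rounds_cost \<tau>"]
    have r: "rounds_cost \<tau> * (m + 1) \<le> rounds_cost \<tau> * (1 + c) * (n + 1)" by (simp only: mult.assoc)
    have "m \<le> c * (n + 1)" using m by simp
    from mult_le_mono2[OF this, of "descend_cost ts"]
    have d: "descend_cost ts * m \<le> descend_cost ts * c * (n + 1)" by (simp only: mult.assoc)
    \<comment> \<open>The two truncated differences are 0 by \<open>r\<close> and \<open>d\<close>;
      with them in place the inequality is a matter of coefficients.\<close>
    have "?tall \<le> attempt_cost ts \<tau> * (n + 1) +
        (rounds_cost \<tau> * (m + 1) - rounds_cost \<tau> * (1 + c) * (n + 1)) +
        (descend_cost ts * m - descend_cost ts * c * (n + 1))"
      unfolding attempt_cost_def by (simp add: algebra_simps del: tr.simps)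
    then show "?tall \<le> attempt_cost ts \<tau> * (n + 1)" using r d by simp
  qed
qed

lemma hwp_attempts:
  assumes "\<forall>\<tau>\<in>set tsx. set \<tau> \<subseteq> branches" "state_ok b s"
  shows "hwp (seqs (map (attempt ts) tsx)) (sum_list (map (attempt_cost ts) tsx) * (n + 1))
    (state_ok (if \<exists>\<tau>\<in>set tsx. Good (apps \<tau> inp) then min b (dist y) else b)) s"
  using assms
proof (induction tsx arbitrary: b s)
  case Nil
  then show ?case by (simp add: hwp_SKIP)
next
  case (Cons \<tau> tsx)
  let ?b = "if Good (apps \<tau> inp) then min b (dist y) else b"
  let ?b' = "if \<exists>\<tau>\<in>set (\<tau> # tsx). Good (apps \<tau> inp) then min b (dist y) else b"
  have e: "(if \<exists>\<tau>\<in>set tsx. Good (apps \<tau> inp) then min ?b (dist y) else ?b) = ?b'" by auto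
  have "hwp (seqs (map (attempt ts) (\<tau> # tsx)))
      (attempt_cost ts \<tau> * (n + 1) + sum_list (map (attempt_cost ts) tsx) * (n + 1)) (state_ok ?b') s"
    unfolding list.map seqs.simps
  proof (rule hwp_Seq, rule hwp_mono[OF hwp_attempt _ order_refl])
    show "set \<tau> \<subseteq> branches" "state_ok b s" using Cons.prems by auto
    show "hwp (seqs (map (attempt ts) tsx)) (sum_list (map (attempt_cost ts) tsx) * (n + 1)) (state_ok ?b') s1"
      if "state_ok ?b s1" for s1
      using Cons.IH[OF _ that] Cons.prems unfolding e by simp
  qed
  then show ?case by (rule hwp_mono) (simp_all add: algebra_simps)
qed

lemma hwp_decode:
  assumes "stat \<rho> \<sigma>" "\<forall>i. \<sigma> aWD i = 0" "\<forall>i. \<sigma> aPOS i = 0"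
  shows "hwp (decode ts ts1) (decode_cost ts ts1 * (n + 1))
    (\<lambda>(\<rho>', \<sigma>'). \<rho>' rN = n \<and> (\<forall>i<n. \<sigma>' aBEST i = of_bool (y i))) (\<rho>, \<sigma>)"
proof -
  let ?\<rho> = "\<rho>(rU := 0, rLG := 0, rBD := n + 1)"
  have "view (\<lambda>_. False) v = replicate d False" for v
    by (simp add: view_def map_replicate_const)
  then have "unsat (\<lambda>_. False) = {}" using zero_code by (simp add: unsat_def)
  then have "Inv (\<rho> rU0, n + 1, \<sigma> aBEST) (\<lambda>_. False) [] (?\<rho>, \<sigma>)"
    using assms by (auto simp: Inv_def stat_def enum_def)
  then have ok: "state_ok (n + 1) (?\<rho>, \<sigma>)"
    unfolding state_ok_def recorded_def by blast
  let ?A = "seqs (map (attempt ts) ts1)" and ?tA = "sum_list (map (attempt_cost ts) ts1) * (n + 1)"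
  let ?Q = "state_ok (min (n + 1) (dist y))"
  have "hwp ?A ?tA ?Q (?\<rho>, \<sigma>)"
    using hwp_attempts[OF ts1 ok] reachable by simp
  then have "hwp (LET rU (K 0) ;; LET rLG (K 0) ;; LET rBD (1, [rN]) ;; ?A)
      (clen (tr (LET rU (K 0))) + (clen (tr (LET rLG (K 0))) + (clen (tr (LET rBD (1, [rN]))) + ?tA))) ?Q (\<rho>, \<sigma>)"
    using assms(1) by (intro hwp_LET_Seq) (simp add: stat_def)
  then show ?thesis
    unfolding decode_def
  proof (rule hwp_mono)
    fix s assume "?Q s"
    then obtain u0 bd bst x l where I: "Inv (u0, bd, bst) x l s"
      and bd: "bd \<le> min (n + 1) (dist y)" "recorded bd bst"
      unfolding state_ok_def by blast
    \<comment> \<open>The final record is at most \<open>dist y\<close>, hence below the mark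
      \<open>n + 1\<close>, so a codeword has been stored.\<close>
    have "dist y \<le> card {..<n}" unfolding dist_def by (rule card_mono) auto
    with bd obtain z where z: "unsat z = {}" "dist z \<le> dist y" "\<forall>i<n. bst i = of_bool (z i)"
      by (auto simp: recorded_def)
    then have "\<forall>i<n. z i = y i" using unique unfolding dist_def by blast
    with z I show "case s of (\<rho>', \<sigma>') \<Rightarrow> \<rho>' rN = n \<and> (\<forall>i<n. \<sigma>' aBEST i = of_bool (y i))"
      by (auto simp: Inv_def stat_def)
  next
    show "clen (tr (LET rU (K 0))) + (clen (tr (LET rLG (K 0))) + (clen (tr (LET rBD (1, [rN]))) + ?tA))
        \<le> decode_cost ts ts1 * (n + 1)"
      by (simp add: decode_cost_def algebra_simps del: tr.simps)
  qed
qed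

end

section \<open>Progress of the decoder on expanders\<close>

lemma hamming_triangle:
  assumes "length a = length b"
  shows "hamming a e \<le> hamming a b + hamming b e"
proof -
  have "hamming a e \<le> card ({i. i < length a \<and> a ! i \<noteq> b ! i} \<union> {i. i < length b \<and> b ! i \<noteq> e ! i})"
    unfolding hamming_def by (rule card_mono) (use assms in auto)
  also have "\<dots> \<le> hamming a b + hamming b e" unfolding hamming_def by (rule card_Un_le)
  finally show ?thesis .
qed

lemma hamming_commute: "length a = length b \<Longrightarrow> hamming a b = hamming b a"
  unfolding hamming_def by (metis (no_types, lifting))

lemma hamming_0_imp_eq: "length a = length b \<Longrightarrow> hamming a b = 0 \<Longrightarrow> a = b"
  unfolding hamming_def by (auto intro: nth_equalityI)

locale expander_word = decoder_run +
  fixes \<alpha> \<delta> :: real and D :: nat and y :: "nat \<Rightarrow> bool"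
  assumes c_pos: "0 < c" and \<alpha>_pos: "0 < \<alpha>" and \<delta>_pos: "0 < \<delta>" and \<delta>_le: "\<delta> \<le> 1"
    and \<delta>D: "\<delta> * D > 2"
    and words: "a \<in> C0 \<Longrightarrow> length a = d"
    and code_dist: "a \<in> C0 \<Longrightarrow> b \<in> C0 \<Longrightarrow> a \<noteq> b \<Longrightarrow> D \<le> hamming a b"
    and inj_nbL: "i < n \<Longrightarrow> inj_on (nbL i) {..<c}"
    and inj_nbR: "v < m \<Longrightarrow> inj_on (nbR v) {..<d}"
    and expansion: "S \<subseteq> {..<n} \<Longrightarrow> real (card S) \<le> \<alpha> * n \<Longrightarrow>
      \<delta> * c * card S \<le> card {v. v < m \<and> (\<exists>k<d. nbR v k \<in> S)}"
    and y_code: "unsat y = {}"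
    and close: "card {i. i < n \<and> inp i \<noteq> y i} \<le> \<alpha> * n"
begin

section \<open>Error sets versus violated constraints\<close>

definition N :: "nat set \<Rightarrow> nat set" where
  "N S = {v. v < m \<and> (\<exists>k<d. nbR v k \<in> S)}"

definition inc :: "nat set \<Rightarrow> nat \<Rightarrow> nat" where
  "inc S v = card {k. k < d \<and> nbR v k \<in> S}"

definition F :: "(nat \<Rightarrow> bool) \<Rightarrow> nat set" where
  "F x = {i. i < n \<and> x i \<noteq> y i}"

lemma F_sub: "F x \<subseteq> {..<n}" and finite_F [simp]: "finite (F x)"
  by (auto simp: F_def)

lemma finite_N [simp]: "finite (N S)"
  by (simp add: N_def)

lemma D_pos: "0 < D"
  using \<delta>D by (cases D) auto

lemma inc_pos: "v < m \<Longrightarrow> inc S v > 0 \<longleftrightarrow> v \<in> N S"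
  by (auto simp: inc_def N_def card_gt_0_iff)

lemma degree: "i < n \<Longrightarrow> card {v. v < m \<and> (\<exists>k<d. nbR v k = i)} = c"
proof -
  assume i: "i < n"
  have "{v. v < m \<and> (\<exists>k<d. nbR v k = i)} = {v. v < m \<and> (\<exists>j<c. nbL i j = v)}"
    using adjacent[OF i] by auto
  also have "\<dots> = nbL i ` {..<c}" using nbL_less[OF i] by auto
  finally have "{v. v < m \<and> (\<exists>k<d. nbR v k = i)} = nbL i ` {..<c}" .
  then show ?thesis using card_image[OF inj_nbL[OF i]] by simp
qed

text \<open>Double counting of the edges that leave \<open>S\<close>.\<close>

lemma sum_inc:
  assumes "S \<subseteq> {..<n}"
  shows "(\<Sum>v<m. inc S v) = c * card S"
proof -
  have fin: "finite S" using assms finite_subset by blast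
  have "inc S v = (\<Sum>i\<in>S. of_bool (\<exists>k<d. nbR v k = i))" if "v < m" for v
  proof -
    have "bij_betw (nbR v) {k. k < d \<and> nbR v k \<in> S} {i \<in> S. \<exists>k<d. nbR v k = i}"
      unfolding bij_betw_def
    proof
      show "inj_on (nbR v) {k. k < d \<and> nbR v k \<in> S}"
        by (rule inj_on_subset[OF inj_nbR[OF that]]) auto
    qed auto
    then have "inc S v = card {i \<in> S. \<exists>k<d. nbR v k = i}"
      unfolding inc_def by (rule bij_betw_same_card)
    also have "\<dots> = (\<Sum>i\<in>S. of_bool (\<exists>k<d. nbR v k = i))"
      using fin by (simp add: sum.If_cases of_bool_def Int_def)
    finally show ?thesis .
  qed
  then have "(\<Sum>v<m. inc S v) = (\<Sum>v<m. \<Sum>i\<in>S. of_bool (\<exists>k<d. nbR v k = i))" by simp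
  also have "\<dots> = (\<Sum>i\<in>S. \<Sum>v<m. of_bool (\<exists>k<d. nbR v k = i))" by (rule sum.swap)
  also have "\<dots> = (\<Sum>i\<in>S. c)"
  proof (rule sum.cong)
    fix i assume "i \<in> S"
    then have "i < n" using assms by auto
    have "(\<Sum>v<m. of_bool (\<exists>k<d. nbR v k = i) :: nat) = card {v. v < m \<and> (\<exists>k<d. nbR v k = i)}"
      by (simp add: sum.If_cases of_bool_def Int_def)
    with degree[OF \<open>i < n\<close>] show "(\<Sum>v<m. of_bool (\<exists>k<d. nbR v k = i)) = c" by simp
  qed simp
  finally show ?thesis by simp
qed

lemma hamming_view:
  assumes "v < m"
  shows "hamming (view x v) (view z v) = inc {i. i < n \<and> x i \<noteq> z i} v"
proof -
  have "{k. k < length (view x v) \<and> view x v ! k \<noteq> view z v ! k} =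
      {k. k < d \<and> nbR v k \<in> {i. i < n \<and> x i \<noteq> z i}}"
    using nbR_less[OF assms] by (auto simp: view_def)
  then show ?thesis unfolding hamming_def inc_def by simp
qed

lemma length_view [simp]: "length (view x v) = d"
  by (simp add: view_def)

lemma y_view: "v < m \<Longrightarrow> view y v \<in> C0"
  using y_code by (auto simp: unsat_def)

text \<open>Both local words belong to \<open>C0\<close> and they differ, so they differ in at least
  \<open>D\<close> places.\<close>

lemma satisfied_error:
  assumes "unsat z \<subseteq> - {v}" "v \<in> N {i. i < n \<and> x i \<noteq> z i}" "view x v \<in> C0"
  shows "D \<le> inc {i. i < n \<and> x i \<noteq> z i} v"
proof -
  have v: "v < m" using assms(2) by (simp add: N_def)
  have "0 < inc {i. i < n \<and> x i \<noteq> z i} v" using inc_pos[OF v] assms(2) by blast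
  with hamming_view[OF v, of x z] have "view x v \<noteq> view z v" by (auto simp: hamming_def)
  moreover have "view z v \<in> C0" using assms(1) v by (auto simp: unsat_def)
  ultimately have "D \<le> hamming (view x v) (view z v)" using code_dist assms(3) by blast
  then show ?thesis using hamming_view[OF v, of x z] by simp
qed

text \<open>Markov's inequality for the \<open>c * card S\<close> edges that leave
  \<open>S\<close>.\<close>

lemma heavy:
  assumes "S \<subseteq> {..<n}"
  shows "D * card {v. v < m \<and> D \<le> inc S v} \<le> c * card S"
proof -
  have "D * card {v. v < m \<and> D \<le> inc S v} = (\<Sum>v | v < m \<and> D \<le> inc S v. D)" by simp
  also have "\<dots> \<le> (\<Sum>v | v < m \<and> D \<le> inc S v. inc S v)" by (rule sum_mono) auto
  also have "\<dots> \<le> (\<Sum>v<m. inc S v)" by (rule sum_mono2) auto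
  finally show ?thesis using sum_inc[OF assms] by simp
qed

lemma unsat_sub: "unsat x \<subseteq> N (F x)"
proof
  fix v assume v: "v \<in> unsat x"
  then have m: "v < m" by (simp add: unsat_def)
  have "view x v \<noteq> view y v" using v y_view[OF m] by (auto simp: unsat_def)
  then have "hamming (view x v) (view y v) \<noteq> 0"
    using hamming_0_imp_eq[of "view x v" "view y v"] by auto
  then show "v \<in> N (F x)" using hamming_view[OF m, of x y] inc_pos[OF m, of "F x"] by (simp add: F_def)
qed

lemma u_upper: "u x \<le> c * card (F x)"
proof -
  have "u x \<le> card (N (F x))" by (rule card_mono[OF finite_N unsat_sub])
  also have "card (N (F x)) = (\<Sum>v\<in>N (F x). 1)" by simp
  also have "\<dots> \<le> (\<Sum>v\<in>N (F x). inc (F x) v)"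
  proof (rule sum_mono)
    fix v assume v: "v \<in> N (F x)"
    then have "v < m" by (simp add: N_def)
    with inc_pos v show "1 \<le> inc (F x) v" by (simp add: Suc_le_eq)
  qed
  also have "\<dots> \<le> (\<Sum>v<m. inc (F x) v)" by (rule sum_mono2) (auto simp: N_def)
  finally show ?thesis using sum_inc[OF F_sub] by simp
qed

text \<open>The errors have at least \<open>\<delta> * c * card (F x)\<close> neighbors. A satisfied
  one sees at least \<open>D\<close> errors, so by \<open>heavy\<close> and
  \<open>\<delta> * D > 2\<close> at most half of this number are satisfied.\<close>

lemma u_lower:
  assumes "card (F x) \<le> \<alpha> * n"
  shows "\<delta> * c * card (F x) \<le> 2 * u x"
proof -
  let ?H = "{v. v < m \<and> D \<le> inc (F x) v}"
  have "N (F x) \<subseteq> unsat x \<union> ?H"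
  proof
    fix v assume v: "v \<in> N (F x)"
    show "v \<in> unsat x \<union> ?H"
    proof (cases "view x v \<in> C0")
      case True
      then show ?thesis using satisfied_error[of y v x] v y_code by (auto simp: F_def N_def)
    next
      case False
      then show ?thesis using v by (auto simp: unsat_def N_def)
    qed
  qed
  then have "card (N (F x)) \<le> card (unsat x \<union> ?H)" by (rule card_mono[rotated]) simp
  also have "\<dots> \<le> u x + card ?H" by (rule card_Un_le)
  finally have "real (card (N (F x))) \<le> u x + card ?H" by linarith
  moreover have "\<delta> * c * card (F x) \<le> card (N (F x))"
    using expansion[OF F_sub assms] by (simp add: N_def)
  moreover have "2 * real (card ?H) \<le> \<delta> * c * card (F x)"
  proof -
    have "2 * real (card ?H) \<le> \<delta> * D * card ?H"
      using \<delta>D by (intro mult_right_mono) auto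
    also have "\<dots> = \<delta> * real (D * card ?H)" by simp
    also have "\<dots> \<le> \<delta> * real (c * card (F x))"
      using heavy[OF F_sub, of x] \<delta>_pos by (intro mult_left_mono) (auto simp only: of_nat_le_iff)
    finally show ?thesis by simp
  qed
  ultimately show ?thesis by linarith
qed

lemma F_app:
  assumes "p \<in> branches"
  shows "F (app p x) = (F x - flipset p x) \<union> (flipset p x - F x)"
  using flipset_less[OF assms] by (auto simp: F_def app_def)

lemma card_F_app_le:
  assumes "p \<in> branches"
  shows "card (F (app p x)) \<le> (1 + c) * card (F x)"
proof -
  have "card (F (app p x)) \<le> card (F x \<union> flipset p x)"
    unfolding F_app[OF assms] by (rule card_mono) auto
  also have "\<dots> \<le> card (F x) + card (flipset p x)" by (rule card_Un_le)
  also have "card (flipset p x) \<le> c * card (F x)"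
    using card_flipset[of p x] u_upper[of x] by linarith
  finally show ?thesis by simp
qed

lemma card_F_apps_le:
  "set \<tau> \<subseteq> branches \<Longrightarrow> card (F (apps \<tau> x)) \<le> (1 + c) ^ length \<tau> * card (F x)"
proof (induction \<tau> arbitrary: x)
  case (Cons p \<tau>)
  have "card (F (apps \<tau> (app p x))) \<le> (1 + c) ^ length \<tau> * card (F (app p x))" using Cons by simp
  also have "\<dots> \<le> (1 + c) ^ length \<tau> * ((1 + c) * card (F x))"
    by (rule mult_le_mono2, rule card_F_app_le) (use Cons in simp)
  finally show ?case by (simp only: fold_simps length_Cons power_Suc mult_ac)
qed simp

definition gain :: "branch \<Rightarrow> (nat \<Rightarrow> bool) \<Rightarrow> real" where
  "gain p x = real (card (flipset p x \<inter> F x)) - real (card (flipset p x - F x))"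

lemma card_F_app:
  assumes "p \<in> branches"
  shows "real (card (F (app p x))) = real (card (F x)) - gain p x"
proof -
  have "card (F (app p x)) = card (F x - flipset p x) + card (flipset p x - F x)"
    unfolding F_app[OF assms] by (rule card_Un_disjoint) auto
  moreover have "card (F x) = card (F x - flipset p x) + card (flipset p x \<inter> F x)"
    using card_Int_Diff[of "F x" "flipset p x"] by (simp add: Int_commute)
  ultimately show ?thesis by (simp add: gain_def)
qed

section \<open>Weighted votes and the gain of a branch\<close>

definition decodable :: "bool list \<Rightarrow> bool" where
  "decodable w \<longleftrightarrow> length w = d \<and> w \<notin> C0 \<and> (\<exists>b\<in>C0. 2 * hamming w b < D)"

definition nearest :: "bool list \<Rightarrow> bool list" where
  "nearest w = (SOME b. b \<in> C0 \<and> 2 * hamming w b < D)"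

text \<open>Putting decodability inside the choice makes it satisfiable for every word, so the
  result is a valid coordinate without a case distinction.\<close>

definition wrong_pos :: "bool list \<Rightarrow> nat" where
  "wrong_pos w = (SOME k. k < d \<and> (decodable w \<longrightarrow> w ! k \<noteq> nearest w ! k))"

text \<open>A constraint whose local word has distance \<open>t\<close> from the code votes with weight \<open>D - 2 t\<close>,
  as in generalized minimum distance decoding. A constraint that votes wrongly sees at
  least \<open>D - t\<close> errors, so its weight is at most the deficit \<open>2 e - D\<close> of its error count \<open>e\<close>.\<close>

definition weight :: "bool list \<Rightarrow> real" where
  "weight w = (if decodable w then real D - 2 * real (hamming w (nearest w)) else 0)"

lemma nearest: "decodable w \<Longrightarrow> nearest w \<in> C0 \<and> 2 * hamming w (nearest w) < D"
  unfolding decodable_def nearest_def by (rule someI_ex) blast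

lemma wrong_pos: "wrong_pos w < d \<and> (decodable w \<longrightarrow> w ! wrong_pos w \<noteq> nearest w ! wrong_pos w)"
  unfolding wrong_pos_def
proof (rule someI_ex)
  show "\<exists>k. k < d \<and> (decodable w \<longrightarrow> w ! k \<noteq> nearest w ! k)"
  proof (cases "decodable w")
    case True
    have "w \<notin> C0" "length w = d" "nearest w \<in> C0"
      using True nearest[OF True] by (simp_all add: decodable_def)
    then have w: "w \<noteq> nearest w" "length w = d" "length (nearest w) = d"
      using words[of "nearest w"] by metis+
    show ?thesis
    proof (rule ccontr)
      assume "\<not> ?thesis"
      then have "w ! k = nearest w ! k" if "k < d" for k using True that by blast
      then have "w = nearest w" by (intro nth_equalityI) (simp_all add: w)
      with w(1) show False ..
    qed
  qed (use edges in auto)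
qed

lemma weight_bounds: "0 \<le> weight w" "weight w \<le> D"
  using nearest[of w] by (auto simp: weight_def)

definition vote :: "(nat \<Rightarrow> bool) \<Rightarrow> nat \<Rightarrow> real" where
  "vote x v = (if nbR v (wrong_pos (view x v)) \<in> F x then 1 else - 1)"

text \<open>Satisfied and undecodable constraints have no say, but they see at least
  \<open>D / 2\<close> errors, so the left side is not positive. If the nearest codeword is the true
  local word, both sides agree. Otherwise the triangle inequality gives
  \<open>D \<le> t + e\<close>, that is, \<open>D - 2 e \<le> - (D - 2 t)\<close>.\<close>

lemma vote_bound:
  assumes v: "v \<in> N (F x)"
  shows "real D - 2 * real (inc (F x) v) \<le>
    (if v \<in> unsat x then weight (view x v) * vote x v else 0)"
proof -
  let ?w = "view x v" and ?b = "view y v"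
  have m: "v < m" using v by (simp add: N_def)
  have e: "hamming ?w ?b = inc (F x) v" using hamming_view[OF m, of x y] by (simp add: F_def)
  note b = y_view[OF m]
  show ?thesis
  proof (cases "v \<in> unsat x")
    case False
    then have "?w \<in> C0" using m by (simp add: unsat_def)
    then have "D \<le> inc (F x) v"
      using satisfied_error[of y v x] v y_code by (auto simp: F_def)
    then show ?thesis using False by simp
  next
    case True
    then have w: "?w \<notin> C0" by (simp add: unsat_def)
    show ?thesis
    proof (cases "decodable ?w")
      case False
      then have "D \<le> 2 * inc (F x) v" using b w e by (auto simp: decodable_def not_less)
      then show ?thesis using True False by (simp add: weight_def)
    next
      case dec: True
      note nb = nearest[OF dec]
      have k: "wrong_pos ?w < d" "?w ! wrong_pos ?w \<noteq> nearest ?w ! wrong_pos ?w"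
        using wrong_pos[of ?w] dec by auto
      show ?thesis
      proof (cases "nearest ?w = ?b")
        case True
        then have "x (nbR v (wrong_pos ?w)) \<noteq> y (nbR v (wrong_pos ?w))"
          using k by (simp add: view_def)
        then have "vote x v = 1" using nbR_less[OF m k(1)] by (simp add: vote_def F_def)
        then show ?thesis using \<open>v \<in> unsat x\<close> dec e True by (simp add: weight_def)
      next
        case False
        then have "D \<le> hamming (nearest ?w) ?b" using code_dist nb b by blast
        also have "\<dots> \<le> hamming (nearest ?w) ?w + hamming ?w ?b"
          by (rule hamming_triangle) (use nb words in simp)
        also have "hamming (nearest ?w) ?w = hamming ?w (nearest ?w)"
          by (rule hamming_commute) (use nb words in simp)
        finally have "real D \<le> real (hamming ?w (nearest ?w)) + real (inc (F x) v)" using e by linarith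
        then have "real D - 2 * real (inc (F x) v) \<le> - weight ?w" using dec by (simp add: weight_def)
        also have "\<dots> \<le> weight ?w * vote x v" using weight_bounds[of ?w] by (simp add: vote_def)
        finally show ?thesis using \<open>v \<in> unsat x\<close> by simp
      qed
    qed
  qed
qed

text \<open>Summing \<open>vote_bound\<close> over the neighbors of the errors gives at least
  \<open>D * card (N (F x)) - 2 * c * card (F x)\<close>, because the error counts add up to
  \<open>c * card (F x)\<close>. Expansion bounds the first term.\<close>

lemma total_vote:
  assumes "card (F x) \<le> \<alpha> * n"
  shows "(\<delta> * D - 2) * c * card (F x) \<le> (\<Sum>v\<in>unsat x. weight (view x v) * vote x v)"
proof -
  have "\<delta> * c * card (F x) \<le> card (N (F x))"
    using expansion[OF F_sub assms] by (simp add: N_def)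
  then have "real D * (\<delta> * c * card (F x)) \<le> real D * card (N (F x))"
    by (rule mult_left_mono) simp
  moreover have "(\<Sum>v\<in>N (F x). inc (F x) v) = c * card (F x)"
    unfolding sum_inc[OF F_sub, symmetric]
    by (rule sum.mono_neutral_left) (use inc_pos in \<open>auto simp: N_def\<close>)
  then have "(\<Sum>v\<in>N (F x). real (inc (F x) v)) = c * card (F x)"
    by (metis of_nat_sum of_nat_mult)
  then have "(\<Sum>v\<in>N (F x). real D - 2 * real (inc (F x) v)) =
      real D * real (card (N (F x))) - 2 * (real c * real (card (F x)))"
    by (simp add: sum_subtractf sum_distrib_left[symmetric])
  moreover have "(\<Sum>v\<in>N (F x). real D - 2 * real (inc (F x) v)) \<le>
      (\<Sum>v\<in>N (F x). if v \<in> unsat x then weight (view x v) * vote x v else 0)"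
    by (rule sum_mono) (rule vote_bound)
  moreover have "\<dots> = (\<Sum>v\<in>unsat x. weight (view x v) * vote x v)"
    using unsat_sub[of x] by (simp add: sum.If_cases Int_absorb1)
  ultimately show ?thesis by (simp add: algebra_simps)
qed

lemma gain_sum:
  assumes "p = (w, k, j)" "p \<in> branches"
  shows "gain p x = (\<Sum>v | v \<in> unsat x \<and> view x v = w \<and> nbL (nbR v k) j = v.
    if nbR v k \<in> F x then 1 else - 1)"
proof -
  let ?V = "{v. v \<in> unsat x \<and> view x v = w \<and> nbL (nbR v k) j = v}"
  have A: "flipset p x = (\<lambda>v. nbR v k) ` ?V" by (auto simp: flipset_def assms(1))
  have inj: "inj_on (\<lambda>v. nbR v k) ?V" by (auto intro: inj_on_inverseI[of _ "\<lambda>i. nbL i j"])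
  have "(\<Sum>v\<in>?V. if nbR v k \<in> F x then 1 else - 1 :: real) = (\<Sum>i\<in>flipset p x. if i \<in> F x then 1 else - 1)"
    unfolding A by (simp add: sum.reindex[OF inj])
  also have "\<dots> = gain p x"
    by (simp add: sum.If_cases gain_def Diff_eq)
  finally show ?thesis by simp
qed

lemma unique_slot:
  assumes "v < m" "k < d"
  shows "card {j. j < c \<and> nbL (nbR v k) j = v} = 1"
proof -
  have i: "nbR v k < n" using nbR_less assms by simp
  then obtain j where j: "j < c" "nbL (nbR v k) j = v" using adjacent[OF i assms(1)] assms by blast
  have "{j. j < c \<and> nbL (nbR v k) j = v} = {j}"
    using j inj_onD[OF inj_nbL[OF i]] by auto
  then show ?thesis by simp
qed

text \<open>Every violated constraint \<open>v\<close> occurs in exactly one of these branches: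
  \<open>w\<close> is its local word, \<open>k\<close> the coordinate it votes for, and
  \<open>j\<close> its unique place in the list of that position.\<close>

lemma sum_gain:
  "(\<Sum>w | length w = d. \<Sum>j<c. weight w * gain (w, wrong_pos w, j) x) =
    (\<Sum>v\<in>unsat x. weight (view x v) * vote x v)"
proof -
  let ?k = wrong_pos
  have finw: "finite {w :: bool list. length w = d}"
    using finite_lists_length_eq[of "UNIV :: bool set" d] by simp
  let ?g = "\<lambda>w j v. if view x v = w \<and> nbL (nbR v (?k w)) j = v then weight w * vote x v else 0"
  have g: "weight w * gain (w, ?k w, j) x = (\<Sum>v\<in>unsat x. ?g w j v)" if "length w = d" "j < c" for w j
  proof -
    have "(w, ?k w, j) \<in> branches" using that wrong_pos[of w] by (simp add: branches_def)
    from gain_sum[OF refl this] have "weight w * gain (w, ?k w, j) x =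
        (\<Sum>v | v \<in> unsat x \<and> view x v = w \<and> nbL (nbR v (?k w)) j = v. weight w * vote x v)"
      by (simp add: sum_distrib_left vote_def)
    also have "\<dots> = (\<Sum>v\<in>unsat x. ?g w j v)"
      by (simp add: sum.If_cases Int_def)
    finally show ?thesis .
  qed
  have "(\<Sum>w | length w = d. \<Sum>j<c. weight w * gain (w, ?k w, j) x) =
      (\<Sum>w | length w = d. \<Sum>j<c. \<Sum>v\<in>unsat x. ?g w j v)"
    by (intro sum.cong refl g) auto
  also have "\<dots> = (\<Sum>w | length w = d. \<Sum>v\<in>unsat x. \<Sum>j<c. ?g w j v)"
    by (intro sum.cong refl sum.swap)
  also have "\<dots> = (\<Sum>v\<in>unsat x. \<Sum>w | length w = d. \<Sum>j<c. ?g w j v)"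
    by (rule sum.swap)
  also have "\<dots> = (\<Sum>v\<in>unsat x. weight (view x v) * vote x v)"
  proof (rule sum.cong)
    fix v assume "v \<in> unsat x"
    then have m: "v < m" by (simp add: unsat_def)
    have "(\<Sum>w | length w = d. \<Sum>j<c. ?g w j v) =
        (\<Sum>w | length w = d. if w = view x v then (\<Sum>j<c. ?g w j v) else 0)"
      by (intro sum.cong) auto
    also have "\<dots> = (\<Sum>j<c. ?g (view x v) j v)" using finw by simp
    also have "\<dots> = (\<Sum>j | j < c \<and> nbL (nbR v (?k (view x v))) j = v. weight (view x v) * vote x v)"
      by (simp add: sum.If_cases Int_def)
    also have "\<dots> = weight (view x v) * vote x v"
      using unique_slot[OF m, of "?k (view x v)"] wrong_pos[of "view x v"] by simp
    finally show "(\<Sum>w | length w = d. \<Sum>j<c. ?g w j v) = weight (view x v) * vote x v" .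
  qed simp
  finally show ?thesis .
qed

text \<open>The total of \<open>total_vote\<close> is shared by \<open>2 ^ d * c\<close> branches,
  one coordinate for each word, and weights are at most \<open>D\<close>; averaging yields twice
  this fraction of the errors. The extra 2 gives a strict contradiction in
  \<open>good_branch\<close>.\<close>

definition rate :: real where
  "rate = (\<delta> * D - 2) / (2 * 2 ^ d * D)"

lemma rate: "0 < rate" "rate < 1"
proof -
  show "0 < rate" using \<delta>D D_pos by (simp add: rate_def)
  have "\<delta> * D \<le> 1 * real D" using \<delta>_le by (intro mult_right_mono) auto
  then have "\<delta> * D - 2 < 1 * real D" by simp
  also have "(1::real) \<le> 2 ^ d" by simp
  then have "1 * real D \<le> (2 * 2 ^ d) * real D" by (intro mult_right_mono) linarith+
  finally show "rate < 1" using D_pos by (simp add: rate_def)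
qed

lemma good_branch:
  assumes "card (F x) \<le> \<alpha> * n"
  shows "\<exists>p\<in>branches. card (F (app p x)) \<le> (1 - rate) * card (F x)"
proof (cases "F x = {}")
  case True
  \<comment> \<open>Without errors no constraint is violated, so any branch changes nothing; the
    averaging argument needs a positive total.\<close>
  let ?p = "(replicate d False, 0, 0)"
  have "?p \<in> branches" using c_pos edges by (simp add: branches_def)
  moreover have "unsat x = {}" using u_upper[of x] True by simp
  then have "F (app ?p x) = F x" by (simp add: F_def app_def flipset_def)
  ultimately show ?thesis using True by (intro bexI[of _ ?p]) simp
next
  case False
  show ?thesis
  proof (rule ccontr)
    assume "\<not> ?thesis"
    then have less: "gain p x < rate * card (F x)" if "p \<in> branches" for p
      using card_F_app[OF that, of x] that by (force simp: algebra_simps)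
    have finw: "finite {w :: bool list. length w = d}"
      and cardw: "card {w :: bool list. length w = d} = 2 ^ d"
      using finite_lists_length_eq[of "UNIV :: bool set" d] card_lists_length_eq[of "UNIV :: bool set" d]
      by simp_all
    have "(\<delta> * D - 2) * c * card (F x) \<le> (\<Sum>w | length w = d. \<Sum>j<c. weight w * gain (w, wrong_pos w, j) x)"
      using total_vote[OF assms] by (simp only: sum_gain)
    also have "\<dots> \<le> (\<Sum>w :: bool list | length w = d. \<Sum>j<c. D * (rate * card (F x)))"
    proof (intro sum_mono)
      fix w :: "bool list" and j assume "w \<in> {w. length w = d}" "j \<in> {..<c}"
      then have "gain (w, wrong_pos w, j) x \<le> rate * card (F x)"
        using less[of "(w, wrong_pos w, j)"] wrong_pos[of w] by (simp add: branches_def)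
      then have "weight w * gain (w, wrong_pos w, j) x \<le> weight w * (rate * card (F x))"
        using weight_bounds by (intro mult_left_mono) auto
      also have "\<dots> \<le> D * (rate * card (F x))"
        using weight_bounds rate by (intro mult_right_mono) auto
      finally show "weight w * gain (w, wrong_pos w, j) x \<le> D * (rate * card (F x))" .
    qed
    also have "\<dots> = 2 ^ d * c * (D * (rate * card (F x)))"
      by (simp add: cardw)
    also have "\<dots> = (\<delta> * D - 2) * c * card (F x) / 2"
      using D_pos by (simp add: rate_def field_simps)
    finally have "(\<delta> * D - 2) * c * card (F x) \<le> 0" by linarith
    moreover have "0 < (\<delta> * D - 2) * c * card (F x)"
      using \<delta>D c_pos False by (simp add: card_gt_0_iff)
    ultimately show False by simp
  qed
qed

lemma good_branches:
  assumes "card (F x) \<le> \<alpha> * n"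
  shows "\<exists>\<tau>. length \<tau> = r \<and> set \<tau> \<subseteq> branches \<and> card (F (apps \<tau> x)) \<le> (1 - rate) ^ r * card (F x)"
  using assms
proof (induction r arbitrary: x)
  case 0
  show ?case by (intro exI[of _ "[]"]) simp
next
  case (Suc r)
  obtain p where p: "p \<in> branches" "card (F (app p x)) \<le> (1 - rate) * card (F x)"
    using good_branch[OF Suc.prems] by blast
  have "(1 - rate) * card (F x) \<le> 1 * real (card (F x))" using rate by (intro mult_right_mono) auto
  then have "card (F (app p x)) \<le> \<alpha> * n" using p Suc.prems by linarith
  from Suc.IH[OF this] obtain \<tau> where \<tau>: "length \<tau> = r" "set \<tau> \<subseteq> branches"
    "card (F (apps \<tau> (app p x))) \<le> (1 - rate) ^ r * card (F (app p x))" by blast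
  have "(1 - rate) ^ r * card (F (app p x)) \<le> (1 - rate) ^ r * ((1 - rate) * card (F x))"
    using p rate by (intro mult_left_mono) auto
  with \<tau> p show ?case by (intro exI[of _ "p # \<tau>"]) (simp add: mult_ac)
qed

section \<open>Uniqueness of the closest codeword and the choice of constants\<close>

text \<open>The two codewords may differ in twice as many positions as expansion allows, so only
  half of the difference is expanded. All its neighbors are satisfied by both words, hence see at
  least \<open>D\<close> differences. Counting edges then contradicts
  \<open>\<delta> * D > 2\<close>.\<close>

lemma codeword_unique:
  assumes z: "unsat z = {}" and "card {i. i < n \<and> z i \<noteq> inp i} \<le> card {i. i < n \<and> y i \<noteq> inp i}"
    and "i < n"
  shows "z i = y i"
proof (rule ccontr)
  assume i: "z i \<noteq> y i"
  let ?h = "card {i. i < n \<and> y i \<noteq> inp i}"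
  have h: "?h \<le> \<alpha> * n" using close by (simp add: eq_commute)
  have "card (F z) \<le> card ({i. i < n \<and> z i \<noteq> inp i} \<union> {i. i < n \<and> y i \<noteq> inp i})"
    by (rule card_mono) (auto simp: F_def)
  also have "\<dots> \<le> card {i. i < n \<and> z i \<noteq> inp i} + ?h" by (rule card_Un_le)
  finally have F2: "card (F z) \<le> 2 * ?h" using assms(2) by linarith
  \<comment> \<open>Rounding up gives \<open>card (F z) \<le> 2 * ?q\<close> and keeps
    \<open>?q\<close> positive, while \<open>?q \<le> ?h\<close> still holds because
    \<open>2 * ?h\<close> is even.\<close>
  let ?q = "(card (F z) + 1) div 2"
  have "?q \<le> card (F z)" by presburger
  then obtain S where S: "S \<subseteq> F z" "card S = ?q" by (rule obtain_subset_with_card_n) auto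
  have "?q \<le> ?h" using F2 by linarith
  then have "card S \<le> \<alpha> * n" using h S(2) by linarith
  then have "\<delta> * c * ?q \<le> card (N S)"
    using expansion[of S] S F_sub by (auto simp: N_def)
  also have "card (N S) \<le> card (N (F z))"
    using card_mono[of "N (F z)" "N S"] S(1) by (fastforce simp: N_def)
  finally have *: "\<delta> * c * ?q \<le> card (N (F z))" by simp
  have "N (F z) \<subseteq> {v. v < m \<and> D \<le> inc (F z) v}"
  proof
    fix v assume v: "v \<in> N (F z)"
    then have "v < m" by (simp add: N_def)
    moreover from this have "view z v \<in> C0" using z by (auto simp: unsat_def)
    ultimately show "v \<in> {v. v < m \<and> D \<le> inc (F z) v}"
      using satisfied_error[of y v z] v y_code by (auto simp: F_def)
  qed
  then have "card (N (F z)) \<le> card {v. v < m \<and> D \<le> inc (F z) v}" by (rule card_mono[rotated]) simp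
  then have "D * card (N (F z)) \<le> c * card (F z)"
    using heavy[OF F_sub, of z] mult_le_mono2 order_trans by blast
  then have "D * card (N (F z)) \<le> c * (2 * ?q)"
    using mult_le_mono2[of "card (F z)" "2 * ?q" c] by linarith
  then have "real D * card (N (F z)) \<le> c * (2 * ?q)" by (metis of_nat_le_iff of_nat_mult)
  moreover have "real D * (\<delta> * c * ?q) \<le> real D * card (N (F z))"
    using * by (intro mult_left_mono) auto
  ultimately have "\<delta> * D * (c * real ?q) \<le> 2 * (c * real ?q)" by (simp add: mult_ac)
  moreover have "0 < card (F z)" using i \<open>i < n\<close> by (auto simp: card_gt_0_iff F_def)
  then have "0 < c * real ?q" using c_pos by simp
  ultimately have "\<delta> * D \<le> 2" using mult_le_cancel_right_pos by blast
  then show False using \<delta>D by simp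
qed

text \<open>By \<open>u_lower\<close> the errors number at most \<open>2 / (\<delta> * c)\<close>
  times \<open>u x\<close>, and each of \<open>r\<close> rounds multiplies them by at most
  \<open>1 + c\<close>. So \<open>growth r * u x\<close> bounds the errors after any
  \<open>r\<close> rounds, good or bad.\<close>

definition growth :: "nat \<Rightarrow> real" where
  "growth r = (1 + c) ^ r * 2 / (\<delta> * c)"

text \<open>The second condition is the slack: whatever sequence of length \<open>r\<close> is
  accepted, at most \<open>\<alpha> * n\<close> errors remain and \<open>u_lower\<close> still
  applies. It is inherited because \<open>u\<close> has been halved.\<close>

definition Good :: "nat \<Rightarrow> (nat \<Rightarrow> bool) \<Rightarrow> bool" where
  "Good r x \<longleftrightarrow> card (F x) \<le> \<alpha> * n \<and> growth r * u x \<le> \<alpha> * n"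

text \<open>With \<open>(1 - rate) ^ r \<le> \<delta> / 4\<close>, good rounds leave
  \<open>u\<close> at most \<open>\<delta> * c / 4\<close> times the old number of errors, which is
  at most half of the old \<open>u\<close> by \<open>u_lower\<close>. The condition on
  \<open>r1\<close> makes \<open>u\<close> after \<open>r1\<close> good rounds small enough for the
  slack.\<close>

lemma decoder_good:
  assumes ts: "set ts = {\<tau>. set \<tau> \<subseteq> branches \<and> length \<tau> = r}"
    and ts1: "set ts1 = {\<tau>. set \<tau> \<subseteq> branches \<and> length \<tau> = r1}"
    and r: "(1 - rate) ^ r \<le> \<delta> / 4" and r1: "growth r * c * (1 - rate) ^ r1 \<le> 1"
  shows "decoder_good c d C0 n m nbL nbR inp ts ts1 (Good r) y"
proof
  show "\<forall>\<tau>\<in>set ts. set \<tau> \<subseteq> branches" "\<forall>\<tau>\<in>set ts1. set \<tau> \<subseteq> branches"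
    using ts ts1 by auto
  have gr: "0 < growth r" using \<delta>_pos c_pos by (simp add: growth_def)
  have dc: "0 < \<delta> * c" using \<delta>_pos c_pos by simp
  have low: "card (F x) \<le> 2 * u x / (\<delta> * c)" if "card (F x) \<le> \<alpha> * n" for x
    using u_lower[OF that] dc by (simp add: field_simps)
  {
    fix x assume x: "Good r x" "unsat x \<noteq> {}"
    then have Fx: "card (F x) \<le> \<alpha> * n" by (simp add: Good_def)
    from good_branches[OF this, of r] obtain \<tau> where
      \<tau>: "length \<tau> = r" "set \<tau> \<subseteq> branches" "card (F (apps \<tau> x)) \<le> (1 - rate) ^ r * card (F x)" by blast
    have "real (u (apps \<tau> x)) \<le> c * real (card (F (apps \<tau> x)))"
      using u_upper[of "apps \<tau> x"] by (metis of_nat_le_iff of_nat_mult)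
    also have "\<dots> \<le> c * (\<delta> / 4 * card (F x))"
      using order_trans[OF \<tau>(3) mult_right_mono[OF r]] by (intro mult_left_mono) auto
    also have "\<dots> = \<delta> * c * card (F x) / 4" by simp
    also have "\<dots> \<le> u x / 2" using u_lower[OF Fx] by simp
    finally have "2 * u (apps \<tau> x) \<le> u x" by linarith
    then show "\<exists>\<tau>\<in>set ts. 2 * u (apps \<tau> x) \<le> u x" using \<tau> ts by auto
  next
    fix x \<tau> assume x: "Good r x" and "\<tau> \<in> set ts" and half: "2 * u (apps \<tau> x) \<le> u x"
    then have \<tau>: "length \<tau> = r" "set \<tau> \<subseteq> branches" using ts by auto
    have Fx: "card (F x) \<le> \<alpha> * n" using x by (simp add: Good_def)
    have "real (card (F (apps \<tau> x))) \<le> real ((1 + c) ^ r * card (F x))"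
      using card_F_apps_le[OF \<tau>(2), of x] \<tau>(1) by (simp only: of_nat_le_iff)
    also have "\<dots> = (1 + c) ^ r * real (card (F x))" by simp
    also have "\<dots> \<le> (1 + c) ^ r * (2 * u x / (\<delta> * c))"
      using low[OF Fx] by (intro mult_left_mono) auto
    also have "\<dots> = growth r * u x" by (simp add: growth_def)
    finally have 1: "card (F (apps \<tau> x)) \<le> \<alpha> * n" using x by (simp add: Good_def)
    have "growth r * u (apps \<tau> x) \<le> growth r * u x"
      using half gr by (intro mult_left_mono) auto
    with x 1 show "Good r (apps \<tau> x)" by (simp add: Good_def)
  next
    fix x i assume "Good r x" "unsat x = {}" "i < n"
    then have "card (F x) \<le> 0" using low[of x] by (simp add: Good_def)
    then show "x i = y i" using \<open>i < n\<close> by (auto simp: F_def)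
  next
    have Fi: "card (F inp) \<le> \<alpha> * n" using close by (simp add: F_def)
    from good_branches[OF this, of r1] obtain \<tau> where
      \<tau>: "length \<tau> = r1" "set \<tau> \<subseteq> branches" "card (F (apps \<tau> inp)) \<le> (1 - rate) ^ r1 * card (F inp)" by blast
    have "(1 - rate) ^ r1 * card (F inp) \<le> 1 * real (card (F inp))"
      using rate by (intro mult_right_mono power_le_one) auto
    with \<tau> Fi have 1: "card (F (apps \<tau> inp)) \<le> \<alpha> * n" by linarith
    have "real (u (apps \<tau> inp)) \<le> c * real (card (F (apps \<tau> inp)))"
      using u_upper[of "apps \<tau> inp"] by (metis of_nat_le_iff of_nat_mult)
    also have "\<dots> \<le> c * ((1 - rate) ^ r1 * (\<alpha> * n))"
    proof (rule mult_left_mono)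
      have "(1 - rate) ^ r1 * card (F inp) \<le> (1 - rate) ^ r1 * (\<alpha> * n)"
        using Fi rate by (intro mult_left_mono) auto
      with \<tau>(3) show "card (F (apps \<tau> inp)) \<le> (1 - rate) ^ r1 * (\<alpha> * n)" by linarith
    qed simp
    finally have "growth r * u (apps \<tau> inp) \<le> growth r * (c * ((1 - rate) ^ r1 * (\<alpha> * n)))"
      using gr by (intro mult_left_mono) auto
    also have "\<dots> = (growth r * c * (1 - rate) ^ r1) * (\<alpha> * n)" by (simp add: mult_ac)
    also have "\<dots> \<le> 1 * (\<alpha> * n)" using r1 \<alpha>_pos by (intro mult_right_mono) auto
    finally show "\<exists>\<tau>\<in>set ts1. Good r (apps \<tau> inp)" using \<tau> ts1 1 by (auto simp: Good_def)
  next
    show "unsat z = {} \<Longrightarrow> card {i. i < n \<and> z i \<noteq> inp i} \<le> card {i. i < n \<and> y i \<noteq> inp i} \<Longrightarrow>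
      i < n \<Longrightarrow> z i = y i" for z i by (rule codeword_unique)
  }
qed

end

section \<open>Unpacking the input and delivering the output\<close>

lemma lrun_count:
  assumes "I 0 M" and "list_all basic is"
    and "\<And>k M. k < N \<Longrightarrow> I k M \<Longrightarrow> M a < M b \<and> I (Suc k) (fold effect is M)"
    and "\<And>M. I N M \<Longrightarrow> \<not> M a < M b"
  shows "\<exists>M'. lrun (While_lt [] a b (Block is)) M (N * (length is + 2) + 2) M' \<and> I N M'"
proof -
  have "\<exists>M'. lrun (While_lt [] a b (Block is)) M ((N - k) * (length is + 2) + 2) M' \<and> I N M'"
    if "k \<le> N" "I k M" for k M
    using that
  proof (induction "N - k" arbitrary: k M)
    case 0
    then have "k = N" by simp
    with 0 assms(4) have "lrun (While_lt [] a b (Block is)) M (length ([] :: instr list) + 2) M"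
      by (intro lrun.While_false) auto
    with 0 \<open>k = N\<close> show ?case by auto
  next
    case (Suc r)
    then have k: "k < N" "r = N - Suc k" by auto
    from Suc.hyps(1)[OF this(2)] k assms(3)[OF k(1) Suc.prems(2)] obtain M' where M':
      "lrun (While_lt [] a b (Block is)) (fold effect is M) ((N - Suc k) * (length is + 2) + 2) M'" "I N M'"
      by auto
    have "lrun (While_lt [] a b (Block is)) M
        (length ([] :: instr list) + Suc (length is + Suc ((N - Suc k) * (length is + 2) + 2))) M'"
      using assms(3)[OF k(1) Suc.prems(2)]
      by (intro lrun.While_true[OF _ _ _ lrun.Block[OF assms(2)] M'(1)]) auto
    moreover have "N - k = Suc (N - Suc k)" using k by simp
    then have "length ([] :: instr list) + Suc (length is + Suc ((N - Suc k) * (length is + 2) + 2)) =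
        (N - k) * (length is + 2) + 2" by simp
    ultimately show ?case using M'(2) by metis
  qed
  from this[of 0 M] assms(1) show ?thesis by simp
qed

lemma fold_effect_replicate_Add:
  assumes "r \<noteq> a"
  shows "fold effect (replicate q (Add r r a)) M = M(r := M r + int q * M a)"
proof (induction q arbitrary: M)
  case (Suc q)
  have "effect (Add r r a) M = M(r := M r + M a)" by simp
  with assms show ?case
    by (simp only: replicate_Suc fold_simps Suc) (simp add: fun_eq_iff algebra_simps)
qed simp

text \<open>The input occupies the cells of the registers. Its first cells are moved away one by one,
  using only cells 0 and 1 as long as no other cell is free.\<close>

definition relocate :: "nat \<Rightarrow> instr list" where
  "relocate c = Const 1 30 # replicate (2 * c + 1) (Add 1 1 0) @ [Store 1 2, Const 2 6] @
     concat (map (\<lambda>k. [Add 1 1 2, Store 1 k]) [3..<17]) @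
     [Const 3 18] @ replicate (2 * c + 1) (Add 3 3 0) @
     [Const 5 2] @ replicate (2 * c + 1) (Add 5 5 0) @ [Const 4 17, Const 6 1]"

definition prologue :: "nat \<Rightarrow> lcom" where
  "prologue c = Sq (Block (relocate c))
     (While_lt [] 4 5 (Block [Add 1 1 2, Load 7 4, Store 1 7, Add 4 4 6]))"

text \<open>Cells 2 to \<open>k - 1\<close> have been copied. Cells below 17 are constrained in sign
  only, since they become registers; nonnegativity ensures that \<open>nat\<close> loses
  nothing.\<close>

definition moved :: "mem \<Rightarrow> nat \<Rightarrow> nat \<Rightarrow> mem \<Rightarrow> bool" where
  "moved M0 B k M \<longleftrightarrow> (\<forall>i. 2 \<le> i \<and> i < k \<longrightarrow> M (B + 6 * i) = M0 i) \<and>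
     (\<forall>a\<ge>17. (\<forall>i. 2 \<le> i \<and> i < k \<longrightarrow> a \<noteq> B + 6 * i) \<longrightarrow> M a = M0 a) \<and> (\<forall>a. 0 \<le> M a)"

lemma moved_reg: "moved M0 B k M \<Longrightarrow> r < 17 \<Longrightarrow> 16 < B \<Longrightarrow> 0 \<le> w \<Longrightarrow> moved M0 B k (M(r := w))"
  by (auto simp: moved_def)

lemma moved_Suc: "moved M0 B k M \<Longrightarrow> 16 < B \<Longrightarrow> 2 \<le> k \<Longrightarrow> 0 \<le> M0 k \<Longrightarrow> moved M0 B (Suc k) (M(B + 6 * k := M0 k))"
  by (auto simp: moved_def less_Suc_eq)

text \<open>By \<open>d * m = c * n\<close> the input ends at \<open>2 + (2 * c + 1) * n\<close>, so
  \<open>B\<close> lies beyond both input and registers, and the constant 30 leads to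
  \<open>B + 6 * 2\<close>, the new place of cell 2. Cell 1 holds \<open>m\<close>, which the
  decoder never reads, so it is free as a first pointer. The maximum covers inputs that end before
  cell 17.\<close>

lemma prologue_correct:
  fixes c n :: nat
  assumes M0: "M 0 = int n" "\<forall>a. 0 \<le> M a"
  defines "B \<equiv> 18 + (2 * c + 1) * n"
  shows "\<exists>M'. lrun (prologue c) M (length (relocate c) + ((2 * c + 1) * n - 15) * 6 + 2) M' \<and>
    M' 0 = int n \<and> M' 3 = int B \<and> moved M B (max 17 (2 + (2 * c + 1) * n)) M'"
proof -
  let ?L = "2 + (2 * c + 1) * n"
  have B: "16 < B" "?L \<le> B" by (auto simp: B_def)
  let ?M1 = "M(1 := int (B + 12))"
  have "fold effect (Const 1 30 # replicate (2 * c + 1) (Add 1 1 0)) M = ?M1"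
  proof -
    have "30 + int (2 * c + 1) * int n = int (B + 12)" by (simp add: B_def algebra_simps)
    moreover have "fold effect (Const 1 30 # replicate (2 * c + 1) (Add 1 1 0)) M =
        fold effect (replicate (2 * c + 1) (Add 1 1 0)) (M(1 := 30))"
      by (simp only: fold_simps effect.simps)
    ultimately show ?thesis
      using M0(1) by (simp only: fold_effect_replicate_Add) (simp add: fun_eq_iff)
  qed
  moreover have "relocate c = (Const 1 30 # replicate (2 * c + 1) (Add 1 1 0)) @ [Store 1 2, Const 2 6] @
     concat (map (\<lambda>k. [Add 1 1 2, Store 1 k]) [3..<17]) @
     [Const 3 18] @ replicate (2 * c + 1) (Add 3 3 0) @
     [Const 5 2] @ replicate (2 * c + 1) (Add 5 5 0) @ [Const 4 17, Const 6 1]"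
    by (simp only: relocate_def append_Cons)
  ultimately have 1: "fold effect (relocate c) M = fold effect (concat (map (\<lambda>k. [Add 1 1 2, Store 1 k]) [3..<17]) @
     [Const 3 18] @ replicate (2 * c + 1) (Add 3 3 0) @
     [Const 5 2] @ replicate (2 * c + 1) (Add 5 5 0) @ [Const 4 17, Const 6 1])
     (fold effect [Store 1 2, Const 2 6] ?M1)"
    by (simp only: fold_append o_apply)
  let ?M2 = "(?M1(B + 12 := M 2))(2 := 6)"
  have "nat (int B + 12) = B + 12" by simp
  then have 2: "fold effect [Store 1 2, Const 2 6] ?M1 = ?M2" using B by simp
  have "moved M B 2 M" using M0 by (auto simp: moved_def)
  then have "moved M B (Suc 2) (?M1(B + 6 * 2 := M 2))"
    by (intro moved_Suc moved_reg) (use B M0 in auto)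
  from moved_reg[OF this, of 2 6] B have m2: "moved M B 3 ?M2" by simp
  define J where "J k M' \<longleftrightarrow> moved M B k M' \<and> M' 0 = int n \<and> M' 1 = int (B + 6 * (k - 1)) \<and> M' 2 = 6 \<and>
    (\<forall>a. k \<le> a \<and> a < 17 \<longrightarrow> M' a = M a)" for k M'
  have steps: "J (3 + q) (fold effect (concat (map (\<lambda>k. [Add 1 1 2, Store 1 k]) [3..<3 + q])) ?M2)" if "q \<le> 14" for q
    using that
  proof (induction q)
    case 0
    have "J 3 ?M2" unfolding J_def by (intro conjI m2) (use B M0 in auto)
    then show ?case
      by (simp only: add_0_right upt_conv_Nil[OF order_refl] list.map concat.simps fold_simps)
  next
    case (Suc q)
    let ?k = "3 + q"
    let ?N = "fold effect (concat (map (\<lambda>k. [Add 1 1 2, Store 1 k]) [3..<?k])) ?M2"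
    have JN: "J ?k ?N" by (rule Suc.IH) (use Suc.prems in simp)
    then have N: "?N 1 = int (B + 6 * (?k - 1))" "?N 2 = 6" "?N ?k = M ?k" "moved M B ?k ?N"
      using Suc.prems by (auto simp: J_def)
    have "fold effect (concat (map (\<lambda>k. [Add 1 1 2, Store 1 k]) [3..<3 + Suc q])) ?M2 =
        fold effect [Add 1 1 2, Store 1 ?k] ?N"
    proof -
      have "[3..<3 + Suc q] = [3..<3 + q] @ [3 + q]"
        by (simp only: add_Suc_right upt_Suc_append le_add1)
      then show ?thesis
        by (simp only: map_append concat_append fold_append o_apply list.map concat.simps append_Nil2)
    qed
    also have "\<dots> = (?N(1 := int (B + 6 * ?k)))(B + 6 * ?k := M ?k)"
    proof -
      have e1: "?N 1 + ?N 2 = int (B + 6 * ?k)" using N(1,2) by simp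
      have e2: "nat (int (B + 6 * ?k)) = B + 6 * ?k" by simp
      show ?thesis using N(3) by (simp only: fold_simps effect.simps e1 e2 fun_upd_same) simp
    qed
    finally have *: "fold effect (concat (map (\<lambda>k. [Add 1 1 2, Store 1 k]) [3..<3 + Suc q])) ?M2 =
        (?N(1 := int (B + 6 * ?k)))(B + 6 * ?k := M ?k)" .
    have "J (3 + Suc q) ((N'(1 := int (B + 6 * ?k)))(B + 6 * ?k := M ?k))" if N': "J ?k N'" for N'
    proof -
      have "moved M B (Suc ?k) ((N'(1 := int (B + 6 * ?k)))(B + 6 * ?k := M ?k))"
        by (intro moved_Suc moved_reg) (use B M0 N' in \<open>auto simp: J_def\<close>)
      then show ?thesis using N' B Suc.prems by (simp add: J_def)
    qed
    from this[OF JN] show ?case unfolding * .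
  qed
  have "(3::nat) + 14 = 17" by simp
  note last = steps[OF order_refl, unfolded this]
  define M3 where "M3 = fold effect (concat (map (\<lambda>k. [Add 1 1 2, Store 1 k]) [3..<17])) ?M2"
  have M3: "moved M B 17 M3" "M3 0 = int n" "M3 1 = int (B + 96)" "M3 2 = 6"
    using last[folded M3_def] by (simp_all add: J_def)
  define M4 where "M4 = M3(3 := int B, 5 := int ?L, 4 := 17, 6 := 1)"
  have "fold effect (relocate c) M = fold effect ([Const 3 18] @ replicate (2 * c + 1) (Add 3 3 0) @
     [Const 5 2] @ replicate (2 * c + 1) (Add 5 5 0) @ [Const 4 17, Const 6 1]) M3"
    unfolding 1 2 fold_append o_apply M3_def[symmetric] ..
  also have "\<dots> = M4"
  proof -
    have "fold effect (replicate q (Add 3 3 0)) X = X(3 := X 3 + int q * X 0)"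
      and "fold effect (replicate q (Add 5 5 0)) X = X(5 := X 5 + int q * X 0)" for q X
      by (rule fold_effect_replicate_Add; simp)+
    then show ?thesis
      by (simp only: fold_append o_apply fold_simps effect.simps append_Cons append_Nil)
        (simp add: M3(2) M4_def B_def fun_eq_iff algebra_simps)
  qed
  finally have fold4: "fold effect (relocate c) M = M4" .
  have bas: "list_all basic (relocate c)"
    by (auto simp: relocate_def list_all_iff)
  have l1: "lrun (Block (relocate c)) M (length (relocate c)) M4"
    using lrun.Block[OF bas, of M] fold4 by simp
  define I where "I k M' \<longleftrightarrow> moved M B (17 + k) M' \<and> M' 0 = int n \<and> M' 1 = int (B + 6 * (16 + k)) \<and> M' 2 = 6 \<and>
     M' 3 = int B \<and> M' 4 = int (17 + k) \<and> M' 5 = int ?L \<and> M' 6 = 1" for k M'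
  let ?is = "[Add 1 1 2, Load 7 4, Store 1 7, Add 4 4 6]"
  have "\<exists>M'. lrun (While_lt [] 4 5 (Block ?is)) M4 (((2 * c + 1) * n - 15) * (length ?is + 2) + 2) M' \<and>
      I ((2 * c + 1) * n - 15) M'"
  proof (rule lrun_count)
    have "moved M B 17 M4" unfolding M4_def by (intro moved_reg M3) (use B in auto)
    then show "I 0 M4" using M3 by (simp add: I_def M4_def)
    show "list_all basic ?is" by simp
    show "\<not> M' 4 < M' 5" if "I ((2 * c + 1) * n - 15) M'" for M'
    proof -
      have "M' 4 = int (17 + ((2 * c + 1) * n - 15))" "M' 5 = int ?L"
        using that unfolding I_def by blast+
      moreover have "?L \<le> 17 + ((2 * c + 1) * n - 15)" by linarith
      ultimately show ?thesis by (simp only: of_nat_less_iff not_less)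
    qed
  next
    fix k M' assume k: "k < (2 * c + 1) * n - 15" and IM: "I k M'"
    have kL: "17 + k < ?L" using k by linarith
    have mv: "moved M B (17 + k) M'" using IM by (simp add: I_def)
    \<comment> \<open>The source cell has not been overwritten: it belongs to the input, which ends
      below \<open>B\<close>, while all targets start at \<open>B\<close>.\<close>
    have "17 + k \<noteq> B + 6 * i" for i using kL B(2) by linarith
    moreover have "17 \<le> 17 + k" by simp
    ultimately have "M' (17 + k) = M (17 + k)" using mv unfolding moved_def by blast
    moreover have "M' 1 + M' 2 = int (B + 6 * (17 + k))" "M' 4 = int (17 + k)" "M' 6 = 1"
      using IM by (simp_all add: I_def)
    moreover define a where "a = B + 6 * (17 + k)"
    moreover have "nat (int a) = a" "nat (int (17 + k)) = 17 + k" by (simp_all only: nat_int)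
    moreover have "a \<noteq> 4" "a \<noteq> 6" using B by (simp_all add: a_def)
    ultimately have e: "fold effect ?is M' = M'(1 := int a, 7 := M (17 + k), a := M (17 + k), 4 := int (17 + Suc k))"
      by (simp del: of_nat_add) simp
    have "moved M B (17 + k) (M'(1 := int a, 7 := M (17 + k)))"
      by (intro moved_reg) (use IM B M0 in \<open>auto simp: I_def\<close>)
    then have "moved M B (Suc (17 + k)) ((M'(1 := int a, 7 := M (17 + k)))(a := M (17 + k)))"
      unfolding a_def by (rule moved_Suc) (use B M0 in simp_all)
    then have "moved M B (Suc (17 + k)) ((M'(1 := int a, 7 := M (17 + k)))(a := M (17 + k), 4 := int (Suc (17 + k))))"
      by (rule moved_reg) (use B in simp_all)
    then have "moved M B (17 + Suc k) (fold effect ?is M')"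
      unfolding e add_Suc_right .
    then have "I (Suc k) (fold effect ?is M')"
      using IM B unfolding e by (auto simp: I_def a_def)
    moreover have "M' 4 < M' 5"
    proof -
      have "M' 4 = int (17 + k)" "M' 5 = int ?L"
        using IM unfolding I_def by blast+
      with kL show ?thesis by (simp only: of_nat_less_iff)
    qed
    ultimately show "M' 4 < M' 5 \<and> I (Suc k) (fold effect ?is M')" by blast
  qed
  moreover have "length ?is + 2 = 6" by simp
  ultimately obtain M' where M': "lrun (While_lt [] 4 5 (Block ?is)) M4 (((2 * c + 1) * n - 15) * 6 + 2) M'"
    "I ((2 * c + 1) * n - 15) M'" by metis
  have "17 + ((2 * c + 1) * n - 15) = max 17 ?L" by simp
  with M'(2) have "M' 0 = int n \<and> M' 3 = int B \<and> moved M B (max 17 ?L) M'"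
    unfolding I_def by metis
  moreover have "lrun (prologue c) M (length (relocate c) + ((2 * c + 1) * n - 15) * 6 + 2) M'"
    unfolding prologue_def using lrun.Sq[OF l1 M'(1)] by (simp add: add.assoc)
  ultimately show ?thesis by blast
qed

section \<open>Writing the output\<close>

text \<open>The output covers the registers, so cells 2 to 16 are written last, by straight-line
  code that uses only cells 0 and 1.\<close>

definition restore :: "instr list" where
  "restore = [Const 1 2, Add 0 1 3, Const 1 6] @ concat (map (\<lambda>k. [Load k 0, Add 0 0 1]) [2..<17])"

text \<open>The loop fills the cells from 17 on while registers are still available. Its source
  pointer starts at offset 92, which is \<open>6 * 15 + slot aBEST\<close>, the bit that belongs in
  cell 17.\<close>

definition epilogue :: lcom where
  "epilogue = Sq (Block [Const 1 6, Const 2 1, Const 4 17, Const 5 2, Add 5 5 0, Const 6 92, Add 6 6 3])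
     (Sq (While_lt [] 4 5 (Block [Load 7 6, Store 4 7, Add 6 6 1, Add 4 4 2])) (Block restore))"

lemma epilogue_correct:
  assumes M: "M 0 = int n" "M 3 = int B" and B: "18 + n \<le> B"
  shows "\<exists>M'. lrun epilogue M (7 + ((n - 15) * 6 + 2 + length restore)) M' \<and>
    (\<forall>i<n. M' (2 + i) = M (B + 6 * i + 2))"
proof -
  let ?W = "\<lambda>i. M (B + 6 * i + 2)"
  let ?init = "[Const 1 6, Const 2 1, Const 4 17, Const 5 2, Add 5 5 0, Const 6 92, Add 6 6 3]"
  define M1 where "M1 = M(1 := 6, 2 := 1, 4 := 17, 5 := int (n + 2), 6 := int (B + 6 * 15 + 2))"
  have i1: "fold effect ?init M = M1"
    unfolding M1_def using M by (auto simp: fun_upd_def)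
  have i2: "length ?init = 7" and "list_all basic ?init" by simp_all
  from lrun.Block[OF this(2), of M] have l1: "lrun (Block ?init) M 7 M1"
    unfolding i1 i2 .
  let ?is = "[Load 7 6, Store 4 7, Add 6 6 1, Add 4 4 2]"
  define I where "I k M' \<longleftrightarrow> M' 1 = 6 \<and> M' 2 = 1 \<and> M' 3 = int B \<and> M' 4 = int (17 + k) \<and> M' 5 = int (n + 2) \<and>
     M' 6 = int (B + 6 * (15 + k) + 2) \<and> (\<forall>i. M' (B + 6 * i + 2) = ?W i) \<and>
     (\<forall>i. 15 \<le> i \<and> i < 15 + k \<longrightarrow> M' (2 + i) = ?W i)" for k M'
  have "\<exists>M'. lrun (While_lt [] 4 5 (Block ?is)) M1 ((n - 15) * (length ?is + 2) + 2) M' \<and> I (n - 15) M'"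
  proof (rule lrun_count)
    show "I 0 M1" using M B by (simp add: I_def M1_def)
    show "list_all basic ?is" by simp
    show "\<not> M' 4 < M' 5" if "I (n - 15) M'" for M'
      using that by (simp add: I_def)
  next
    fix k M' assume k: "k < n - 15" and IM: "I k M'"
    then have "M' (B + 6 * (15 + k) + 2) = ?W (15 + k)" unfolding I_def by blast
    moreover have "M' 6 = int (B + 6 * (15 + k) + 2)" "M' 4 = int (17 + k)"
      "M' 6 + M' 1 = int (B + 6 * (15 + Suc k) + 2)" "M' 4 + M' 2 = int (17 + Suc k)"
      using IM by (simp_all add: I_def)
    ultimately have e: "fold effect ?is M' = M'(7 := ?W (15 + k), 17 + k := ?W (15 + k),
        6 := int (B + 6 * (15 + Suc k) + 2), 4 := int (17 + Suc k))"
      by (simp only: fold_simps effect.simps nat_int) (rule ext, auto)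
    have "I (Suc k) (fold effect ?is M')"
      unfolding e I_def
    proof (intro conjI allI impI)
      fix i assume i: "15 \<le> i \<and> i < 15 + Suc k"
      show "(M'(7 := ?W (15 + k), 17 + k := ?W (15 + k),
        6 := int (B + 6 * (15 + Suc k) + 2), 4 := int (17 + Suc k))) (2 + i) = ?W i"
        using i IM by (cases "i = 15 + k") (auto simp: I_def)
    qed (use IM B k in \<open>auto simp: I_def\<close>)
    moreover have "M' 4 < M' 5" using IM k by (simp add: I_def)
    ultimately show "M' 4 < M' 5 \<and> I (Suc k) (fold effect ?is M')" by blast
  qed
  moreover have "length ?is + 2 = 6" by simp
  ultimately obtain M2 where M2: "lrun (While_lt [] 4 5 (Block ?is)) M1 ((n - 15) * 6 + 2) M2" "I (n - 15) M2"
    by metis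
  let ?M3 = "M2(1 := 6, 0 := int (B + 2))"
  have init3: "fold effect [Const 1 2, Add 0 1 3, Const 1 6] M2 = ?M3"
    using M2(2) by (auto simp: I_def)
  define J where "J q M' \<longleftrightarrow> M' 0 = int (B + 6 * q + 2) \<and> M' 1 = 6 \<and> (\<forall>i<q. M' (2 + i) = ?W i) \<and>
     (\<forall>a\<ge>17. M' a = M2 a)" for q M'
  have J: "J q (fold effect (concat (map (\<lambda>k. [Load k 0, Add 0 0 1]) [2..<2 + q])) ?M3)" if "q \<le> 15" for q
    using that
  proof (induction q)
    case 0
    then show ?case by (simp add: J_def)
  next
    case (Suc q)
    let ?N = "fold effect (concat (map (\<lambda>k. [Load k 0, Add 0 0 1]) [2..<2 + q])) ?M3"
    have JN: "J q ?N" by (rule Suc.IH) (use Suc.prems in simp)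
    have "M2 (B + 6 * q + 2) = ?W q" using M2(2) by (simp add: I_def)
    then have "?N 0 = int (B + 6 * q + 2)" "?N 1 = 6" "?N (B + 6 * q + 2) = ?W q"
      using JN B by (auto simp: J_def)
    then have "fold effect [Load (2 + q) 0, Add 0 0 1] ?N = ?N(2 + q := ?W q, 0 := int (B + 6 * Suc q + 2))"
      by (simp only: fold_simps effect.simps nat_int) (rule ext, auto)
    moreover have "fold effect (concat (map (\<lambda>k. [Load k 0, Add 0 0 1]) [2..<2 + Suc q])) ?M3 =
        fold effect [Load (2 + q) 0, Add 0 0 1] ?N"
    proof -
      have "[2..<2 + Suc q] = [2..<2 + q] @ [2 + q]"
        by (simp only: add_Suc_right upt_Suc_append le_add1)
      then show ?thesis
        by (simp only: map_append concat_append fold_append o_apply list.map concat.simps append_Nil2)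
    qed
    ultimately have *: "fold effect (concat (map (\<lambda>k. [Load k 0, Add 0 0 1]) [2..<2 + Suc q])) ?M3 =
        ?N(2 + q := ?W q, 0 := int (B + 6 * Suc q + 2))" by (simp only:)
    have "J (Suc q) (N'(2 + q := ?W q, 0 := int (B + 6 * Suc q + 2)))" if "J q N'" for N'
      using that Suc.prems by (auto simp: J_def less_Suc_eq)
    from this[OF JN] show ?case unfolding * .
  qed
  define M4 where "M4 = fold effect restore M2"
  have "(2::nat) + 15 = 17" by simp
  from J[OF order_refl, unfolded this] have "J 15 M4"
    unfolding M4_def restore_def fold_append o_apply init3 .
  then have "M4 (2 + i) = ?W i" if "i < n" for i
    using M2(2) that by (cases "i < 15") (auto simp: J_def I_def)
  moreover have "list_all basic restore" by (auto simp: restore_def list_all_iff)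
  then have "lrun (Block restore) M2 (length restore) M4"
    unfolding M4_def by (rule lrun.Block)
  from lrun.Sq[OF l1 lrun.Sq[OF M2(1) this]]
  have "lrun epilogue M (7 + ((n - 15) * 6 + 2 + length restore)) M4"
    unfolding epilogue_def .
  ultimately show ?thesis by blast
qed

section \<open>From a problem instance to a run of the machine\<close>

text \<open>If \<open>C0\<close> has only one word, \<open>min_dist C0\<close> is the
  \<open>Min\<close> of the empty set and carries no information; then every \<open>D\<close> bounds
  the distances, and a large one is taken.\<close>

lemma code_distance:
  assumes C: "linear_code d C0" and "0 < \<delta>" and "\<delta> * real (min_dist C0) > 2"
  obtains D where "\<delta> * real D > 2" "\<And>a b. a \<in> C0 \<Longrightarrow> b \<in> C0 \<Longrightarrow> a \<noteq> b \<Longrightarrow> D \<le> hamming a b"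
proof (cases "\<exists>a\<in>C0. \<exists>b\<in>C0. a \<noteq> b")
  case True
  let ?H = "{hamming a b | a b. a \<in> C0 \<and> b \<in> C0 \<and> a \<noteq> b}"
  have "C0 \<subseteq> {w. length w = d}" using C by (simp add: linear_code_def)
  moreover have "finite {w :: bool list. length w = d}"
    using finite_lists_length_eq[of "UNIV :: bool set" d] by simp
  ultimately have "finite C0" by (rule finite_subset)
  then have "finite ((\<lambda>(a, b). hamming a b) ` (C0 \<times> C0))" by blast
  then have "finite ?H" by (rule finite_subset[rotated]) auto
  then have "min_dist C0 \<le> hamming a b" if "a \<in> C0" "b \<in> C0" "a \<noteq> b" for a b
    unfolding min_dist_def using that by (intro Min_le) auto
  with assms(3) that show ?thesis by blast
next
  case False
  obtain D :: nat where "2 / \<delta> < real D" using reals_Archimedean2 by blast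
  then have "\<delta> * real D > 2" using assms(2) by (simp add: field_simps)
  with False that show ?thesis by blast
qed

lemma regular_edge_count:
  assumes "bip_regular n m E c d"
  shows "c * n = d * m"
proof -
  have E: "E \<subseteq> {..<n} \<times> {..<m}" and l: "\<And>i. i < n \<Longrightarrow> card (E `` {i}) = c"
    and r: "\<And>v. v < m \<Longrightarrow> card {i. (i, v) \<in> E} = d"
    using assms by (auto simp: bip_regular_def)
  have f: "finite (E `` {i})" "finite {i. (i, v) \<in> E}" for i v
    using E by (auto intro: finite_subset[of _ "{..<m}"] finite_subset[of _ "{..<n}"])
  have "E = (SIGMA i:{..<n}. E `` {i})" using E by auto
  then have "card E = (\<Sum>i<n. card (E `` {i}))" using f(1) card_SigmaI[of "{..<n}" "\<lambda>i. E `` {i}"] by simp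
  moreover have "E\<inverse> = (SIGMA v:{..<m}. {i. (i, v) \<in> E})" using E by auto
  then have "card (E\<inverse>) = (\<Sum>v<m. card {i. (i, v) \<in> E})"
    using f(2) card_SigmaI[of "{..<m}" "\<lambda>v. {i. (i, v) \<in> E}"] by simp
  ultimately show ?thesis using l r by (simp add: mult.commute)
qed

lemma expander_word_of_instance:
  assumes params: "0 < c" "0 < d" "0 < \<alpha>" "0 < \<delta>" "\<delta> \<le> 1" "linear_code d C0" "\<delta> * real D > 2"
    and D: "\<And>a b. a \<in> C0 \<Longrightarrow> b \<in> C0 \<Longrightarrow> a \<noteq> b \<Longrightarrow> D \<le> hamming a b"
    and G: "bip_expander n m E c d \<alpha> \<delta>" "adj_lists n m E c d nbL nbR"
    and xy: "length x = n" "y \<in> tanner n m d nbR C0" "real (hamming x y) \<le> \<alpha> * real n"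
  shows "expander_word c d C0 n m nbL nbR (\<lambda>i. i < n \<and> x ! i) \<alpha> \<delta> D (\<lambda>i. i < n \<and> y ! i)"
proof -
  have reg: "bip_regular n m E c d" using G by (simp add: bip_expander_def)
  then have E: "E \<subseteq> {..<n} \<times> {..<m}" by (simp add: bip_regular_def)
  have L: "bij_betw (nbL i) {..<c} (E `` {i})" if "i < n" for i
    using G(2) that by (simp add: adj_lists_def)
  have R: "bij_betw (nbR v) {..<d} {i. (i, v) \<in> E}" if "v < m" for v
    using G(2) that by (simp add: adj_lists_def)
  have L': "(\<exists>j<c. nbL i j = v) \<longleftrightarrow> (i, v) \<in> E" if "i < n" for i v
    using bij_betw_imp_surj_on[OF L[OF that]] by (auto simp: set_eq_iff image_iff Bex_def) (metis lessThan_iff)+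
  have R': "(\<exists>k<d. nbR v k = i) \<longleftrightarrow> (i, v) \<in> E" if "v < m" for i v
    using bij_betw_imp_surj_on[OF R[OF that]] by (auto simp: set_eq_iff image_iff Bex_def) (metis lessThan_iff)+
  have less: "nbL i j < m" if "i < n" "j < c" for i j
    using L'[OF that(1), of "nbL i j"] that E by auto
  have less': "nbR v k < n" if "v < m" "k < d" for v k
    using R'[OF that(1), of "nbR v k"] that E by auto
  interpret decoder_run c d C0 n m nbL nbR "\<lambda>i. i < n \<and> x ! i"
  proof
    show "replicate d False \<in> C0" using params by (simp add: linear_code_def)
    show "c * n = d * m" by (rule regular_edge_count[OF reg])
  qed (use less less' L' R' params in auto)
  show ?thesis
  proof
    show "length a = d" if "a \<in> C0" for a using that params(6) by (auto simp: linear_code_def)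
    show "inj_on (nbL i) {..<c}" if "i < n" for i using L[OF that] by (rule bij_betw_imp_inj_on)
    show "inj_on (nbR v) {..<d}" if "v < m" for v using R[OF that] by (rule bij_betw_imp_inj_on)
    show "unsat (\<lambda>i. i < n \<and> y ! i) = {}"
    proof -
      have "view (\<lambda>i. i < n \<and> y ! i) v = map (\<lambda>k. y ! nbR v k) [0..<d]" if "v < m" for v
        using less'[OF that] by (simp add: view_def)
      then show ?thesis using xy(2) by (auto simp: unsat_def tanner_def)
    qed
    have "{i. i < n \<and> (i < n \<and> x ! i) \<noteq> (i < n \<and> y ! i)} = {i. i < length x \<and> x ! i \<noteq> y ! i}"
      using xy(1) by auto
    then show "real (card {i. i < n \<and> (i < n \<and> x ! i) \<noteq> (i < n \<and> y ! i)}) \<le> \<alpha> * real n"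
      using xy(3) by (simp add: hamming_def)
    show "\<delta> * real c * real (card S) \<le> real (card {v. v < m \<and> (\<exists>k<d. nbR v k \<in> S)})"
      if "S \<subseteq> {..<n}" "real (card S) \<le> \<alpha> * real n" for S
    proof -
      have "E `` S = {v. v < m \<and> (\<exists>k<d. nbR v k \<in> S)}"
      proof (intro set_eqI iffI)
        fix v assume "v \<in> E `` S"
        then obtain i where i: "i \<in> S" "(i, v) \<in> E" by auto
        then have "v < m" using E by auto
        moreover from this i obtain k where "k < d" "nbR v k = i" using R' by blast
        ultimately show "v \<in> {v. v < m \<and> (\<exists>k<d. nbR v k \<in> S)}" using i by blast
      next
        fix v assume "v \<in> {v. v < m \<and> (\<exists>k<d. nbR v k \<in> S)}"
        then obtain k where k: "v < m" "k < d" "nbR v k \<in> S" by blast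
        then have "(nbR v k, v) \<in> E" using R'[of v "nbR v k"] by blast
        with k show "v \<in> E `` S" by blast
      qed
      then show ?thesis using G(1) that unfolding bip_expander_def by metis
    qed
  qed (use params D in auto)
qed

lemma input_cells:
  fixes c d n m :: nat and nbL nbR :: "nat \<Rightarrow> nat \<Rightarrow> nat" and x :: "bool list"
  assumes "c * n = d * m" "0 < d" "0 < c"
  defines "M \<equiv> input_mem c d n m nbL nbR x"
  shows "M 0 = int n" "0 \<le> M a" "2 + (2 * c + 1) * n \<le> a \<Longrightarrow> M a = 0"
    and "i < n \<Longrightarrow> M (2 + i) = int (of_bool (x ! i))"
    and "i < n \<Longrightarrow> j < c \<Longrightarrow> M (2 + j + n + c * i) = int (nbL i j)"
    and "v < m \<Longrightarrow> k < d \<Longrightarrow> M (2 + k + n + c * n + d * v) = int (nbR v k)"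
proof -
  have L: "2 + n + c * n + d * m = 2 + (2 * c + 1) * n" using assms(1) by simp
  show "M 0 = int n" by (simp add: M_def input_mem_def)
  show "0 \<le> M a" by (auto simp: M_def input_mem_def bit_int_def)
  show "2 + (2 * c + 1) * n \<le> a \<Longrightarrow> M a = 0"
    unfolding L[symmetric] by (auto simp: M_def input_mem_def)
  show "i < n \<Longrightarrow> M (2 + i) = int (of_bool (x ! i))"
    by (simp add: M_def input_mem_def bit_int_def)
  show "M (2 + j + n + c * i) = int (nbL i j)" if ij: "i < n" "j < c"
  proof -
    have "j + c * i < c * Suc i" using ij by simp
    also have "\<dots> \<le> c * n" using ij by (intro mult_le_mono2) simp
    finally have "j + c * i < c * n" .
    then show ?thesis using ij by (simp add: M_def input_mem_def)
  qed
  show "M (2 + k + n + c * n + d * v) = int (nbR v k)" if vk: "v < m" "k < d"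
  proof -
    have "k + d * v < d * Suc v" using vk by simp
    also have "\<dots> \<le> d * m" using vk by (intro mult_le_mono2) simp
    finally have "k + d * v < d * m" .
    then show ?thesis using vk by (simp add: M_def input_mem_def)
  qed
qed

lemma decoder_program:
  assumes good: "decoder_good c d C0 n m nbL nbR (\<lambda>i. i < n \<and> x ! i) ts ts1 Good (\<lambda>i. i < n \<and> y ! i)"
    and "0 < c" and x: "length x = n"
  defines "T \<equiv> length (relocate c) + (2 * c + 1) * 6 + decoder.decode_cost c d C0 ts ts1 + length restore + 17"
  shows "\<exists>k M'. lrun (Sq (prologue c) (Sq (tr (decoder.decode c d C0 ts ts1)) epilogue))
      (input_mem c d n m nbL nbR x) k M' \<and> k \<le> T * (n + 1) \<and> (\<forall>i<n. M' (2 + i) = bit_int (y ! i))"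
proof -
  interpret decoder_good c d C0 n m nbL nbR "\<lambda>i. i < n \<and> x ! i" ts ts1 Good "\<lambda>i. i < n \<and> y ! i"
    by (rule good)
  let ?M = "input_mem c d n m nbL nbR x"
  let ?B = "18 + (2 * c + 1) * n" and ?L = "2 + (2 * c + 1) * n"
  note inp = input_cells[OF edges(1,2) assms(2), where nbL = nbL and nbR = nbR and x = x]
  obtain M1 where M1: "lrun (prologue c) ?M (length (relocate c) + ((2 * c + 1) * n - 15) * 6 + 2) M1"
    "M1 0 = int n" "M1 3 = int ?B" "moved ?M ?B (max 17 ?L) M1"
    using prologue_correct[of ?M n c] inp(1,2) by blast
  define \<rho> where "\<rho> r = nat (M1 (cell r))" for r
  define \<sigma> where "\<sigma> a i = nat (M1 (?B + (6 * i + slot a)))" for a i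
  have nonneg: "0 \<le> M1 a" for a using M1(4) by (simp add: moved_def)
  have rep: "rep ?B (\<rho>, \<sigma>) M1"
    using nonneg M1(3) by (simp add: rep_def \<rho>_def \<sigma>_def)
  have IN: "\<sigma> aIN i = nat (?M i)" if "2 \<le> i" "i < ?L" for i
    using M1(4) that by (simp add: \<sigma>_def moved_def)
  \<comment> \<open>The other arrays lie beyond the input, in cells that are 0 at the start, and
    copying hits only cells of \<open>aIN\<close>.\<close>
  have zero: "\<sigma> a i = 0" if "a \<noteq> aIN" for a i
  proof -
    have "?B + (6 * i + slot a) \<noteq> ?B + 6 * j" for j
      using address_inj[of i a j aIN] that by simp
    moreover have "17 \<le> ?B + (6 * i + slot a)" by simp
    ultimately have "M1 (?B + (6 * i + slot a)) = ?M (?B + (6 * i + slot a))"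
      using M1(4) unfolding moved_def by blast
    moreover have "?M (?B + (6 * i + slot a)) = 0" by (rule inp(3)) simp
    ultimately show ?thesis by (simp add: \<sigma>_def)
  qed
  have st: "stat \<rho> \<sigma>"
    unfolding stat_def
  proof (intro conjI allI impI)
    show "\<rho> rN = n" using M1(2) by (simp add: \<rho>_def)
    fix i assume i: "i < n"
    show "\<sigma> aIN (2 + i) = of_bool (i < n \<and> x ! i)"
      using IN[of "2 + i"] inp(4)[OF i] i by simp
    fix j assume j: "j < c"
    have "j + c * i < c * Suc i" using j by simp
    also have "\<dots> \<le> c * n" using i by (intro mult_le_mono2) simp
    finally show "\<sigma> aIN (2 + j + n + c * i) = nbL i j"
      using IN[of "2 + j + n + c * i"] inp(5)[OF i j] by simp
  next
    fix v k assume v: "v < m" and k: "k < d"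
    have "k + d * v < d * Suc v" using k by simp
    also have "\<dots> \<le> d * m" using v by (intro mult_le_mono2) simp
    finally show "\<sigma> aIN (2 + k + n + c * n + d * v) = nbR v k"
      using IN[of "2 + k + n + c * n + d * v"] inp(6)[OF v k] edges(1) by simp
  qed
  have "\<forall>i. \<sigma> aWD i = 0" "\<forall>i. \<sigma> aPOS i = 0" using zero by simp_all
  from hwp_decode[OF st this] rep obtain k M2 s' where
    s': "lrun (tr (decode ts ts1)) M1 k M2" "k \<le> decode_cost ts ts1 * (n + 1)" "rep ?B s' M2"
      "case s' of (\<rho>', \<sigma>') \<Rightarrow> \<rho>' rN = n \<and> (\<forall>i<n. \<sigma>' aBEST i = of_bool (i < n \<and> y ! i))"
    unfolding hwp_def by blast
  obtain \<rho>' \<sigma>' where "s' = (\<rho>', \<sigma>')" by (cases s')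
  with s' have M2: "lrun (tr (decode ts ts1)) M1 k M2" "k \<le> decode_cost ts ts1 * (n + 1)"
      "rep ?B (\<rho>', \<sigma>') M2" "\<rho>' rN = n" "\<forall>i<n. \<sigma>' aBEST i = of_bool (i < n \<and> y ! i)"
    by simp_all
  have M2': "M2 0 = int n" "M2 3 = int ?B" "M2 (?B + 6 * i + 2) = int (\<sigma>' aBEST i)" for i
  proof -
    have r: "M2 (cell rN) = int (\<rho>' rN)" "M2 (?B + (6 * i + slot aBEST)) = int (\<sigma>' aBEST i)"
      using M2(3) unfolding rep_def fst_conv snd_conv by blast+
    show "M2 0 = int n" using r(1) M2(4) by simp
    show "M2 (?B + 6 * i + 2) = int (\<sigma>' aBEST i)" using r(2) by (simp add: add.assoc)
    show "M2 3 = int ?B" using M2(3) by (simp add: rep_def)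
  qed
  have "18 + n \<le> ?B" by simp
  from epilogue_correct[OF M2'(1,2) this] obtain M3 where
    M3: "lrun epilogue M2 (7 + ((n - 15) * 6 + 2 + length restore)) M3" "\<forall>i<n. M3 (2 + i) = M2 (?B + 6 * i + 2)"
    by blast
  have "\<forall>i<n. M3 (2 + i) = bit_int (y ! i)"
    using M3(2) M2'(3) M2(5) by (simp add: bit_int_def)
  moreover have "length (relocate c) + ((2 * c + 1) * n - 15) * 6 + 2 + (k + (7 + ((n - 15) * 6 + 2 + length restore)))
      \<le> T * (n + 1)"
  proof -
    have "length (relocate c) + ((2 * c + 1) * n - 15) * 6 + 2 + (k + (7 + ((n - 15) * 6 + 2 + length restore)))
      \<le> length (relocate c) + (2 * c + 1) * n * 6 + 2 + (decode_cost ts ts1 * (n + 1) + (7 + (n * 6 + 2 + length restore)))"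
      using M2(2) by (intro add_mono mult_le_mono) simp_all
    also have "\<dots> \<le> T * (n + 1)" unfolding T_def by (simp add: algebra_simps)
    finally show ?thesis .
  qed
  ultimately show ?thesis using lrun.Sq[OF M1(1) lrun.Sq[OF M2(1) M3(1)]] by blast
qed

theorem theorem4p7:
  fixes c d d0 :: nat and \<alpha> \<delta> :: real and C0 :: "bool list set"
  assumes "0 < c" and "0 < d"
    and "0 < \<alpha>" and "\<alpha> \<le> 1" and "0 < \<delta>" and "\<delta> \<le> 1"
    and "linear_code d C0" and "d0 = min_dist C0" and "\<delta> * real d0 > 2"
  shows "\<exists>(P :: instr list) (K :: nat).
     \<forall>n m E nbL nbR x y.
       bip_expander n m E c d \<alpha> \<delta> \<and> adj_lists n m E c d nbL nbR \<and>
       length x = n \<and> y \<in> tanner n m d nbR C0 \<and> real (hamming x y) \<le> \<alpha> * real n \<longrightarrow>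
       (let cf = (step P ^^ (K * (n + 1))) (0, input_mem c d n m nbL nbR x)
        in halted P cf \<and> (\<forall>i<n. snd cf (2 + i) = bit_int (y ! i)))"
proof -
  obtain D where D: "\<delta> * real D > 2" "\<And>a b. a \<in> C0 \<Longrightarrow> b \<in> C0 \<Longrightarrow> a \<noteq> b \<Longrightarrow> D \<le> hamming a b"
    using code_distance[OF assms(7,5)] assms(8,9) by blast
  \<comment> \<open>These are the values of \<open>rate\<close> and, below, of
    \<open>growth r\<close>. They are fixed before any graph is given, because \<open>r\<close> and
    \<open>r1\<close> determine the program.\<close>
  define \<eta> where "\<eta> = (\<delta> * D - 2) / (2 * 2 ^ d * D)"
  have "0 < D" using D(1) by (cases D) auto
  then have "0 < \<eta>" using D(1) by (simp add: \<eta>_def)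
  then have "1 - \<eta> < 1" by simp
  then obtain r where r: "(1 - \<eta>) ^ r < \<delta> / 4"
    using real_arch_pow_inv[of "\<delta> / 4" "1 - \<eta>"] assms(5) by auto
  define g where "g = (1 + real c) ^ r * 2 / (\<delta> * c)"
  have g: "0 < g * c" using assms(1,5) by (simp add: g_def)
  obtain r1 where r1: "(1 - \<eta>) ^ r1 < 1 / (g * c)"
    using real_arch_pow_inv[of "1 / (g * c)" "1 - \<eta>"] g \<open>1 - \<eta> < 1\<close> by auto
  have "finite {w :: bool list. length w = d}"
    using finite_lists_length_eq[of "UNIV :: bool set" d] by simp
  then have "finite (decoder.branches c d)" by (simp add: decoder.branches_def)
  then have "finite {\<tau>. set \<tau> \<subseteq> decoder.branches c d \<and> length \<tau> = r}" for r
    by (rule finite_lists_length_eq)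
  then obtain ts ts1 where ts: "set ts = {\<tau>. set \<tau> \<subseteq> decoder.branches c d \<and> length \<tau> = r}"
    "set ts1 = {\<tau>. set \<tau> \<subseteq> decoder.branches c d \<and> length \<tau> = r1}"
    using finite_list[of "{\<tau>. set \<tau> \<subseteq> decoder.branches c d \<and> length \<tau> = r}"]
      finite_list[of "{\<tau>. set \<tau> \<subseteq> decoder.branches c d \<and> length \<tau> = r1}"] by blast
  let ?p = "Sq (prologue c) (Sq (tr (decoder.decode c d C0 ts ts1)) epilogue)"
  let ?T = "length (relocate c) + (2 * c + 1) * 6 + decoder.decode_cost c d C0 ts ts1 + length restore + 17"
  show ?thesis
  proof (intro exI[of _ "compile 0 ?p"] exI[of _ ?T] allI impI, elim conjE)
    fix n m E nbL nbR and x y :: "bool list"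
    assume inst: "bip_expander n m E c d \<alpha> \<delta>" "adj_lists n m E c d nbL nbR"
      "length x = n" "y \<in> tanner n m d nbR C0" "real (hamming x y) \<le> \<alpha> * real n"
    interpret W: expander_word c d C0 n m nbL nbR "\<lambda>i. i < n \<and> x ! i" \<alpha> \<delta> D "\<lambda>i. i < n \<and> y ! i"
      by (rule expander_word_of_instance[OF assms(1,2,3,5,6,7) D inst])
    have rate: "W.rate = \<eta>" by (simp add: W.rate_def \<eta>_def)
    have growth: "W.growth r = g" by (simp add: W.growth_def g_def)
    have "g * c * (1 - \<eta>) ^ r1 \<le> 1"
      using r1 unfolding pos_less_divide_eq[OF g] by (simp add: mult.commute)
    then have "decoder_good c d C0 n m nbL nbR (\<lambda>i. i < n \<and> x ! i) ts ts1 (W.Good r) (\<lambda>i. i < n \<and> y ! i)"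
      using r by (intro W.decoder_good[OF ts]) (simp_all add: rate growth)
    from decoder_program[OF this assms(1) inst(3)] obtain k M' where
      k: "lrun ?p (input_mem c d n m nbL nbR x) k M'" "k \<le> ?T * (n + 1)" "\<forall>i<n. M' (2 + i) = bit_int (y ! i)"
      by blast
    from compile_halts[OF k(1,2)] k(3)
    show "let cf = (step (compile 0 ?p) ^^ (?T * (n + 1))) (0, input_mem c d n m nbL nbR x)
        in halted (compile 0 ?p) cf \<and> (\<forall>i<n. snd cf (2 + i) = bit_int (y ! i))"
      by simp
  qed
qed

end
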